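(* Let $m,j\in\frac12\mathbb{N}_{\rm odd}$ and $p\in\mathbb{Z}$ with $0\le p\le 2m$ and $0<j\le m$. Then for $\tau\in\mathbb{C}_+$: 1) ($S$-transformation) (i) $g^{(1)[m,p]}_j\big(-\tfrac1\tau\big)=\dfrac{\tau}{c_j\sqrt{m(m+\frac12)}}\displaystyle\sum_{\substack{\ell\in\frac12\mathbb{Z}_{\rm odd}\\ 0<\ell\le m}}\sum_{p'=0}^{2m}e^{-\frac{\pi i}{2(2m+1)}(2p+1)(2p'+1)}\sin\frac{\pi j\ell}{m}\,g^{(1)[m,p']}_\ell(\tau)$; (ii) $g^{(2)[m,p]}_j\big(-\tfrac1\tau\big)=\dfrac{i\,\tau}{c_j\sqrt{m(m+\frac12)}}\displaystyle\sum_{\substack{\ell\in\frac12\mathbb{Z}_{\rm odd}\\ 0<\ell\le m}}\sum_{p'=0}^{2m}e^{-\frac{\pi i}{2m+1}(2p+1)p'}\sin\frac{\pi j\ell}{m}\,g^{(3)[m,p']}_\ell(\tau)$; (iii) $g^{(3)[m,p]}_j\big(-\tfrac1\tau\big)=\dfrac{-i\,\tau}{c_j\sqrt{m(m+\frac12)}}\displaystyle\sum_{\substack{\ell\in\frac12\mathbb{Z}_{\rm odd}\\ 0<\ell\le m}}\sum_{p'=0}^{2m}e^{-\frac{\pi i}{2m+1}p(2p'+1)}\sin\frac{\pi j\ell}{m}\,g^{(2)[m,p']}_\ell(\tau)$. 2) ($T$-transformation) (i) $g^{(1)[m,p]}_j(\tau+1)=e^{\frac{\pi i(2p+1)^2}{4(2m+1)}-\frac{\pi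 ij^2}{2m}-\frac{\pi i}{4}}\,g^{(2)[m,p]}_j(\tau)$; (ii) $g^{(2)[m,p]}_j(\tau+1)=-e^{\frac{\pi i(2p+1)^2}{4(2m+1)}-\frac{\pi ij^2}{2m}-\frac{\pi i}{4}}\,g^{(1)[m,p]}_j(\tau)$; (iii) $g^{(3)[m,p]}_j(\tau+1)=e^{\frac{\pi ip^2}{2m+1}-\frac{\pi ij^2}{2m}}\,g^{(3)[m,p]}_j(\tau)$.
   Context: $\mathbb{C}_+=\{\tau\in\mathbb{C}:\mathrm{Im}\,\tau>0\}$, $q=e^{2\pi i\tau}$, and $q^x:=e^{2\pi i\tau x}$ for real $x$. $\frac12\mathbb{Z}_{\rm odd}=\{n/2:n\in\mathbb{Z}\text{ odd}\}$, $\frac12\mathbb{N}_{\rm odd}=\{n/2:n\text{ a positive odd integer}\}$. For $M\in\frac12\mathbb{Z}_{>0}$ and $k\in\frac12\mathbb{Z}$, $\theta^{(\pm)}_{k,M}(\tau,z)=\sum_{n\in\mathbb{Z}}(\pm1)^n e^{2\pi iM(n+\frac{k}{2M})z}q^{M(n+\frac{k}{2M})^2}$ and $\theta_{k,M}:=\theta^{(+)}_{k,M}$. For $j\in\frac12\mathbb{Z}_{\rm odd}$ with $0<j\le m$: $c_j=1$ if $j<m$ and $c_j=2$ if $j=m$. For finite or absolutely convergent families, write $\big[\sum_{A}-\sum_{B}\big]F(j,r)$ for $\sum_{(j,r)\in A}F(j,r)-\sum_{(j,r)\in B}F(j,r)$, where $A,B$ are sets of pairs $(j,r)\in\mathbb{Z}^2$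 given by the displayed inequalities. For $m\in\frac12\mathbb{N}_{\rm odd}$, $p\in\mathbb{Z}$, $0\le p\le 2m$, put $\alpha=\frac{m(2p+1)}{2m+1}$, $\beta=\frac{2mp}{2m+1}$, and define, for $k\in\frac12\mathbb{Z}_{\rm odd}$ with $0<k<m$: $g^{(1)[m,p]}_k(\tau)=\big[\sum_{0\le r<j}-\sum_{j\le r<0}\big](-1)^je^{\pi ik}q^{(m+\frac12)(j+\alpha)^2-m(r+p+\frac{m+k}{2m})^2}+\big[\sum_{0\le r\le j}-\sum_{j<r<0}\big](-1)^je^{\pi ik}q^{(m+\frac12)(j+\alpha)^2-m(r+p+\frac{m-k}{2m})^2}+\theta^{(-)}_{(2p+1)m,m+\frac12}(\tau,0)\sum_{r\in\mathbb{Z},\,-p<r\le p}e^{\pi ik}q^{-m(r+\frac{k-m}{2m})^2}$; $g^{(2)[m,p]}_k(\tau)=(-1)^p\big[\sum_{0\le r<j}-\sum_{j\le r<0}\big](-1)^rq^{(m+\frac12)(j+\alpha)^2-m(r+p+\frac{m+k}{2m})^2}-(-1)^p\big[\sum_{0\le r\le j}-\sum_{j<r<0}\big](-1)^rq^{(m+\frac12)(j+\alpha)^2-m(r+p+\frac{m-k}{2m})^2}-\theta_{(2p+1)m,m+\frac12}(\tau,0)\sum_{-p<r\le p}(-1)^rq^{-m(r+\frac{k-m}{2m})^2}$; $g^{(3)[m,p]}_k(\tau)=\big[\sum_{0\le r<j}-\sum_{j\le r<0}\big](-1)^je^{\pi ik}q^{(m+\frac12)(j+\beta)^2-m(r+p+\frac{k}{2m})^2}+\big[\sum_{0\le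 r\le j}-\sum_{j<r<0}\big](-1)^je^{\pi ik}q^{(m+\frac12)(j+\beta)^2-m(r+p-\frac{k}{2m})^2}+\theta^{(-)}_{2pm,m+\frac12}(\tau,0)\sum_{-p<r<p}e^{\pi ik}q^{-\frac{(2mr+k)^2}{4m}}$; and for $k=m$: $g^{(1)[m,p]}_m(\tau)=\big[\sum_{0<r\le j}-\sum_{j<r\le0}\big](-1)^je^{\pi im}q^{(m+\frac12)(j+\alpha)^2-m(r+p)^2}+\frac12e^{\pi im}\theta^{(-)}_{(2p+1)m,m+\frac12}(\tau,0)\sum_{-p\le r\le p}q^{-mr^2}$; $g^{(2)[m,p]}_m(\tau)=-(-1)^p\big[\sum_{0<r\le j}-\sum_{j<r\le0}\big](-1)^rq^{(m+\frac12)(j+\alpha)^2-m(r+p)^2}-\frac12\theta_{(2p+1)m,m+\frac12}(\tau,0)\sum_{-p\le r\le p}(-1)^rq^{-mr^2}$; $g^{(3)[m,p]}_m(\tau)=e^{\pi im}\big[\sum_{0<r\le j}-\sum_{j<r\le0}\big](-1)^jq^{(m+\frac12)(j+\beta)^2-m(r-\frac12+p)^2}+e^{\pi im}\theta^{(-)}_{2pm,m+\frac12}(\tau,0)\sum_{r=1}^{p}q^{-\frac m4(2r-1)^2}$. (In all these, $j,r$ range over $\mathbb{Z}$.)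
   Formalization: For p=0 and k<m, the sum over −p<r<p in g^(3)[m,0]_k is read as minus its r=0 term instead of as an empty sum, so that g^(3)[m,0]_k=0; with the empty sum, S-transformations (ii) and (iii) are false for m≥3/2. *)

theory Defs
  imports "HOL-Analysis.Analysis"
begin

definition half_odd_ints :: "real set" where
  "half_odd_ints = {real_of_int n / 2 | n. odd n}"

definition half_odd_nats :: "real set" where
  "half_odd_nats = {real_of_int n / 2 | n. odd n \<and> 0 < n}"

text \<open>\<open>qpow \<tau> x\<close> is $q^x$ with $q = e^{2\pi i\tau}$; for non-integral \<open>x\<close> it depends on \<open>\<tau>\<close>,
  not only on $q$.\<close>

definition qpow :: "complex \<Rightarrow> real \<Rightarrow> complex" where
  "qpow \<tau> x = exp (2 * of_real pi * \<i> * \<tau> * of_real x)"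

definition theta_sgn :: "complex \<Rightarrow> real \<Rightarrow> real \<Rightarrow> complex \<Rightarrow> complex \<Rightarrow> complex" where
  "theta_sgn \<epsilon> k M \<tau> z =
     (\<Sum>\<^sub>\<infinity>n::int. \<epsilon> powi n
        * exp (2 * of_real pi * \<i> * of_real (M * (of_int n + k / (2 * M))) * z)
        * qpow \<tau> (M * (of_int n + k / (2 * M))\<^sup>2))"

text \<open>$\theta_{k,M} = \theta^{(+)}_{k,M}$ and $\theta^{(-)}_{k,M}$.\<close>

abbreviation theta :: "real \<Rightarrow> real \<Rightarrow> complex \<Rightarrow> complex \<Rightarrow> complex" where
  "theta \<equiv> theta_sgn 1"

abbreviation theta_minus :: "real \<Rightarrow> real \<Rightarrow> complex \<Rightarrow> complex \<Rightarrow> complex" where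
  "theta_minus \<equiv> theta_sgn (-1)"

definition cfac :: "real \<Rightarrow> real \<Rightarrow> real" where
  "cfac m j = (if j < m then 1 else 2)"

text \<open>The bracket $[\sum_A - \sum_B] F(j,r)$ for sets of pairs \<open>(j, r)\<close> given by predicates.\<close>

definition bracket ::
  "(int \<Rightarrow> int \<Rightarrow> bool) \<Rightarrow> (int \<Rightarrow> int \<Rightarrow> bool) \<Rightarrow> (int \<Rightarrow> int \<Rightarrow> complex) \<Rightarrow> complex" where
  "bracket A B F =
     (\<Sum>\<^sub>\<infinity>(j, r)\<in>{(j, r). A j r}. F j r) - (\<Sum>\<^sub>\<infinity>(j, r)\<in>{(j, r). B j r}. F j r)"

definition galpha :: "real \<Rightarrow> int \<Rightarrow> real" where
  "galpha m p = m * (2 * of_int p + 1) / (2 * m + 1)"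

definition gbeta :: "real \<Rightarrow> int \<Rightarrow> real" where
  "gbeta m p = 2 * m * of_int p / (2 * m + 1)"

text \<open>The functions $g^{(i)[m,p]}_k$ are meant for \<open>0 < k \<le> m\<close>; the second branch of each definition
  is the case \<open>k = m\<close>.\<close>

definition g1 :: "real \<Rightarrow> int \<Rightarrow> real \<Rightarrow> complex \<Rightarrow> complex" where
  "g1 m p k \<tau> =
    (if k < m then
       bracket (\<lambda>j r. 0 \<le> r \<and> r < j) (\<lambda>j r. j \<le> r \<and> r < 0)
         (\<lambda>j r. (-1) powi j * exp (of_real pi * \<i> * of_real k)
            * qpow \<tau> ((m + 1/2) * (of_int j + galpha m p)\<^sup>2
                      - m * (of_int r + of_int p + (m + k) / (2 * m))\<^sup>2))
     + bracket (\<lambda>j r. 0 \<le> r \<and> r \<le> j) (\<lambda>j r. j < r \<and> r < 0)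
         (\<lambda>j r. (-1) powi j * exp (of_real pi * \<i> * of_real k)
            * qpow \<tau> ((m + 1/2) * (of_int j + galpha m p)\<^sup>2
                      - m * (of_int r + of_int p + (m - k) / (2 * m))\<^sup>2))
     + theta_minus ((2 * of_int p + 1) * m) (m + 1/2) \<tau> 0
         * (\<Sum>r\<in>{-p<..p}. exp (of_real pi * \<i> * of_real k)
              * qpow \<tau> (- m * (of_int r + (k - m) / (2 * m))\<^sup>2))
     else
       bracket (\<lambda>j r. 0 < r \<and> r \<le> j) (\<lambda>j r. j < r \<and> r \<le> 0)
         (\<lambda>j r. (-1) powi j * exp (of_real pi * \<i> * of_real m)
            * qpow \<tau> ((m + 1/2) * (of_int j + galpha m p)\<^sup>2 - m * (of_int r + of_int p)\<^sup>2))
     + 1/2 * exp (of_real pi * \<i> * of_real m)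
         * theta_minus ((2 * of_int p + 1) * m) (m + 1/2) \<tau> 0
         * (\<Sum>r\<in>{-p..p}. qpow \<tau> (- m * (of_int r)\<^sup>2)))"

definition g2 :: "real \<Rightarrow> int \<Rightarrow> real \<Rightarrow> complex \<Rightarrow> complex" where
  "g2 m p k \<tau> =
    (if k < m then
       (-1) powi p * bracket (\<lambda>j r. 0 \<le> r \<and> r < j) (\<lambda>j r. j \<le> r \<and> r < 0)
         (\<lambda>j r. (-1) powi r
            * qpow \<tau> ((m + 1/2) * (of_int j + galpha m p)\<^sup>2
                      - m * (of_int r + of_int p + (m + k) / (2 * m))\<^sup>2))
     - (-1) powi p * bracket (\<lambda>j r. 0 \<le> r \<and> r \<le> j) (\<lambda>j r. j < r \<and> r < 0)
         (\<lambda>j r. (-1) powi r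
            * qpow \<tau> ((m + 1/2) * (of_int j + galpha m p)\<^sup>2
                      - m * (of_int r + of_int p + (m - k) / (2 * m))\<^sup>2))
     - theta ((2 * of_int p + 1) * m) (m + 1/2) \<tau> 0
         * (\<Sum>r\<in>{-p<..p}. (-1) powi r * qpow \<tau> (- m * (of_int r + (k - m) / (2 * m))\<^sup>2))
     else
       - ((-1) powi p) * bracket (\<lambda>j r. 0 < r \<and> r \<le> j) (\<lambda>j r. j < r \<and> r \<le> 0)
         (\<lambda>j r. (-1) powi r
            * qpow \<tau> ((m + 1/2) * (of_int j + galpha m p)\<^sup>2 - m * (of_int r + of_int p)\<^sup>2))
     - 1/2 * theta ((2 * of_int p + 1) * m) (m + 1/2) \<tau> 0
         * (\<Sum>r\<in>{-p..p}. (-1) powi r * qpow \<tau> (- m * (of_int r)\<^sup>2)))"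

text \<open>For \<open>k < m\<close> the last sum of $g^{(3)[m,p]}_k$ is the oriented sum $\sum_{-p<r<p}$, i.e.
  $[\sum_{-p<r<p} - \sum_{p\le r\le -p}]$ as in the brackets above. For \<open>p \<ge> 1\<close> the subtracted
  sum is empty. For \<open>p = 0\<close> it consists of the single term \<open>r = 0\<close>, which cancels the brackets,
  so that $g^{(3)[m,0]}_k = 0$; reading $\sum_{-0<r<0}$ as an empty sum instead would give
  $g^{(3)[m,0]}_k = e^{\pi ik}\theta^{(-)}_{0,m+1/2}(\tau,0) q^{-k^2/4m}$, for which the
  $S$-transformation formulas fail.\<close>

definition g3 :: "real \<Rightarrow> int \<Rightarrow> real \<Rightarrow> complex \<Rightarrow> complex" where
  "g3 m p k \<tau> =
    (if k < m then
       bracket (\<lambda>j r. 0 \<le> r \<and> r < j) (\<lambda>j r. j \<le> r \<and> r < 0)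
         (\<lambda>j r. (-1) powi j * exp (of_real pi * \<i> * of_real k)
            * qpow \<tau> ((m + 1/2) * (of_int j + gbeta m p)\<^sup>2
                      - m * (of_int r + of_int p + k / (2 * m))\<^sup>2))
     + bracket (\<lambda>j r. 0 \<le> r \<and> r \<le> j) (\<lambda>j r. j < r \<and> r < 0)
         (\<lambda>j r. (-1) powi j * exp (of_real pi * \<i> * of_real k)
            * qpow \<tau> ((m + 1/2) * (of_int j + gbeta m p)\<^sup>2
                      - m * (of_int r + of_int p - k / (2 * m))\<^sup>2))
     + theta_minus (2 * of_int p * m) (m + 1/2) \<tau> 0
         * ((\<Sum>r\<in>{-p<..<p}. exp (of_real pi * \<i> * of_real k)
               * qpow \<tau> (- ((2 * m * of_int r + k)\<^sup>2 / (4 * m))))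
           - (\<Sum>r\<in>{p..-p}. exp (of_real pi * \<i> * of_real k)
               * qpow \<tau> (- ((2 * m * of_int r + k)\<^sup>2 / (4 * m)))))
     else
       exp (of_real pi * \<i> * of_real m)
         * bracket (\<lambda>j r. 0 < r \<and> r \<le> j) (\<lambda>j r. j < r \<and> r \<le> 0)
             (\<lambda>j r. (-1) powi j
                * qpow \<tau> ((m + 1/2) * (of_int j + gbeta m p)\<^sup>2
                          - m * (of_int r - 1/2 + of_int p)\<^sup>2))
     + exp (of_real pi * \<i> * of_real m) * theta_minus (2 * of_int p * m) (m + 1/2) \<tau> 0
         * (\<Sum>r\<in>{1..p}. qpow \<tau> (- (m / 4) * (2 * of_int r - 1)\<^sup>2)))"

lemma finite_half_odd_ints_bounded: "finite {l \<in> half_odd_ints. 0 < l \<and> l \<le> m}"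
proof -
  have "{l \<in> half_odd_ints. 0 < l \<and> l \<le> m} \<subseteq> (\<lambda>n. real_of_int n / 2) ` {0..\<lfloor>2 * m\<rfloor>}"
    by (auto simp: half_odd_ints_def le_floor_iff)
  then show ?thesis
    by (rule finite_subset) simp
qed

end

theory Submission
  imports Defs "HOL-Complex_Analysis.Complex_Analysis" "HOL-Probability.Probability"
begin

text \<open>
  With \<open>N = 2m\<close>, reflecting the second bracket in \<open>y \<mapsto> -y\<close> and absorbing the theta correction turns every
  \<open>g\<close> into a Hecke sum \<open>\<Sum> \<plusminus> w(x, y) q\<close>-power of \<open>Q(x, y) = ((N + 1)x\<^sup>2 - N y\<^sup>2) / 2\<close> over a coset of
  \<open>\<int>\<^sup>2\<close>, where \<open>w\<close> is, up to finitely many lines parallel to \<open>(1, \<plusminus>1)\<close>, the signed indicator of the cone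
  \<open>|y| < |x|\<close>. The vectors \<open>(1, \<plusminus>1)\<close> have \<open>Q = 1/2\<close>, and the reflections in them preserve the coset and
  flip the sign character, so a weight depending on \<open>x - y\<close> alone, or on \<open>x + y\<close> alone, contributes \<open>0\<close>.
  Hence for \<open>\<tau> = it\<close> the sign functions in \<open>w\<close> may be replaced by error functions of
  \<open>(2\<pi>N(N + 1)t)\<^sup>1\<^sup>/\<^sup>2 (x \<plusminus> y)\<close>. The resulting kernel is \<open>\<integral> x exp(-\<pi>t(2Q + 2N(N + 1)(y - sx)\<^sup>2)) ds\<close> over
  \<open>-1 \<le> s \<le> 1\<close>; Poisson summation for each fixed \<open>s\<close> produces an integrand that is again an exact derivative
  in \<open>s\<close>, so the kernel is self-dual. This is the \<open>S\<close>-transformation on the imaginary axis, and the identity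
  theorem extends it to the upper half-plane. The \<open>T\<close>-transformation holds term by term.
\<close>

section \<open>Fourier uniqueness and Poisson summation\<close>

text \<open>All three families are instances of one function \<open>hecke_theta N e P i\<close>: the
  parity of \<open>P\<close> selects the coset, the parity of \<open>e\<close> the sign character,
  (-1)^j for odd \<open>e\<close> and (-1)^r for even \<open>e\<close>. Poisson summation turns
  shifts into characters and conversely, so S exchanges \<open>P\<close> and \<open>e\<close>, while
  T replaces \<open>e\<close> by \<open>e + P\<close>. The parities (P, e) = (1, 1), (1, 0), (0, 1)
  of g1, g2, g3 are thus permuted, and (0, 0), where no sines would arise, never occurs.

  The obstacle is that Q is indefinite and the weight jumps, so Poisson summation does not apply to
  the Hecke sum directly. In Zwegers' smoothing each sign becomes an error function attached to a
  negative vector, at the usual price of a non-holomorphic correction. Here the negative vectors (N,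
  N + 1) and (N, - N - 1) are orthogonal to (1, 1) and (1, -1). This is why the error terms depend
  on x - y or on x + y alone and cancel; the norm -N(N + 1) of these vectors is the origin of the
  constant N(N + 1) in the error functions.\<close>

lemma summable_on_intI:
  fixes f :: "int \<Rightarrow> 'a :: banach"
  assumes "(\<lambda>n. f (int n)) summable_on UNIV" "(\<lambda>n. f (- int n)) summable_on UNIV"
  shows "f summable_on UNIV"
proof -
  have "f summable_on range int"
    by (subst summable_on_reindex) (use assms(1) in \<open>auto simp: o_def inj_def\<close>)
  moreover have "f summable_on range (\<lambda>n. - int n)"
    by (subst summable_on_reindex) (use assms(2) in \<open>auto simp: o_def inj_def\<close>)
  then have "f summable_on (range (\<lambda>n. - int n) - {0})"
    by (rule summable_on_subset_banach) auto
  ultimately have "f summable_on (range int \<union> (range (\<lambda>n. - int n) - {0}))"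
    by (rule summable_on_Un_disjoint) auto
  moreover have "range int \<union> (range (\<lambda>n. - int n) - {0}) = UNIV"
    by (auto, metis int_cases2 rangeI)
  ultimately show ?thesis by simp
qed

lemma summable_on_exp_abs_int: "(\<lambda>n::int. exp (- \<bar>real_of_int n\<bar>)) summable_on UNIV"
proof -
  have "summable (\<lambda>n. exp (- 1 :: real) ^ n)"
    by (rule summable_geometric) simp
  then have "summable (\<lambda>n. exp (- real n))"
    by (simp add: exp_of_nat_mult [symmetric])
  then have "(\<lambda>n. exp (- real n)) summable_on UNIV"
    by (intro norm_summable_imp_summable_on) simp
  then show ?thesis
    by (intro summable_on_intI) simp_all
qed

lemma summable_on_real_comparison:
  fixes f :: "'a \<Rightarrow> 'b :: banach" and g :: "'a \<Rightarrow> real"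
  assumes "g summable_on A" "\<And>x. x \<in> A \<Longrightarrow> norm (f x) \<le> C * g x"
  shows "f summable_on A"
proof -
  have "(\<lambda>x. norm (f x)) summable_on A"
    by (rule summable_on_comparison_test [OF summable_on_cmult_right [OF assms(1), of C]])
       (use assms(2) in auto)
  then show ?thesis
    by (rule abs_summable_summable)
qed

text \<open>Expanding the square of \<open>c * (n + s) - sgn n / 2\<close>, divided by
  \<open>c\<close>, bounds the Gaussian exponent below by \<open>\<bar>n\<bar>\<close> up to a
  constant. Gaussian series over the integers thereby reduce to a geometric series.\<close>

lemma gaussian_le_exp_abs:
  fixes c s :: real
  assumes "c > 0"
  obtains C where "\<And>n. exp (- c * (n + s)\<^sup>2) \<le> C * exp (- \<bar>n\<bar>)"
proof
  fix n :: real
  have "0 \<le> (c * (n + s) - sgn n / 2)\<^sup>2 / c"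
    using assms by simp
  also have "\<dots> = c * (n + s)\<^sup>2 - (n + s) * sgn n + (sgn n)\<^sup>2 / (4 * c)"
    using assms by (simp add: power2_eq_square field_simps)
  also have "\<dots> \<le> c * (n + s)\<^sup>2 - \<bar>n\<bar> + \<bar>s\<bar> + 1 / (4 * c)"
  proof (cases "n = 0")
    case True
    have "0 \<le> \<bar>s\<bar> + 1 / (4 * c)" using assms by simp
    with True show ?thesis by simp
  qed (auto simp: sgn_if abs_if)
  finally show "exp (- c * (n + s)\<^sup>2) \<le> exp (\<bar>s\<bar> + 1 / (4 * c)) * exp (- \<bar>n\<bar>)"
    by (simp flip: exp_add)
qed

lemma summable_on_gaussian_int:
  fixes c s :: real
  assumes "c > 0"
  shows "(\<lambda>n::int. exp (- c * (of_int n + s)\<^sup>2)) summable_on UNIV"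
proof -
  obtain C where C: "\<And>n. exp (- c * (n + s)\<^sup>2) \<le> C * exp (- \<bar>n\<bar>)"
    using gaussian_le_exp_abs [OF assms] by blast
  show ?thesis
    by (rule summable_on_real_comparison [OF summable_on_exp_abs_int, of _ C]) (use C in auto)
qed

lemma summable_on_product:
  fixes f :: "'a \<Rightarrow> real" and g :: "'b \<Rightarrow> real"
  assumes "f summable_on A" "g summable_on B" "\<And>x. x \<in> A \<Longrightarrow> f x \<ge> 0" "\<And>y. y \<in> B \<Longrightarrow> g y \<ge> 0"
  shows "(\<lambda>(x, y). f x * g y) summable_on A \<times> B"
proof (rule summable_on_SigmaI)
  show "((\<lambda>y. case (x, y) of (x, y) \<Rightarrow> f x * g y) has_sum f x * infsum g B) B" for x
    using assms(2) by (simp add: has_sum_cmult_right)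
  show "(\<lambda>x. f x * infsum g B) summable_on A"
    using assms(1) by (rule summable_on_cmult_left)
qed (use assms in auto)

lemma summable_on_gaussian_int2:
  fixes c d a b :: real
  assumes "c > 0" "d > 0"
  shows "(\<lambda>(j, r). exp (- c * (of_int j + a)\<^sup>2) * exp (- d * (of_int r + b)\<^sup>2))
           summable_on (UNIV :: (int \<times> int) set)"
  using summable_on_product [OF summable_on_gaussian_int [OF assms(1), of a]
      summable_on_gaussian_int [OF assms(2), of b]] by simp

text \<open>Weierstrass M-test along the net of finite index sets: convergence is uniform, so the
  sum is continuous and may be integrated termwise. It serves twice, for Fourier coefficients and
  for the parameter \<open>s\<close> of the Hecke kernel.\<close>

lemma has_sum_integral:
  fixes f :: "'a \<Rightarrow> real \<Rightarrow> complex"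
  assumes cont: "\<And>i. i \<in> I \<Longrightarrow> continuous_on {a..b} (f i)"
    and bound: "\<And>i x. i \<in> I \<Longrightarrow> x \<in> {a..b} \<Longrightarrow> norm (f i x) \<le> M i"
    and "M summable_on I"
  shows "((\<lambda>i. integral {a..b} (f i)) has_sum integral {a..b} (\<lambda>x. \<Sum>\<^sub>\<infinity>i\<in>I. f i x)) I"
    and "continuous_on {a..b} (\<lambda>x. \<Sum>\<^sub>\<infinity>i\<in>I. f i x)"
proof -
  \<comment> \<open>The hypotheses concern only indices in \<open>I\<close>, while the limit
    theorems ask for continuity at every index set; partial sums over sets not inside
    \<open>I\<close> are therefore replaced by 0.\<close>
  let ?f = "\<lambda>X x. if X \<subseteq> I then \<Sum>i\<in>X. f i x else 0"
  have ev: "eventually (\<lambda>X. finite X \<and> X \<subseteq> I) (finite_subsets_at_top I)"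
    by (auto simp: eventually_finite_subsets_at_top)
  have "uniform_limit {a..b} (\<lambda>X x. \<Sum>i\<in>X. f i x) (\<lambda>x. \<Sum>\<^sub>\<infinity>i\<in>I. f i x) (finite_subsets_at_top I)"
    by (rule Weierstrass_m_test_general [OF bound]) (use assms in auto)
  then have u: "uniform_limit {a..b} ?f (\<lambda>x. \<Sum>\<^sub>\<infinity>i\<in>I. f i x) (finite_subsets_at_top I)"
    by (rule uniform_limit_cong [THEN iffD1, rotated 2])
       (use ev in \<open>auto elim!: eventually_mono\<close>)
  have c: "continuous_on {a..b} (?f X)" for X
    by (cases "X \<subseteq> I") (auto intro!: continuous_intros cont)
  obtain J K where J: "\<And>X. (?f X has_integral J X) {a..b}"
      and K: "((\<lambda>x. \<Sum>\<^sub>\<infinity>i\<in>I. f i x) has_integral K) {a..b}"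
      and JK: "(J \<longlongrightarrow> K) (finite_subsets_at_top I)"
    using uniform_limit_integral [OF u c] by auto
  have "J X = (\<Sum>i\<in>X. integral {a..b} (f i))" if "finite X \<and> X \<subseteq> I" for X
  proof -
    have "J X = integral {a..b} (?f X)"
      using integral_unique [OF J] by simp
    also have "\<dots> = (\<Sum>i\<in>X. integral {a..b} (f i))"
      using that cont by (simp add: integral_sum integrable_continuous_interval subset_iff)
    finally show ?thesis .
  qed
  with ev have "eventually (\<lambda>X. J X = (\<Sum>i\<in>X. integral {a..b} (f i))) (finite_subsets_at_top I)"
    by (auto elim!: eventually_mono)
  with JK have "((\<lambda>X. \<Sum>i\<in>X. integral {a..b} (f i)) \<longlongrightarrow> K) (finite_subsets_at_top I)"
    by (rule Lim_transform_eventually)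
  with K show "((\<lambda>i. integral {a..b} (f i)) has_sum integral {a..b} (\<lambda>x. \<Sum>\<^sub>\<infinity>i\<in>I. f i x)) I"
    by (simp add: has_sum_def integral_unique)
  show "continuous_on {a..b} (\<lambda>x. \<Sum>\<^sub>\<infinity>i\<in>I. f i x)"
    by (rule uniform_limit_theorem [OF _ u]) (use c in auto)
qed

section \<open>Fourier coefficients determine a continuous function on the unit interval\<close>

lemma integral_cis_int:
  fixes k :: int
  shows "integral {0..1} (\<lambda>x. cis (2 * pi * of_int k * x)) = (if k = 0 then 1 else 0)"
proof (cases "k = 0")
  case False
  define F where "F = (\<lambda>x::real. cis (2 * pi * of_int k * x) / (2 * pi * \<i> * of_int k))"
  have "((\<lambda>x. cis (2 * pi * of_int k * x)) has_integral (F 1 - F 0)) {0..1}"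
  proof (rule fundamental_theorem_of_calculus)
    fix x :: real assume "x \<in> {0..1}"
    show "(F has_vector_derivative cis (2 * pi * of_int k * x)) (at x within {0..1})"
      unfolding F_def cis_conv_exp using False
      by (auto intro!: derivative_eq_intros has_vector_derivative_real_field simp: field_simps)
  qed simp
  moreover have "F 1 = F 0"
    by (simp add: F_def cis_multiple_2pi)
  ultimately show ?thesis
    using False by (simp add: integral_unique)
qed simp

text \<open>Only the distance of \<open>d\<close> to the nearest integer matters: beyond 1/2 the
  angle of \<open>1 - \<bar>d\<bar>\<close> has the same cosine and lies in the range where cosine
  decreases.\<close>

lemma cos_two_pi_le:
  fixes d \<delta> :: real
  assumes "0 \<le> \<delta>" "\<delta> \<le> \<bar>d\<bar>" "\<bar>d\<bar> \<le> 1 - \<delta>"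
  shows "cos (2 * pi * d) \<le> cos (2 * pi * \<delta>)"
proof (cases "\<bar>d\<bar> \<le> 1 / 2")
  case True
  have "cos (2 * pi * \<bar>d\<bar>) \<le> cos (2 * pi * \<delta>)"
    by (rule cos_monotone_0_pi_le) (use True assms in auto)
  then show ?thesis by (simp add: abs_if split: if_splits)
next
  case False
  have "cos (2 * pi * (1 - \<bar>d\<bar>)) \<le> cos (2 * pi * \<delta>)"
    by (rule cos_monotone_0_pi_le) (use False assms in auto)
  moreover have "cos (2 * pi * (1 - \<bar>d\<bar>)) = cos (2 * pi * \<bar>d\<bar>)"
    by (simp add: right_diff_distrib cos_diff)
  ultimately show ?thesis by (simp add: abs_if split: if_splits)
qed

text \<open>The powers of \<open>(1 + cos 2\<pi>(x - c)) / 2\<close> concentrate at \<open>c\<close>.\<close>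
lemma fourier_uniqueness_interior:
  fixes D :: "real \<Rightarrow> complex"
  assumes cont: "continuous_on {0..1} D"
    and zero: "\<And>k::int. integral {0..1} (\<lambda>x. D x * cis (2 * pi * of_int k * x)) = 0"
    and c: "0 < c" "c < 1"
  shows "D c = 0"
proof (rule ccontr)
  assume "D c \<noteq> 0"
  define T where "T = (\<lambda>x. (1 + cos (2 * pi * (x - c))) / 2)"
  have T01: "0 \<le> T x" for x
    using add_left_mono [OF cos_ge_minus_one [of "2 * pi * (x - c)"], of 1] by (simp add: T_def)
  have contT: "continuous_on S T" for S
    unfolding T_def by (intro continuous_intros) auto
  \<comment> \<open>Multiplication by \<open>T\<close> only mixes the frequencies k - 1, k and k +
    1, so the vanishing of all Fourier coefficients passes from \<open>D\<close> to
    \<open>D * T ^ n\<close> by induction.\<close>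
  have T_cis: "complex_of_real (T x) * cis (2 * pi * of_int k * x) =
      cis (2 * pi * of_int k * x) / 2 + cis (- 2 * pi * c) / 4 * cis (2 * pi * of_int (k + 1) * x)
      + cis (2 * pi * c) / 4 * cis (2 * pi * of_int (k - 1) * x)" for x k
  proof -
    have "complex_of_real (T x) = 1 / 2 + (cis (2 * pi * (x - c)) + cis (- (2 * pi * (x - c)))) / 4"
      by (simp add: T_def complex_eq_iff)
    then show ?thesis
      by (simp add: distrib_right add_divide_distrib cis_mult algebra_simps)
  qed
  have int: "(\<lambda>x. D x * complex_of_real (T x ^ n) * cis (2 * pi * of_int k * x)) integrable_on {0..1}"
    for n k
    by (intro integrable_continuous_interval continuous_intros cont contT)
  have zeroT: "integral {0..1} (\<lambda>x. D x * complex_of_real (T x ^ n) * cis (2 * pi * of_int k * x)) = 0"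
    for n k
  proof (induction n arbitrary: k)
    case 0
    then show ?case using zero by simp
  next
    case (Suc n)
    have "(\<lambda>x. D x * complex_of_real (T x ^ Suc n) * cis (2 * pi * of_int k * x)) =
        (\<lambda>x. (1 / 2) * (D x * complex_of_real (T x ^ n) * cis (2 * pi * of_int k * x))
            + (cis (- 2 * pi * c) / 4) * (D x * complex_of_real (T x ^ n) * cis (2 * pi * of_int (k + 1) * x))
            + (cis (2 * pi * c) / 4) * (D x * complex_of_real (T x ^ n) * cis (2 * pi * of_int (k - 1) * x)))"
    proof
      fix x
      have "D x * complex_of_real (T x ^ Suc n) * cis (2 * pi * of_int k * x) =
          D x * complex_of_real (T x ^ n) * (complex_of_real (T x) * cis (2 * pi * of_int k * x))"
        by simp
      then show "D x * complex_of_real (T x ^ Suc n) * cis (2 * pi * of_int k * x) =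
        (1 / 2) * (D x * complex_of_real (T x ^ n) * cis (2 * pi * of_int k * x))
            + (cis (- 2 * pi * c) / 4) * (D x * complex_of_real (T x ^ n) * cis (2 * pi * of_int (k + 1) * x))
            + (cis (2 * pi * c) / 4) * (D x * complex_of_real (T x ^ n) * cis (2 * pi * of_int (k - 1) * x))"
        unfolding T_cis by (simp add: algebra_simps)
    qed
    then show ?case
      using Suc int
      by (simp only: integral_add integrable_add integrable_on_mult_right integral_mult_right)
         simp
  qed
  \<comment> \<open>The factor \<open>cnj (D c)\<close> makes the value at \<open>c\<close> a
    positive real, so that a real inequality yields the contradiction.\<close>
  define w where "w = cnj (D c)"
  define E where "E = (\<lambda>x. Re (w * D x))"
  define \<eta> where "\<eta> = E c / 2"
  have "E c = (norm (D c))\<^sup>2"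
    unfolding cmod_power2 by (simp add: E_def w_def power2_eq_square)
  then have \<eta>: "\<eta> > 0" "E c = 2 * \<eta>"
    using \<open>D c \<noteq> 0\<close> by (auto simp: \<eta>_def)
  have contE: "continuous_on {0..1} E"
    unfolding E_def by (intro continuous_intros cont)
  then obtain d where d: "d > 0" "\<And>x. x \<in> {0..1} \<Longrightarrow> dist x c < d \<Longrightarrow> dist (E x) (E c) < \<eta>"
    using c \<eta>(1) unfolding continuous_on_iff
    by (metis (no_types, lifting) atLeastAtMost_iff less_imp_le)
  define \<delta> where "\<delta> = Min {d / 2, c / 2, (1 - c) / 2}"
  have \<delta>: "0 < \<delta>" "\<delta> < d" "\<delta> < c" "\<delta> < 1 - c"
    using d c by (auto simp: \<delta>_def min_def)
  have Enear: "E x \<ge> \<eta>" if "\<bar>x - c\<bar> \<le> \<delta>" for x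
  proof -
    have "x \<in> {0..1}" "dist x c < d"
      using that \<delta> by (auto simp: dist_real_def abs_le_iff)
    from d(2) [OF this] show ?thesis
      using \<eta> by (auto simp: dist_real_def abs_less_iff)
  qed
  have "compact (E ` {0..1})"
    by (rule compact_continuous_image [OF contE]) simp
  then obtain B where B: "\<And>x. x \<in> {0..1} \<Longrightarrow> \<bar>E x\<bar> \<le> B"
    using compact_imp_bounded bounded_real by (metis image_eqI)
  have B0: "B \<ge> 0"
    using B [of c] c by auto
  \<comment> \<open>\<open>t0\<close> bounds \<open>T\<close> from above outside the
    \<open>\<delta>\<close>-neighbourhood of \<open>c\<close>, and \<open>t1\<close> bounds it from
    below on the neighbourhood of half the size; everything rests on \<open>t0 < t1\<close>.\<close>
  define t0 where "t0 = (1 + cos (2 * pi * \<delta>)) / 2"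
  define t1 where "t1 = (1 + cos (2 * pi * (\<delta> / 2))) / 2"
  have "2 * \<delta> < 1" using \<delta> by auto
  then have "cos (2 * pi * \<delta>) < cos (2 * pi * (\<delta> / 2))"
    by (intro cos_monotone_0_pi) (use \<delta> in auto)
  then have t01: "t0 < t1" "0 \<le> t0"
    using add_left_mono [OF cos_ge_minus_one [of "2 * pi * \<delta>"], of 1] by (auto simp: t0_def t1_def)
  have Tfar: "T x \<le> t0" if "x \<in> {0..1}" "\<bar>x - c\<bar> > \<delta>" for x
    unfolding T_def t0_def
    using cos_two_pi_le [of \<delta> "x - c"] that \<delta> c by (auto simp: abs_if split: if_splits)
  have Tnear: "t1 \<le> T x" if "\<bar>x - c\<bar> \<le> \<delta> / 2" for x
  proof -
    have "cos (2 * pi * (\<delta> / 2)) \<le> cos (2 * pi * \<bar>x - c\<bar>)"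
      by (rule cos_monotone_0_pi_le) (use that \<open>2 * \<delta> < 1\<close> in auto)
    also have "cos (2 * pi * \<bar>x - c\<bar>) = cos (2 * pi * (x - c))"
      by (cases "x < c") (auto simp: right_diff_distrib cos_diff)
    finally show ?thesis
      by (simp add: T_def t1_def)
  qed
  \<comment> \<open>The integral of \<open>E * T ^ n\<close> is 0. The interval \<open>?J\<close>,
    of length \<open>\<delta>\<close>, contributes at least
    \<open>\<eta> * \<delta> * t1 ^ n\<close>, the rest of the neighbourhood is nonnegative, and
    what lies outside loses at most \<open>B * t0 ^ n\<close>.\<close>
  have main: "\<eta> * \<delta> * t1 ^ n \<le> B * t0 ^ n" for n
  proof -
    let ?J = "{c - \<delta> / 2..c + \<delta> / 2}"
    have J: "?J \<subseteq> {0..1}" using \<delta> by auto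
    have "((\<lambda>x. \<eta> * t1 ^ n) has_integral (\<delta> * (\<eta> * t1 ^ n))) ?J"
      using has_integral_const_real [of "\<eta> * t1 ^ n" "c - \<delta> / 2" "c + \<delta> / 2"] \<delta> by simp
    then have "((\<lambda>x. if x \<in> ?J then \<eta> * t1 ^ n else 0) has_integral (\<delta> * (\<eta> * t1 ^ n))) {0..1}"
      by (subst has_integral_restrict [OF J])
    moreover have "((\<lambda>x. B * t0 ^ n) has_integral (B * t0 ^ n)) {0..1::real}"
      using has_integral_const_real [of "B * t0 ^ n" 0 1] by simp
    ultimately have low: "((\<lambda>x. (if x \<in> ?J then \<eta> * t1 ^ n else 0) - B * t0 ^ n) has_integral
        (\<delta> * (\<eta> * t1 ^ n) - B * t0 ^ n)) {0..1}"
      by (rule has_integral_diff)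
    have "((\<lambda>x. D x * complex_of_real (T x ^ n) * cis (2 * pi * of_int 0 * x)) has_integral 0) {0..1}"
      using int [of n 0] zeroT [of n 0] by (metis integrable_integral)
    then have "((\<lambda>x. Re (w * (D x * complex_of_real (T x ^ n)))) has_integral Re (w * 0)) {0..1}"
      by (intro has_integral_Re has_integral_mult_right) simp
    then have up: "((\<lambda>x. E x * T x ^ n) has_integral 0) {0..1}"
      by (simp add: E_def algebra_simps)
    have "\<delta> * (\<eta> * t1 ^ n) - B * t0 ^ n \<le> 0"
    proof (rule has_integral_le [OF low up])
      fix x :: real assume x: "x \<in> {0..1}"
      show "(if x \<in> ?J then \<eta> * t1 ^ n else 0) - B * t0 ^ n \<le> E x * T x ^ n"
      proof (cases "\<bar>x - c\<bar> \<le> \<delta>")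
        case True
        have "(if x \<in> ?J then \<eta> * t1 ^ n else 0) \<le> E x * T x ^ n"
        proof (cases "x \<in> ?J")
          case True
          then have "\<bar>x - c\<bar> \<le> \<delta> / 2" by (auto simp: abs_if)
          then have "t1 ^ n \<le> T x ^ n" "\<eta> \<le> E x"
            using Tnear [of x] Enear [of x] t01 \<delta> by (auto intro!: power_mono)
          then have "\<eta> * t1 ^ n \<le> E x * T x ^ n"
            using \<eta>(1) t01 by (intro mult_mono) auto
          with True show ?thesis by simp
        next
          case False
          moreover have "0 \<le> E x * T x ^ n"
            using Enear [OF True] \<eta>(1) T01 [of x] by simp
          ultimately show ?thesis by (simp only: if_False)
        qed
        moreover have "0 \<le> B * t0 ^ n" using B0 t01 by simp
        ultimately show ?thesis by linarith
      next
        case False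
        then have "x \<notin> ?J" using \<delta> by (auto simp: abs_if split: if_splits)
        have "T x ^ n \<le> t0 ^ n" "0 \<le> T x ^ n"
          using Tfar [OF x] False T01 [of x] by (auto intro: power_mono)
        moreover have "\<bar>E x\<bar> \<le> B" by (rule B [OF x])
        ultimately have "\<bar>E x\<bar> * T x ^ n \<le> B * t0 ^ n"
          using B0 by (intro mult_mono) auto
        moreover have "- (\<bar>E x\<bar> * T x ^ n) \<le> E x * T x ^ n"
          using mult_right_mono [of "- \<bar>E x\<bar>" "E x" "T x ^ n"] \<open>0 \<le> T x ^ n\<close> by simp
        ultimately have "0 - B * t0 ^ n \<le> E x * T x ^ n" by linarith
        with \<open>x \<notin> ?J\<close> show ?thesis by (simp only: if_False)
      qed
    qed
    then show ?thesis by (simp add: algebra_simps)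
  qed
  have "0 \<le> t0 / t1" "t0 / t1 < 1" "\<eta> * \<delta> / (B + 1) > 0"
    using t01 \<eta> \<delta> B0 by auto
  then obtain n where n: "(t0 / t1) ^ n < \<eta> * \<delta> / (B + 1)"
    using real_arch_pow_inv by blast
  have "t1 > 0" using t01 by linarith
  have "(t0 / t1) ^ n * (B + 1) < \<eta> * \<delta>"
    using n B0 by (simp add: field_simps)
  then have "t0 ^ n * (B + 1) < \<eta> * \<delta> * t1 ^ n"
    using \<open>t1 > 0\<close> by (simp add: power_divide field_simps)
  moreover have "B * t0 ^ n \<le> t0 ^ n * (B + 1)"
    using t01 by (simp add: algebra_simps)
  ultimately show False
    using main [of n] by linarith
qed

text \<open>The concentration argument needs a whole neighbourhood of \<open>c\<close> inside the
  interval, so the end points are reached by continuity. The end point 0 is where Poisson summation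
  is read off.\<close>

lemma fourier_uniqueness:
  fixes D :: "real \<Rightarrow> complex"
  assumes cont: "continuous_on {0..1} D"
    and zero: "\<And>k::int. integral {0..1} (\<lambda>x. D x * cis (2 * pi * of_int k * x)) = 0"
    and "x \<in> {0..1}"
  shows "D x = 0"
proof -
  have "x \<in> closure {0<..<1}"
    using assms(3) by simp
  then show ?thesis
    by (rule continuous_constant_on_closure [where S = "{0<..<1}", rotated 2])
       (use cont fourier_uniqueness_interior [OF cont zero] in auto)
qed

section \<open>Poisson summation\<close>

lemma filterlim_int_intervals:
  "filterlim (\<lambda>N::nat. {- int N..<int N}) (finite_subsets_at_top UNIV) sequentially"
  unfolding filterlim_finite_subsets_at_top
proof (intro allI impI)
  fix X :: "int set" assume "finite X \<and> X \<subseteq> UNIV"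
  then have b: "\<bar>x\<bar> \<le> Max (insert 0 (abs ` X))" if "x \<in> X" for x
    using that by (intro Max_ge) auto
  show "\<forall>\<^sub>F N in sequentially. finite {- int N..<int N} \<and> X \<subseteq> {- int N..<int N} \<and> {- int N..<int N} \<subseteq> UNIV"
    using eventually_gt_at_top [of "nat (Max (insert 0 (abs ` X)))"]
  proof eventually_elim
    case (elim N)
    then show ?case using b by (fastforce simp: abs_le_iff nat_less_iff)
  qed
qed

text \<open>The half-open index range is chosen so that the translated unit intervals tile
  \<open>{- N..N}\<close> exactly.\<close>

lemma sum_integral_unit_intervals:
  fixes f :: "real \<Rightarrow> complex"
  assumes "continuous_on UNIV f"
  shows "(\<Sum>n\<in>{- int N..<int N}. integral {0..1} (\<lambda>x. f (x + of_int n))) = integral {- real N..real N} f"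
proof (induction N)
  case (Suc N)
  have shift: "integral {0..1} (\<lambda>x. f (x + c)) = integral {c..c + 1} f" for c
    using integral_shift [of 0 c 1 f] continuous_on_subset [OF assms subset_UNIV]
    by (simp add: o_def add.commute)
  have int: "f integrable_on {a..b}" for a b
    by (rule integrable_continuous_interval) (use assms continuous_on_subset in blast)
  have "{- int (Suc N)..<int (Suc N)} = insert (- int (Suc N)) (insert (int N) {- int N..<int N})"
    by auto
  then have "(\<Sum>n\<in>{- int (Suc N)..<int (Suc N)}. integral {0..1} (\<lambda>x. f (x + of_int n))) =
      integral {- real (Suc N)..- real N} f + (integral {real N..real (Suc N)} f
        + integral {- real N..real N} f)"
    using Suc by (simp add: shift add.commute)
  also have "\<dots> = integral {- real (Suc N)..real (Suc N)} f"
  proof -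
    have "integral {- real (Suc N)..- real N} f + integral {- real N..real N} f = integral {- real (Suc N)..real N} f"
      by (rule Henstock_Kurzweil_Integration.integral_combine) (use int in auto)
    moreover have "integral {- real (Suc N)..real N} f + integral {real N..real (Suc N)} f = integral {- real (Suc N)..real (Suc N)} f"
      by (rule Henstock_Kurzweil_Integration.integral_combine) (use int in auto)
    ultimately show ?thesis by (simp only: add_ac)
  qed
  finally show ?case .
qed simp

text \<open>The periodization \<open>G\<close> and the absolutely convergent Fourier series
  \<open>H\<close> are continuous on the unit interval with equal Fourier coefficients, so they
  agree there; the formula is their equality at 0. The transform enters as a limit over symmetric
  intervals because partial sums of the coefficients of \<open>G\<close> have exactly this
  form.\<close>

theorem poisson_summation:
  fixes f :: "real \<Rightarrow> complex" and F :: "int \<Rightarrow> complex"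
  assumes cont: "continuous_on UNIV f"
    and bound: "\<And>n x. x \<in> {0..1} \<Longrightarrow> norm (f (x + of_int n)) \<le> M n"
    and M: "M summable_on UNIV"
    and ft: "\<And>k. (\<lambda>N. integral {- real N..real N} (\<lambda>x. f x * cis (- (2 * pi * of_int k * x)))) \<longlonglongrightarrow> F k"
    and F: "(\<lambda>k. norm (F k)) summable_on UNIV"
  shows "(\<Sum>\<^sub>\<infinity>n::int. f (of_int n)) = (\<Sum>\<^sub>\<infinity>k. F k)"
proof -
  define G where "G = (\<lambda>x. \<Sum>\<^sub>\<infinity>n::int. f (x + of_int n))"
  define H where "H = (\<lambda>x. \<Sum>\<^sub>\<infinity>k. F k * cis (2 * pi * of_int k * x))"
  have cf: "continuous_on S (\<lambda>x. f (x + of_int n))" for n S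
    by (rule continuous_on_compose2 [OF cont]) (auto intro!: continuous_intros)
  have contG: "continuous_on {0..1} G"
    unfolding G_def by (rule has_sum_integral(2) [OF cf bound M])
  have contH: "continuous_on {0..1} H"
    unfolding H_def by (rule has_sum_integral(2) [OF _ _ F]) (auto simp: norm_mult intro!: continuous_intros)
  have coefG: "integral {0..1} (\<lambda>x. G x * cis (- (2 * pi * of_int k * x))) = F k" for k
  proof (rule LIMSEQ_unique [OF _ ft])
    have "((\<lambda>n. integral {0..1} (\<lambda>x. f (x + of_int n) * cis (- (2 * pi * of_int k * x)))) has_sum
        integral {0..1} (\<lambda>x. \<Sum>\<^sub>\<infinity>n. f (x + of_int n) * cis (- (2 * pi * of_int k * x)))) UNIV"
      by (rule has_sum_integral(1) [OF _ _ M])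
         (use bound in \<open>auto simp: norm_mult intro!: continuous_intros cf\<close>)
    also have "(\<lambda>x. \<Sum>\<^sub>\<infinity>n. f (x + of_int n) * cis (- (2 * pi * of_int k * x))) =
        (\<lambda>x. G x * cis (- (2 * pi * of_int k * x)))"
      by (simp add: G_def infsum_cmult_left')
    also have "(\<lambda>n. integral {0..1} (\<lambda>x. f (x + of_int n) * cis (- (2 * pi * of_int k * x)))) =
        (\<lambda>n. integral {0..1} (\<lambda>x. f (x + of_int n) * cis (- (2 * pi * of_int k * (x + of_int n)))))"
    proof
      fix n
      \<comment> \<open>An integer shift does not change the character, so the integrals over unit
        intervals glue together to a Fourier integral of \<open>f\<close>.\<close>
      have "cis (- (2 * pi * of_int k * (x + of_int n))) = cis (- (2 * pi * of_int k * x))" for x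
      proof -
        have "cis (- (2 * pi * of_int k * (x + of_int n))) =
            cis (- (2 * pi * of_int k * x)) * cis (2 * pi * of_int (- k * n))"
          unfolding cis_mult by (simp add: algebra_simps)
        also have "cis (2 * pi * of_int (- k * n)) = 1"
          by (rule cis_multiple_2pi) simp
        finally show ?thesis by simp
      qed
      then show "integral {0..1} (\<lambda>x. f (x + of_int n) * cis (- (2 * pi * of_int k * x))) =
        integral {0..1} (\<lambda>x. f (x + of_int n) * cis (- (2 * pi * of_int k * (x + of_int n))))"
        by simp
    qed
    finally have "(\<lambda>N. \<Sum>n\<in>{- int N..<int N}. integral {0..1} (\<lambda>x. f (x + of_int n) *
        cis (- (2 * pi * of_int k * (x + of_int n))))) \<longlonglongrightarrow> integral {0..1} (\<lambda>x. G x * cis (- (2 * pi * of_int k * x)))"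
      unfolding has_sum_def by (rule filterlim_compose [OF _ filterlim_int_intervals])
    then show "(\<lambda>N. integral {- real N..real N} (\<lambda>x. f x * cis (- (2 * pi * of_int k * x))))
        \<longlonglongrightarrow> integral {0..1} (\<lambda>x. G x * cis (- (2 * pi * of_int k * x)))"
      by (subst (asm) sum_integral_unit_intervals) (auto intro!: continuous_intros cont)
  qed
  have coefH: "integral {0..1} (\<lambda>x. H x * cis (- (2 * pi * of_int k * x))) = F k" for k
  proof -
    have "((\<lambda>l. integral {0..1} (\<lambda>x. F l * cis (2 * pi * of_int l * x) * cis (- (2 * pi * of_int k * x)))) has_sum
        integral {0..1} (\<lambda>x. \<Sum>\<^sub>\<infinity>l. F l * cis (2 * pi * of_int l * x) * cis (- (2 * pi * of_int k * x)))) UNIV"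
      by (rule has_sum_integral(1) [OF _ _ F]) (auto simp: norm_mult intro!: continuous_intros)
    also have "(\<lambda>x. \<Sum>\<^sub>\<infinity>l. F l * cis (2 * pi * of_int l * x) * cis (- (2 * pi * of_int k * x))) =
        (\<lambda>x. H x * cis (- (2 * pi * of_int k * x)))"
      by (simp add: H_def infsum_cmult_left')
    also have "(\<lambda>l. integral {0..1} (\<lambda>x. F l * cis (2 * pi * of_int l * x) * cis (- (2 * pi * of_int k * x)))) =
        (\<lambda>l. if l = k then F k else 0)"
    proof
      fix l
      have "(\<lambda>x. F l * cis (2 * pi * of_int l * x) * cis (- (2 * pi * of_int k * x))) =
          (\<lambda>x. F l * cis (2 * pi * of_int (l - k) * x))"
        by (simp add: mult.assoc cis_mult algebra_simps)
      then show "integral {0..1} (\<lambda>x. F l * cis (2 * pi * of_int l * x) * cis (- (2 * pi * of_int k * x))) =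
          (if l = k then F k else 0)"
        using integral_cis_int [of "l - k"] by (simp del: of_int_diff)
    qed
    finally have "((\<lambda>l. if l = k then F k else 0) has_sum
        integral {0..1} (\<lambda>x. H x * cis (- (2 * pi * of_int k * x)))) UNIV" .
    moreover have "((\<lambda>l. if l = k then F k else 0) has_sum F k) UNIV"
      by (rule has_sum_finite_neutralI [of "{k}"]) auto
    ultimately show ?thesis by (rule has_sum_unique)
  qed
  have "G 0 - H 0 = 0"
  proof (rule fourier_uniqueness [of "\<lambda>x. G x - H x"])
    fix k :: int
    have cis: "continuous_on {0..1} (\<lambda>x. cis (- (2 * pi * of_int (- k) * x)))"
      by (intro continuous_intros)
    have "integral {0..1} (\<lambda>x. (G x - H x) * cis (2 * pi * of_int k * x)) =
        integral {0..1} (\<lambda>x. G x * cis (- (2 * pi * of_int (- k) * x)) - H x * cis (- (2 * pi * of_int (- k) * x)))"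
      by (simp add: algebra_simps)
    also have "\<dots> = integral {0..1} (\<lambda>x. G x * cis (- (2 * pi * of_int (- k) * x)))
        - integral {0..1} (\<lambda>x. H x * cis (- (2 * pi * of_int (- k) * x)))"
      by (rule integral_diff [OF integrable_continuous_interval [OF continuous_on_mult [OF contG cis]]
            integrable_continuous_interval [OF continuous_on_mult [OF contH cis]]])
    also have "\<dots> = 0"
      unfolding coefG coefH by simp
    finally show "integral {0..1} (\<lambda>x. (G x - H x) * cis (2 * pi * of_int k * x)) = 0" .
  qed (use continuous_on_diff [OF contG contH] in auto)
  then show ?thesis
    by (simp add: G_def H_def)
qed

section \<open>Gaussians and the error function\<close>

text \<open>Rescaling by \<open>s = sqrt (2 * pi * c)\<close> turns the Gaussian into a multiple of
  the standard normal density, so the value is the characteristic function of the normal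
  distribution at \<open>t = 2 * pi * w / s\<close>.\<close>

lemma gaussian_fourier_aux:
  fixes c w :: real
  assumes "c > 0"
  shows "has_bochner_integral lborel (\<lambda>x. exp (- pi * c * x\<^sup>2) *\<^sub>R cis (2 * pi * w * x))
    (complex_of_real (exp (- pi * w\<^sup>2 / c) / sqrt c))"
proof -
  define s where "s = sqrt (2 * pi * c)"
  have s: "s > 0" "s\<^sup>2 = 2 * pi * c" using assms by (auto simp: s_def)
  define t where "t = 2 * pi * w / s"
  have "(\<lambda>x. cis (t * x)) \<in> borel_measurable borel"
    by (intro borel_measurable_continuous_onI continuous_intros)
  then have std: "integrable lborel (\<lambda>x. std_normal_density x *\<^sub>R cis (t * x))"
    by (intro Bochner_Integration.integrable_bound [OF integrable_normal_density [of 1 0]]) auto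
  have "char std_normal_distribution t = complex_of_real (exp (- t\<^sup>2 / 2))"
    by (simp add: char_std_normal_distribution)
  moreover have "char std_normal_distribution t = (CLINT x|lborel. std_normal_density x *\<^sub>R cis (t * x))"
    unfolding char_def by (subst integral_density) (auto simp: cis_conv_exp mult_ac)
  ultimately have I: "(CLINT x|lborel. std_normal_density x *\<^sub>R cis (t * x)) = complex_of_real (exp (- t\<^sup>2 / 2))"
    by simp
  then have "has_bochner_integral lborel (\<lambda>x. std_normal_density x *\<^sub>R cis (t * x)) (complex_of_real (exp (- t\<^sup>2 / 2)))"
    using std by (simp add: has_bochner_integral_iff)
  from lborel_has_bochner_integral_real_affine_iff [THEN iffD1, OF _ this, of s 0] s
  have "has_bochner_integral lborel (\<lambda>x. std_normal_density (s * x) *\<^sub>R cis (t * (s * x)))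
     (complex_of_real (exp (- t\<^sup>2 / 2)) /\<^sub>R s)"
    by simp
  from has_bochner_integral_scaleR_right [OF this, of "sqrt (2 * pi)"]
  have "has_bochner_integral lborel (\<lambda>x. sqrt (2 * pi) *\<^sub>R std_normal_density (s * x) *\<^sub>R cis (t * (s * x)))
     (sqrt (2 * pi) *\<^sub>R (complex_of_real (exp (- t\<^sup>2 / 2)) /\<^sub>R s))"
    by simp
  also have "(\<lambda>x. sqrt (2 * pi) *\<^sub>R std_normal_density (s * x) *\<^sub>R cis (t * (s * x))) =
      (\<lambda>x. exp (- pi * c * x\<^sup>2) *\<^sub>R cis (2 * pi * w * x))"
    using s by (auto simp: std_normal_density_def t_def power_mult_distrib mult.assoc)
  also have "sqrt (2 * pi) *\<^sub>R (complex_of_real (exp (- t\<^sup>2 / 2)) /\<^sub>R s) =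
      complex_of_real (exp (- pi * w\<^sup>2 / c) / sqrt c)"
  proof -
    have "t\<^sup>2 / 2 = pi * w\<^sup>2 / c"
      using assms by (simp add: t_def power_divide s power_mult_distrib) (simp add: power2_eq_square)
    moreover have "s = sqrt (2 * pi) * sqrt c"
      by (simp add: s_def real_sqrt_mult)
    ultimately show ?thesis
      by (simp add: scaleR_conv_of_real field_simps)
  qed
  finally show ?thesis .
qed

text \<open>The truncation is centred at \<open>a\<close> because Poisson summation over a shifted
  lattice translates the symmetric interval by the shift.\<close>

lemma gaussian_fourier_limit:
  fixes c w a :: real
  assumes "c > 0"
  shows "(\<lambda>N. integral {a - real N..a + real N} (\<lambda>x. complex_of_real (exp (- pi * c * x\<^sup>2)) * cis (2 * pi * w * x)))
    \<longlonglongrightarrow> complex_of_real (exp (- pi * w\<^sup>2 / c) / sqrt c)"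
proof -
  let ?f = "\<lambda>x. exp (- pi * c * x\<^sup>2) *\<^sub>R cis (2 * pi * w * x)"
  let ?A = "\<lambda>N. {a - real N..a + real N}"
  have int: "set_integrable lborel S ?f" if "S \<in> sets borel" for S
    using gaussian_fourier_aux [OF assms, of w] that
    unfolding set_integrable_def has_bochner_integral_iff by (intro integrable_mult_indicator) auto
  have U: "(\<Union>N. ?A N) = UNIV"
  proof -
    have "x \<in> (\<Union>N. ?A N)" for x
      using real_arch_simple [of "\<bar>x - a\<bar>"] by (auto simp: abs_le_iff) (force simp: algebra_simps)
    then show ?thesis by blast
  qed
  have "(\<lambda>N. LINT x:?A N|lborel. ?f x) \<longlonglongrightarrow> (LINT x:(\<Union>N. ?A N)|lborel. ?f x)"
  proof (rule set_integral_cont_up)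
    show "set_integrable lborel (\<Union>N. ?A N) ?f"
      unfolding U by (rule int) simp
  qed (auto simp: incseq_def)
  also have "(LINT x:(\<Union>N. ?A N)|lborel. ?f x) = complex_of_real (exp (- pi * w\<^sup>2 / c) / sqrt c)"
    using gaussian_fourier_aux [OF assms, of w]
    by (simp add: U set_lebesgue_integral_def has_bochner_integral_iff)
  also have "(\<lambda>N. LINT x:?A N|lborel. ?f x) = (\<lambda>N. integral (?A N) ?f)"
    by (intro ext set_borel_integral_eq_integral int) auto
  finally show ?thesis
    by (simp add: scaleR_conv_of_real)
qed

lemma gaussian_tendsto_0:
  fixes c a :: real
  assumes "c > 0"
  shows "(\<lambda>N. exp (- pi * c * (a + real N)\<^sup>2)) \<longlonglongrightarrow> 0" "(\<lambda>N. exp (- pi * c * (a - real N)\<^sup>2)) \<longlonglongrightarrow> 0"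
  using assms by real_asymp+

text \<open>Integration by parts: the derivative of \<open>?f\<close> is a combination of
  \<open>?f\<close> and \<open>?g\<close>, and its boundary values tend to 0. This expresses the
  integral of \<open>?g\<close> through the pure Gaussian one.\<close>

lemma gaussian_fourier_limit_linear:
  fixes c w a :: real
  assumes "c > 0"
  shows "(\<lambda>N. integral {a - real N..a + real N} (\<lambda>x. complex_of_real (x * exp (- pi * c * x\<^sup>2)) * cis (2 * pi * w * x)))
    \<longlonglongrightarrow> \<i> * (w / c) * complex_of_real (exp (- pi * w\<^sup>2 / c) / sqrt c)"
proof -
  let ?f = "\<lambda>x. complex_of_real (exp (- pi * c * x\<^sup>2)) * cis (2 * pi * w * x)"
  let ?g = "\<lambda>x. complex_of_real (x * exp (- pi * c * x\<^sup>2)) * cis (2 * pi * w * x)"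
  let ?A = "\<lambda>N. {a - real N..a + real N}"
  have int: "?f integrable_on ?A N" "?g integrable_on ?A N" for N
    by (auto intro!: integrable_continuous_interval continuous_intros)
  have eq: "integral (?A N) ?g = \<i> * (w / c) * integral (?A N) ?f - (?f (a + real N) - ?f (a - real N)) / (2 * pi * c)" for N
  proof -
    have "((\<lambda>x. 2 * pi * \<i> * w * ?f x - 2 * pi * c * ?g x) has_integral (?f (a + real N) - ?f (a - real N))) (?A N)"
      by (rule fundamental_theorem_of_calculus)
         (auto intro!: derivative_eq_intros has_vector_derivative_real_field
           simp: cis_conv_exp algebra_simps simp flip: exp_of_real)
    moreover have "((\<lambda>x. 2 * pi * \<i> * w * ?f x - 2 * pi * c * ?g x) has_integral
        (2 * pi * \<i> * w * integral (?A N) ?f - 2 * pi * c * integral (?A N) ?g)) (?A N)"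
      by (intro has_integral_diff has_integral_mult_right integrable_integral int)
    ultimately have "2 * pi * \<i> * w * integral (?A N) ?f - 2 * pi * c * integral (?A N) ?g = ?f (a + real N) - ?f (a - real N)"
      by (rule has_integral_unique [rotated])
    then show ?thesis
      using assms by (simp add: field_simps)
  qed
  have "(\<lambda>N. ?f (a + real N)) \<longlonglongrightarrow> 0" "(\<lambda>N. ?f (a - real N)) \<longlonglongrightarrow> 0"
    by (rule tendsto_norm_zero_cancel, use gaussian_tendsto_0 [OF assms, of a] in \<open>simp add: norm_mult\<close>)+
  then have "(\<lambda>N. integral (?A N) ?g) \<longlonglongrightarrow> \<i> * (w / c) * complex_of_real (exp (- pi * w\<^sup>2 / c) / sqrt c) - (0 - 0) / complex_of_real (2 * pi * c)"
    unfolding eq using assms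
    by (intro tendsto_diff [OF tendsto_mult_left [OF gaussian_fourier_limit [OF assms]]
          tendsto_divide [OF tendsto_diff tendsto_const]]) auto
  then show ?thesis by simp
qed

text \<open>Half of the decay rate pays for the linear factor, since
  \<open>\<bar>y\<bar> \<le> 1 + y^2\<close> and both summands are at most a multiple of
  \<open>exp (d * y^2)\<close>.\<close>

lemma linear_gaussian_le:
  fixes d y :: real
  assumes "d > 0"
  shows "\<bar>y\<bar> * exp (- (2 * d) * y\<^sup>2) \<le> (1 + 1 / d) * exp (- d * y\<^sup>2)"
proof -
  have "\<bar>y\<bar> \<le> 1 + y\<^sup>2"
    using sum_power2_ge_zero [of "\<bar>y\<bar> - 1 / 2" 0] by (simp add: power2_eq_square algebra_simps)
  also have "\<dots> \<le> exp (d * y\<^sup>2) + exp (d * y\<^sup>2) / d"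
  proof (intro add_mono)
    have "d * y\<^sup>2 \<le> exp (d * y\<^sup>2)"
      using exp_ge_add_one_self [of "d * y\<^sup>2"] by linarith
    then show "y\<^sup>2 \<le> exp (d * y\<^sup>2) / d"
      using assms by (simp add: field_simps)
  qed (use assms in auto)
  finally have "\<bar>y\<bar> * exp (- (2 * d) * y\<^sup>2) \<le> (exp (d * y\<^sup>2) + exp (d * y\<^sup>2) / d) * exp (- (2 * d) * y\<^sup>2)"
    by (intro mult_right_mono) auto
  also have "\<dots> = (1 + 1 / d) * (exp (d * y\<^sup>2) * exp (- (2 * d) * y\<^sup>2))"
    by (simp add: algebra_simps)
  also have "exp (d * y\<^sup>2) * exp (- (2 * d) * y\<^sup>2) = exp (- d * y\<^sup>2)"
    by (simp flip: exp_add)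
  finally show ?thesis .
qed

lemma gaussian_unit_interval_bound:
  fixes c a :: real
  assumes "c > 0"
  obtains C where "\<And>n x. x \<in> {0..1} \<Longrightarrow> exp (- c * (x + real_of_int n + a)\<^sup>2) \<le> C * exp (- \<bar>real_of_int n\<bar>)"
proof -
  obtain C where C: "\<And>y. exp (- c * (y + a)\<^sup>2) \<le> C * exp (- \<bar>y\<bar>)"
    using gaussian_le_exp_abs [OF assms] by blast
  have "0 < C * exp (- \<bar>0::real\<bar>)"
    using C [of 0] by (rule less_le_trans [rotated]) simp
  then have "C > 0" by simp
  show ?thesis
  proof
    fix n :: int and x :: real assume "x \<in> {0..1}"
    then have "exp (- \<bar>x + real_of_int n\<bar>) \<le> exp (1 - \<bar>real_of_int n\<bar>)"
      by auto
    then have "C * exp (- \<bar>x + real_of_int n\<bar>) \<le> C * exp (1 - \<bar>real_of_int n\<bar>)"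
      using \<open>C > 0\<close> by simp
    with C [of "x + real_of_int n"]
    show "exp (- c * (x + real_of_int n + a)\<^sup>2) \<le> (C * exp 1) * exp (- \<bar>real_of_int n\<bar>)"
      by (simp add: exp_diff exp_minus divide_inverse)
  qed
qed

text \<open>Poisson summation with characteristics: the twist \<open>\<mu>\<close> moves the dual
  lattice and the shift \<open>a\<close> becomes a phase. The bound on \<open>H\<close> is centred
  at \<open>- s\<close> to admit modulated Gaussians, whose transforms are concentrated away from
  0.\<close>

lemma poisson_shifted:
  fixes h :: "real \<Rightarrow> complex" and H :: "real \<Rightarrow> complex" and a \<mu> d e s :: real
  assumes cont: "continuous_on UNIV h"
    and bound: "\<And>x. norm (h x) \<le> K * exp (- d * x\<^sup>2)" and d: "d > 0"
    and ft: "\<And>v. (\<lambda>N. integral {a - real N..a + real N} (\<lambda>x. h x * cis (2 * pi * v * x))) \<longlonglongrightarrow> H v"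
    and H: "\<And>v. norm (H v) \<le> K' * exp (- e * (v + s)\<^sup>2)" and e: "e > 0"
  shows "(\<Sum>\<^sub>\<infinity>n::int. cis (2 * pi * \<mu> * of_int n) * h (of_int n + a)) =
    (\<Sum>\<^sub>\<infinity>k::int. cis (2 * pi * (of_int k - \<mu>) * a) * H (\<mu> - of_int k))"
proof -
  obtain C where C: "\<And>n x. x \<in> {0..1} \<Longrightarrow> exp (- d * (x + real_of_int n + a)\<^sup>2) \<le> C * exp (- \<bar>real_of_int n\<bar>)"
    using gaussian_unit_interval_bound [OF d, of a] by blast
  have "0 \<le> K"
    using order_trans [OF norm_ge_zero bound [of 0]] by simp
  have conth: "continuous_on S h" for S
    using cont by (rule continuous_on_subset) simp
  show ?thesis
  proof (rule poisson_summation [where f = "\<lambda>x. cis (2 * pi * \<mu> * x) * h (x + a)" and M = "\<lambda>n. K * (C * exp (- \<bar>real_of_int n\<bar>))"])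
    show "continuous_on UNIV (\<lambda>x. cis (2 * pi * \<mu> * x) * h (x + a))"
      by (intro continuous_intros continuous_on_compose2 [OF cont]) auto
    show "(\<lambda>n. K * (C * exp (- \<bar>real_of_int n\<bar>))) summable_on UNIV"
      by (intro summable_on_cmult_right summable_on_exp_abs_int)
    show "norm (cis (2 * pi * \<mu> * (x + of_int n)) * h (x + of_int n + a)) \<le> K * (C * exp (- \<bar>real_of_int n\<bar>))"
      if "x \<in> {0..1}" for n :: int and x
      using order_trans [OF bound [of "x + of_int n + a"] mult_left_mono [OF C [OF that] \<open>0 \<le> K\<close>]]
      by (simp add: norm_mult)
    show "(\<lambda>N. integral {- real N..real N} (\<lambda>x. cis (2 * pi * \<mu> * x) * h (x + a) * cis (- (2 * pi * of_int k * x)))) \<longlonglongrightarrow>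
        cis (2 * pi * (of_int k - \<mu>) * a) * H (\<mu> - of_int k)" for k :: int
    proof -
      let ?f = "\<lambda>x. h x * cis (2 * pi * (\<mu> - of_int k) * x)"
      have "integral {- real N..real N} (\<lambda>x. cis (2 * pi * \<mu> * x) * h (x + a) * cis (- (2 * pi * of_int k * x))) =
          cis (2 * pi * (of_int k - \<mu>) * a) * integral {a - real N..a + real N} ?f" for N
      proof -
        have "(\<lambda>x. cis (2 * pi * \<mu> * x) * h (x + a) * cis (- (2 * pi * of_int k * x))) =
            (\<lambda>x. cis (2 * pi * (of_int k - \<mu>) * a) * ?f (x + a))"
        proof
          fix x
          have "cis (2 * pi * \<mu> * x) * cis (- (2 * pi * of_int k * x)) =
              cis (2 * pi * (of_int k - \<mu>) * a) * cis (2 * pi * (\<mu> - of_int k) * (x + a))"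
            by (simp add: cis_mult algebra_simps)
          then show "cis (2 * pi * \<mu> * x) * h (x + a) * cis (- (2 * pi * of_int k * x)) =
              cis (2 * pi * (of_int k - \<mu>) * a) * ?f (x + a)"
            by (simp add: mult_ac)
        qed
        moreover have "continuous_on S ?f" for S
          by (intro continuous_intros conth)
        then have "integral {- real N..real N} (\<lambda>x. ?f (x + a)) = integral {a - real N..a + real N} ?f"
          using integral_shift [of "- real N" a "real N" ?f] by (simp add: o_def add.commute)
        ultimately show ?thesis by simp
      qed
      then show ?thesis
        by (simp only:) (intro tendsto_intros ft)
    qed
    show "(\<lambda>k::int. norm (cis (2 * pi * (of_int k - \<mu>) * a) * H (\<mu> - of_int k))) summable_on UNIV"
    proof (rule summable_on_real_comparison [OF summable_on_gaussian_int [OF e, of "- \<mu> - s"]])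
      fix k :: int
      have "(\<mu> - of_int k + s)\<^sup>2 = (of_int k + (- \<mu> - s))\<^sup>2"
        by (simp add: power2_eq_square algebra_simps)
      with H [of "\<mu> - of_int k"]
      show "norm (norm (cis (2 * pi * (of_int k - \<mu>) * a) * H (\<mu> - of_int k))) \<le> K' * exp (- e * (of_int k + (- \<mu> - s))\<^sup>2)"
        by (simp add: norm_mult)
    qed
  qed
qed

lemma poisson_gaussian:
  fixes c \<nu> b :: real
  assumes "c > 0"
  shows "(\<Sum>\<^sub>\<infinity>n::int. cis (2 * pi * \<nu> * of_int n) * complex_of_real (exp (- pi * c * (of_int n + b)\<^sup>2))) =
    (\<Sum>\<^sub>\<infinity>k::int. cis (2 * pi * (of_int k - \<nu>) * b) * complex_of_real (exp (- pi * (of_int k - \<nu>)\<^sup>2 / c) / sqrt c))"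
  unfolding power2_commute [of "of_int _" \<nu>]
proof (rule poisson_shifted [where K = 1 and d = "pi * c" and K' = "1 / sqrt c" and e = "pi / c" and s = 0
      and h = "\<lambda>x. complex_of_real (exp (- pi * c * x\<^sup>2))" and H = "\<lambda>v. complex_of_real (exp (- pi * v\<^sup>2 / c) / sqrt c)"])
  show "(\<lambda>N. integral {b - real N..b + real N} (\<lambda>x. complex_of_real (exp (- pi * c * x\<^sup>2)) * cis (2 * pi * v * x)))
      \<longlonglongrightarrow> complex_of_real (exp (- pi * v\<^sup>2 / c) / sqrt c)" for v
    by (rule gaussian_fourier_limit [OF assms])
qed (use assms in \<open>auto simp: norm_divide intro!: continuous_intros\<close>)

text \<open>The modulation by \<open>w\<close> displaces the transform. In the double sum it carries
  the shear between the two lattice directions.\<close>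

lemma poisson_gaussian_linear:
  fixes c \<mu> w a :: real
  assumes "c > 0"
  shows "(\<Sum>\<^sub>\<infinity>n::int. cis (2 * pi * \<mu> * of_int n) *
        (complex_of_real ((of_int n + a) * exp (- pi * c * (of_int n + a)\<^sup>2)) * cis (2 * pi * w * (of_int n + a)))) =
    (\<Sum>\<^sub>\<infinity>k::int. cis (2 * pi * (of_int k - \<mu>) * a) * (- \<i> * ((of_int k - \<mu> - w) / c)) *
        complex_of_real (exp (- pi * (of_int k - \<mu> - w)\<^sup>2 / c) / sqrt c))"
proof -
  define d where "d = pi * c / 2"
  have d: "d > 0" using assms by (simp add: d_def)
  define e where "e = pi / c / 2"
  have e: "e > 0" using assms by (simp add: e_def)
  define H where "H = (\<lambda>v. \<i> * complex_of_real ((v + w) / c) * complex_of_real (exp (- pi * (v + w)\<^sup>2 / c) / sqrt c))"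
  have "(\<Sum>\<^sub>\<infinity>n::int. cis (2 * pi * \<mu> * of_int n) *
        (complex_of_real ((of_int n + a) * exp (- pi * c * (of_int n + a)\<^sup>2)) * cis (2 * pi * w * (of_int n + a)))) =
      (\<Sum>\<^sub>\<infinity>k::int. cis (2 * pi * (of_int k - \<mu>) * a) * H (\<mu> - of_int k))"
  proof (rule poisson_shifted [OF _ _ d _ _ e, where h = "\<lambda>x. complex_of_real (x * exp (- pi * c * x\<^sup>2)) * cis (2 * pi * w * x)"])
    show "norm (complex_of_real (x * exp (- pi * c * x\<^sup>2)) * cis (2 * pi * w * x)) \<le> (1 + 1 / d) * exp (- d * x\<^sup>2)" for x
      using linear_gaussian_le [OF d, of x] by (simp add: norm_mult d_def abs_mult del: of_real_mult)
    have "complex_of_real (x * exp (- pi * c * x\<^sup>2)) * cis (2 * pi * w * x) * cis (2 * pi * v * x) =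
        complex_of_real (x * exp (- pi * c * x\<^sup>2)) * cis (2 * pi * (v + w) * x)" for v x
      unfolding mult.assoc cis_mult by (simp add: algebra_simps)
    then show "(\<lambda>N. integral {a - real N..a + real N} (\<lambda>x. complex_of_real (x * exp (- pi * c * x\<^sup>2)) * cis (2 * pi * w * x) * cis (2 * pi * v * x)))
        \<longlonglongrightarrow> H v" for v
      unfolding H_def using gaussian_fourier_limit_linear [OF assms, of a "v + w"] by (simp only:)
    show "norm (H v) \<le> ((1 + 1 / e) / (c * sqrt c)) * exp (- e * (v + w)\<^sup>2)" for v
    proof -
      have "norm (H v) = (\<bar>v + w\<bar> * exp (- (2 * e) * (v + w)\<^sup>2)) / (c * sqrt c)"
        using assms by (simp add: H_def norm_mult norm_divide e_def del: of_real_add)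
      also have "\<dots> \<le> ((1 + 1 / e) * exp (- e * (v + w)\<^sup>2)) / (c * sqrt c)"
        using linear_gaussian_le [OF e, of "v + w"] assms by (intro divide_right_mono) auto
      finally show ?thesis by simp
    qed
  qed (auto intro!: continuous_intros)
  also have "\<dots> = (\<Sum>\<^sub>\<infinity>k::int. cis (2 * pi * (of_int k - \<mu>) * a) * (- \<i> * ((of_int k - \<mu> - w) / c)) *
        complex_of_real (exp (- pi * (of_int k - \<mu> - w)\<^sup>2 / c) / sqrt c))"
  proof (rule infsum_cong)
    fix k :: int
    have "\<mu> - of_int k + w = - (of_int k - \<mu> - w)" by simp
    then show "cis (2 * pi * (of_int k - \<mu>) * a) * H (\<mu> - of_int k) =
        cis (2 * pi * (of_int k - \<mu>) * a) * (- \<i> * ((of_int k - \<mu> - w) / c)) *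
        complex_of_real (exp (- pi * (of_int k - \<mu> - w)\<^sup>2 / c) / sqrt c)"
      unfolding H_def by (simp only: power2_minus minus_divide_left [symmetric] of_real_minus mult_minus_right mult_minus_left mult.assoc)
  qed
  finally show ?thesis .
qed

section \<open>The error function and its Gaussian tails\<close>

definition error_fun :: "real \<Rightarrow> real" where
  "error_fun z = 2 / sqrt pi * (integral {0..z} (\<lambda>s. exp (- s\<^sup>2)) - integral {z..0} (\<lambda>s. exp (- s\<^sup>2)))"

lemma error_fun_0 [simp]: "error_fun 0 = 0"
  by (simp add: error_fun_def)

text \<open>Integrals over reversed intervals vanish, so each sign of the argument uses one of the
  two integrals in the definition. Inside the window \<open>{- R<..<R}\<close> both cases become a
  single integral with fixed lower end \<open>- R\<close>.\<close>

lemma has_real_derivative_error_fun: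
  "(error_fun has_real_derivative 2 / sqrt pi * exp (- z\<^sup>2)) (at z)"
proof -
  define R where "R = \<bar>z\<bar> + 1"
  let ?f = "\<lambda>s::real. exp (- s\<^sup>2)"
  have cont: "continuous_on S ?f" for S
    by (intro continuous_intros)
  have int: "?f integrable_on {a..b}" for a b
    by (intro integrable_continuous_interval cont)
  have eq: "error_fun y = 2 / sqrt pi * (integral {- R..y} ?f - integral {- R..0} ?f)"
    if "y \<in> {- R<..<R}" for y
  proof (cases "0 \<le> y")
    case True
    have "integral {- R..0} ?f + integral {0..y} ?f = integral {- R..y} ?f"
      by (rule Henstock_Kurzweil_Integration.integral_combine) (use int True R_def in auto)
    moreover have "integral {y..0} ?f = 0"
      using True by (cases "y = 0") auto
    ultimately show ?thesis by (simp add: error_fun_def)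
  next
    case False
    have "integral {- R..y} ?f + integral {y..0} ?f = integral {- R..0} ?f"
      by (rule Henstock_Kurzweil_Integration.integral_combine) (use int False that in auto)
    then have "integral {y..0} ?f = integral {- R..0} ?f - integral {- R..y} ?f"
      by simp
    then show ?thesis using False by (simp add: error_fun_def)
  qed
  have "((\<lambda>y. integral {- R..y} ?f) has_real_derivative ?f z) (at z within {- R..R})"
    by (rule integral_has_real_derivative [OF cont]) (auto simp: R_def)
  moreover have "z \<in> interior {- R..R}"
    by (auto simp: R_def)
  ultimately have "((\<lambda>y. integral {- R..y} ?f) has_real_derivative ?f z) (at z)"
    by (simp only: at_within_interior)
  from DERIV_cmult [OF DERIV_diff [OF this DERIV_const [of "integral {- R..0} ?f"]], of "2 / sqrt pi"]
  have "((\<lambda>y. 2 / sqrt pi * (integral {- R..y} ?f - integral {- R..0} ?f)) has_real_derivative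
      2 / sqrt pi * ?f z) (at z)"
    by (simp only: diff_zero)
  then show ?thesis
    by (rule has_field_derivative_transform_within_open [where S = "{- R<..<R}"])
       (use eq in \<open>auto simp: R_def\<close>)
qed

lemmas error_fun_derivative_intros [derivative_intros] =
  has_real_derivative_error_fun [THEN DERIV_chain2]

lemma error_fun_minus: "error_fun (- z) = - error_fun z"
proof -
  have "((\<lambda>z. error_fun z + error_fun (- z)) has_real_derivative 0) (at x)" for x
    by (auto intro!: derivative_eq_intros)
  then have "error_fun z + error_fun (- z) = error_fun 0 + error_fun (- 0)"
    by (intro DERIV_isconst_all) auto
  then show ?thesis by simp
qed

text \<open>The Gaussian integral is the Fourier transform above at frequency 0 with
  \<open>c = 1 / pi\<close>.\<close>

lemma error_fun_tendsto: "(\<lambda>N. error_fun (real N)) \<longlonglongrightarrow> 1"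
proof -
  have eq: "integral {0 - real N..0 + real N} (\<lambda>x. complex_of_real (exp (- pi * (1 / pi) * x\<^sup>2)) * cis (2 * pi * 0 * x))
      = complex_of_real (sqrt pi * error_fun (real N))" for N
  proof -
    have "((\<lambda>x. exp (- x\<^sup>2)) has_integral (sqrt pi / 2 * error_fun (real N) - sqrt pi / 2 * error_fun (- real N))) {- real N..real N}"
      by (rule fundamental_theorem_of_calculus)
         (auto intro!: derivative_eq_intros simp flip: has_real_derivative_iff_has_vector_derivative)
    then have "((\<lambda>x. complex_of_real (exp (- x\<^sup>2))) has_integral complex_of_real (sqrt pi * error_fun (real N))) {- real N..real N}"
      by (intro has_integral_of_real) (simp add: error_fun_minus)
    then show ?thesis
      by (simp add: integral_unique)
  qed
  have "(\<lambda>N. complex_of_real (sqrt pi * error_fun (real N))) \<longlonglongrightarrow> complex_of_real (sqrt pi)"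
    using gaussian_fourier_limit [of "1 / pi" 0 0] unfolding eq by (simp add: real_sqrt_divide)
  then have "(\<lambda>N. sqrt pi * error_fun (real N)) \<longlonglongrightarrow> sqrt pi"
    by (simp only: tendsto_of_real_iff)
  from tendsto_divide [OF this tendsto_const, of "sqrt pi"] show ?thesis
    by simp
qed

lemma error_fun_mono: "x \<le> y \<Longrightarrow> error_fun x \<le> error_fun y"
  by (rule DERIV_nonneg_imp_nondecreasing)
     (auto intro!: exI [of _ "2 / sqrt pi * exp (- _\<^sup>2)"] has_real_derivative_error_fun)

lemma error_fun_le_1: "\<bar>error_fun z\<bar> \<le> 1"
proof -
  have "error_fun z \<le> 1" for z
  proof (rule LIMSEQ_le_const [OF error_fun_tendsto])
    show "\<exists>N. \<forall>n\<ge>N. error_fun z \<le> error_fun (real n)"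
      by (rule exI [of _ "nat \<lceil>z\<rceil>"]) (auto intro!: error_fun_mono simp: nat_le_iff ceiling_le_iff)
  qed
  from this [of z] this [of "- z"] show ?thesis
    by (auto simp: error_fun_minus abs_le_iff)
qed

text \<open>For nonnegative \<open>z\<close> and \<open>u\<close>,
  \<open>(z + u)^2 \<ge> z^2 + u^2\<close>, so
  \<open>error_fun (z + u) - exp (- z^2) * error_fun u\<close> does not increase with
  \<open>u\<close>. Comparing \<open>u = 0\<close> with the limit at infinity gives the tail
  bound.\<close>

lemma error_fun_tail:
  assumes "z \<ge> 0"
  shows "\<bar>1 - error_fun z\<bar> \<le> exp (- z\<^sup>2)"
proof -
  have le: "error_fun (z + real n) \<le> error_fun z + exp (- z\<^sup>2) * error_fun (real n)" for n
  proof -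
    let ?h = "\<lambda>u. error_fun (z + u) - exp (- z\<^sup>2) * error_fun u"
    have "?h (real n) \<le> ?h 0"
    proof (rule DERIV_nonpos_imp_nonincreasing [where f = ?h])
      fix u :: real assume u: "0 \<le> u" "u \<le> real n"
      have "(?h has_real_derivative (2 / sqrt pi * exp (- (z + u)\<^sup>2) - exp (- z\<^sup>2) * (2 / sqrt pi * exp (- u\<^sup>2)))) (at u)"
        by (auto intro!: derivative_eq_intros)
      moreover have "exp (- (z + u)\<^sup>2) \<le> exp (- z\<^sup>2) * exp (- u\<^sup>2)"
        using assms u by (simp add: power2_sum flip: exp_add)
      then have "2 / sqrt pi * exp (- (z + u)\<^sup>2) \<le> 2 / sqrt pi * (exp (- z\<^sup>2) * exp (- u\<^sup>2))"
        by (intro mult_left_mono) auto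
      ultimately show "\<exists>y. (?h has_real_derivative y) (at u) \<and> y \<le> 0"
        by (intro exI conjI) (auto simp: mult_ac)
    qed simp
    then show ?thesis by simp
  qed
  have "1 \<le> error_fun z + exp (- z\<^sup>2) * 1"
  proof (rule LIMSEQ_le [OF error_fun_tendsto])
    show "(\<lambda>n. error_fun z + exp (- z\<^sup>2) * error_fun (real n)) \<longlonglongrightarrow> error_fun z + exp (- z\<^sup>2) * 1"
      by (intro tendsto_intros error_fun_tendsto)
    have "error_fun (real n) \<le> error_fun z + exp (- z\<^sup>2) * error_fun (real n)" for n
      using le [of n] error_fun_mono [of "real n" "z + real n"] assms by simp
    then show "\<exists>N. \<forall>n\<ge>N. error_fun (real n) \<le> error_fun z + exp (- z\<^sup>2) * error_fun (real n)"
      by blast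
  qed
  with error_fun_le_1 [of z] show ?thesis by simp
qed

lemma error_fun_tail_sgn:
  assumes "(s = 1 \<and> z \<ge> 0) \<or> (s = - 1 \<and> z \<le> 0)"
  shows "\<bar>s - error_fun z\<bar> \<le> exp (- z\<^sup>2)"
  using assms
proof
  assume "s = - 1 \<and> z \<le> 0"
  then show ?thesis
    using error_fun_tail [of "- z"] by (simp add: error_fun_minus abs_minus_commute)
qed (use error_fun_tail in auto)

text \<open>Both integral representations of the Hecke kernel are instances, with different choices
  of \<open>G\<close>.\<close>

lemma integral_gaussian_substitution:
  fixes G G' :: "real \<Rightarrow> real"
  assumes "A > 0" "a \<le> b" "\<And>s. s \<in> {a..b} \<Longrightarrow> (G has_real_derivative G' s) (at s within {a..b})"
  shows "integral {a..b} (\<lambda>s. G' s * exp (- A * (G s)\<^sup>2)) =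
    sqrt (pi / A) / 2 * (error_fun (sqrt A * G b) - error_fun (sqrt A * G a))"
proof -
  have "((\<lambda>s. G' s * exp (- A * (G s)\<^sup>2)) has_integral
      (sqrt (pi / A) / 2 * error_fun (sqrt A * G b) - sqrt (pi / A) / 2 * error_fun (sqrt A * G a))) {a..b}"
  proof (rule fundamental_theorem_of_calculus [OF assms(2)])
    fix s assume "s \<in> {a..b}"
    from assms(3) [OF this]
    show "((\<lambda>s. sqrt (pi / A) / 2 * error_fun (sqrt A * G s)) has_vector_derivative G' s * exp (- A * (G s)\<^sup>2)) (at s within {a..b})"
      using assms(1) unfolding has_real_derivative_iff_has_vector_derivative [symmetric]
      by (auto intro!: derivative_eq_intros simp: power_mult_distrib real_sqrt_divide)
  qed
  then show ?thesis
    by (simp add: integral_unique right_diff_distrib)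
qed

text \<open>Undoing a shear of bounded size costs a bounded factor. Uniformity in \<open>s\<close>
  is the point: one majorant has to serve the whole integral over \<open>s\<close>.\<close>

lemma shear_lower_bound:
  fixes c d s S u v :: real
  assumes "c > 0" "d > 0" "\<bar>s\<bar> \<le> S"
  shows "min c d / (2 + 2 * S\<^sup>2) * (u\<^sup>2 + v\<^sup>2) \<le> c * (u + s * v)\<^sup>2 + d * v\<^sup>2"
proof -
  have "s\<^sup>2 \<le> S\<^sup>2" using power_mono [OF assms(3) abs_ge_zero, of 2] by simp
  then have s: "s\<^sup>2 * v\<^sup>2 \<le> S\<^sup>2 * v\<^sup>2" by (intro mult_right_mono) auto
  have "0 \<le> (u + 2 * s * v)\<^sup>2" by simp
  then have "u\<^sup>2 + v\<^sup>2 \<le> 2 * (u + s * v)\<^sup>2 + 2 * (s\<^sup>2 * v\<^sup>2) + v\<^sup>2"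
    by (simp add: power2_eq_square algebra_simps)
  also have "\<dots> \<le> (2 + 2 * S\<^sup>2) * ((u + s * v)\<^sup>2 + v\<^sup>2)"
  proof -
    define X where "X = (u + s * v)\<^sup>2"
    have "0 \<le> v\<^sup>2" "0 \<le> S\<^sup>2 * X" by (simp_all add: X_def)
    moreover have "(2 + 2 * S\<^sup>2) * (X + v\<^sup>2) = 2 * X + 2 * v\<^sup>2 + 2 * (S\<^sup>2 * X) + 2 * (S\<^sup>2 * v\<^sup>2)"
      by (simp add: algebra_simps)
    ultimately show ?thesis
      unfolding X_def [symmetric] using s by linarith
  qed
  finally have "u\<^sup>2 + v\<^sup>2 \<le> (2 + 2 * S\<^sup>2) * ((u + s * v)\<^sup>2 + v\<^sup>2)" .
  then have "min c d / (2 + 2 * S\<^sup>2) * (u\<^sup>2 + v\<^sup>2) \<le> min c d / (2 + 2 * S\<^sup>2) * ((2 + 2 * S\<^sup>2) * ((u + s * v)\<^sup>2 + v\<^sup>2))"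
    using assms by (intro mult_left_mono) auto
  also have "\<dots> = min c d * ((u + s * v)\<^sup>2 + v\<^sup>2)"
  proof -
    have "0 < 2 + 2 * S\<^sup>2" by (simp add: add_pos_nonneg)
    then show ?thesis by simp
  qed
  also have "\<dots> \<le> c * (u + s * v)\<^sup>2 + d * v\<^sup>2"
    unfolding distrib_left by (intro add_mono mult_right_mono) auto
  finally show ?thesis .
qed

lemma linear_gaussian2_le:
  fixes e x y :: real
  assumes "e > 0"
  shows "(\<bar>x\<bar> + \<bar>y\<bar>) * exp (- (2 * e) * (x\<^sup>2 + y\<^sup>2)) \<le> 2 * (1 + 1 / e) * (exp (- e * x\<^sup>2) * exp (- e * y\<^sup>2))"
proof -
  have e2: "exp (- (2 * e) * z\<^sup>2) \<le> exp (- e * z\<^sup>2)" for z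
    using assms by simp
  have "(\<bar>x\<bar> + \<bar>y\<bar>) * exp (- (2 * e) * (x\<^sup>2 + y\<^sup>2)) =
      (\<bar>x\<bar> * exp (- (2 * e) * x\<^sup>2)) * exp (- (2 * e) * y\<^sup>2) + exp (- (2 * e) * x\<^sup>2) * (\<bar>y\<bar> * exp (- (2 * e) * y\<^sup>2))"
    by (simp add: distrib_left distrib_right exp_add exp_diff exp_minus field_simps)
  also have "\<dots> \<le> ((1 + 1 / e) * exp (- e * x\<^sup>2)) * exp (- e * y\<^sup>2) + exp (- e * x\<^sup>2) * ((1 + 1 / e) * exp (- e * y\<^sup>2))"
    using assms by (intro add_mono mult_mono linear_gaussian_le e2) auto
  finally show ?thesis by (simp add: algebra_simps)
qed

section \<open>The Hecke kernel and its Fourier dual\<close>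

text \<open>The scale comes from the vector (\<beta>, \<beta> + 1), orthogonal to (1, 1) and of norm
  -\<beta>(\<beta> + 1) under (\<beta> + 1)x^2 - \<beta>y^2. Its product with (x, y) is
  \<beta>(\<beta> + 1)(x - y), so the normalized coordinate is sqrt(\<beta>(\<beta> + 1)) (x - y);
  the factor x + y belongs to the mirror image (\<beta>, -\<beta> - 1).\<close>

definition hecke_kernel :: "real \<Rightarrow> real \<Rightarrow> real \<Rightarrow> real \<Rightarrow> real" where
  "hecke_kernel \<beta> t x y = exp (- pi * t * ((\<beta> + 1) * x\<^sup>2 - \<beta> * y\<^sup>2)) *
     ((error_fun (sqrt (2 * \<beta> * (\<beta> + 1) * pi * t) * (x + y)) + error_fun (sqrt (2 * \<beta> * (\<beta> + 1) * pi * t) * (x - y))) / 2)"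

text \<open>At \<open>s = 1\<close> and \<open>s = - 1\<close> this is the Siegel majorant, which
  reverses the sign of the indefinite form on the negative line orthogonal to (1, s). In between it
  stays positive definite and depends on \<open>s\<close> only through the square of a linear
  expression.\<close>

definition hecke_majorant :: "real \<Rightarrow> real \<Rightarrow> real \<Rightarrow> real \<Rightarrow> real" where
  "hecke_majorant \<beta> s x y = (\<beta> + 1) * x\<^sup>2 - \<beta> * y\<^sup>2 + 2 * \<beta> * (\<beta> + 1) * (y - s * x)\<^sup>2"

definition hecke_primal_term :: "real \<Rightarrow> real \<Rightarrow> real \<Rightarrow> real \<Rightarrow> real \<Rightarrow> real" where
  "hecke_primal_term \<beta> t s x y = x * exp (- pi * t * hecke_majorant \<beta> s x y)"

text \<open>The factor \<open>x\<close> of the primal term is, up to sign, the derivative of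
  \<open>y - s * x\<close> in \<open>s\<close>. The integral is therefore exact, and its end points
  produce the arguments x + y and x - y.\<close>

lemma hecke_kernel_eq_integral:
  assumes "\<beta> > 0" "t > 0"
  shows "hecke_kernel \<beta> t x y = sqrt (2 * \<beta> * (\<beta> + 1) * t) *
    integral {-1..1} (\<lambda>s. hecke_primal_term \<beta> t s x y)"
proof -
  define A where "A = 2 * \<beta> * (\<beta> + 1) * pi * t"
  have A: "A > 0" using assms by (simp add: A_def)
  have "integral {-1..1} (\<lambda>s. (- x) * exp (- A * (y - s * x)\<^sup>2)) =
      sqrt (pi / A) / 2 * (error_fun (sqrt A * (y - 1 * x)) - error_fun (sqrt A * (y - (- 1) * x)))"
    by (rule integral_gaussian_substitution) (use A in \<open>auto intro!: derivative_eq_intros\<close>)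
  moreover have "error_fun (sqrt A * (y - 1 * x)) = - error_fun (sqrt A * (x - y))"
    by (simp add: right_diff_distrib flip: error_fun_minus)
  ultimately have 1: "integral {-1..1} (\<lambda>s. x * exp (- A * (y - s * x)\<^sup>2)) =
      sqrt (pi / A) / 2 * (error_fun (sqrt A * (x + y)) + error_fun (sqrt A * (x - y)))"
    by (simp add: algebra_simps)
  have "(\<lambda>s. hecke_primal_term \<beta> t s x y) =
      (\<lambda>s. exp (- pi * t * ((\<beta> + 1) * x\<^sup>2 - \<beta> * y\<^sup>2)) * (x * exp (- A * (y - s * x)\<^sup>2)))"
    by (simp add: hecke_primal_term_def hecke_majorant_def A_def distrib_left algebra_simps flip: exp_add)
  then have 2: "integral {-1..1} (\<lambda>s. hecke_primal_term \<beta> t s x y) =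
      exp (- pi * t * ((\<beta> + 1) * x\<^sup>2 - \<beta> * y\<^sup>2)) * (sqrt (pi / A) / 2 * (error_fun (sqrt A * (x + y)) + error_fun (sqrt A * (x - y))))"
    using 1 by simp
  have "sqrt (2 * \<beta> * (\<beta> + 1) * t) * sqrt (pi / A) = sqrt 1"
    unfolding real_sqrt_mult [symmetric] using assms by (simp add: A_def)
  then show ?thesis
    unfolding 2 by (simp add: hecke_kernel_def A_def)
qed

text \<open>Multiplied by \<beta>(\<beta> + 1), this is the determinant of the majorant.\<close>

definition hecke_disc :: "real \<Rightarrow> real \<Rightarrow> real" where
  "hecke_disc \<beta> s = 2 * \<beta> + 1 - 2 * \<beta> * s\<^sup>2"

lemma hecke_disc_bounds:
  assumes "\<beta> > 0" "\<bar>s\<bar> \<le> 1"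
  shows "1 \<le> hecke_disc \<beta> s" "hecke_disc \<beta> s \<le> 2 * \<beta> + 1"
proof -
  have "s\<^sup>2 \<le> 1" using assms(2) by (simp add: abs_square_le_1)
  then have "\<beta> * s\<^sup>2 \<le> \<beta> * 1" using assms(1) by (intro mult_left_mono) auto
  then show "1 \<le> hecke_disc \<beta> s" by (simp add: hecke_disc_def)
  show "hecke_disc \<beta> s \<le> 2 * \<beta> + 1" using assms(1) by (simp add: hecke_disc_def)
qed

text \<open>The inverse of the majorant, evaluated at
  \<open>((\<beta> + 1) * x, \<beta> * y)\<close>. In these coordinates it is again the indefinite
  form plus a square, which makes self-duality visible.\<close>

definition hecke_dual_form :: "real \<Rightarrow> real \<Rightarrow> real \<Rightarrow> real \<Rightarrow> real" where
  "hecke_dual_form \<beta> s x y =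
     (\<beta> + 1) * x\<^sup>2 - \<beta> * y\<^sup>2 + 2 * \<beta> * (\<beta> + 1) * (y + s * x)\<^sup>2 / hecke_disc \<beta> s"

definition hecke_dual :: "real \<Rightarrow> real \<Rightarrow> real \<Rightarrow> real \<Rightarrow> real \<Rightarrow> real" where
  "hecke_dual \<beta> t s x y = ((2 * \<beta> + 1) * x + 2 * \<beta> * s * y) / (hecke_disc \<beta> s * sqrt (hecke_disc \<beta> s)) *
     exp (- pi / t * hecke_dual_form \<beta> s x y)"

text \<open>The prefactor of \<open>hecke_dual\<close> is the derivative of
  \<open>G s = (y + s * x) / sqrt (hecke_disc \<beta> s)\<close>. As \<open>hecke_disc\<close>
  equals 1 at both end points, the same error functions appear as on the primal side, with
  \<open>1 / t\<close> for \<open>t\<close>.\<close>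

lemma hecke_kernel_eq_integral_dual:
  assumes "\<beta> > 0" "t > 0"
  shows "hecke_kernel \<beta> (1 / t) x y = sqrt (2 * \<beta> * (\<beta> + 1) / t) * integral {-1..1} (\<lambda>s. hecke_dual \<beta> t s x y)"
proof -
  define A where "A = 2 * \<beta> * (\<beta> + 1) * pi / t"
  have A: "A > 0" using assms by (simp add: A_def)
  define G where "G = (\<lambda>s. (y + s * x) / sqrt (hecke_disc \<beta> s))"
  define G' where "G' = (\<lambda>s. ((2 * \<beta> + 1) * x + 2 * \<beta> * s * y) / (hecke_disc \<beta> s * sqrt (hecke_disc \<beta> s)))"
  have "integral {-1..1} (\<lambda>s. G' s * exp (- A * (G s)\<^sup>2)) =
      sqrt (pi / A) / 2 * (error_fun (sqrt A * G 1) - error_fun (sqrt A * G (- 1)))"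
  proof (rule integral_gaussian_substitution [OF A])
    fix s :: real assume "s \<in> {-1..1}"
    then have D: "hecke_disc \<beta> s > 0" using hecke_disc_bounds [OF assms(1), of s] by (force simp: abs_le_iff)
    have D': "(hecke_disc \<beta> has_real_derivative (- 4 * \<beta> * s)) (at s within {-1..1})"
      unfolding hecke_disc_def [abs_def] by (auto intro!: derivative_eq_intros)
    define R where "R = sqrt (hecke_disc \<beta> s)"
    have R: "R > 0" "R * R = hecke_disc \<beta> s" using D by (auto simp: R_def)
    have "(G has_real_derivative ((x * R - (y + s * x) * ((- 4 * \<beta> * s) * (inverse R / 2))) / (R * R))) (at s within {-1..1})"
      unfolding G_def using D R
      by (auto intro!: derivative_eq_intros D' simp: R_def mult_ac)
    also have "(x * R - (y + s * x) * ((- 4 * \<beta> * s) * (inverse R / 2))) / (R * R) =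
        (x * (R * R) + 2 * \<beta> * s * (y + s * x)) / (R * R * R)"
      using R by (simp add: field_simps)
    also have "\<dots> = G' s"
      unfolding G'_def R_def [symmetric] R(2)
      by (simp add: hecke_disc_def power2_eq_square algebra_simps)
    finally show "(G has_real_derivative G' s) (at s within {-1..1})" .
  qed simp
  moreover have "G 1 = x + y" "G (- 1) = - (x - y)"
    by (auto simp: G_def hecke_disc_def)
  ultimately have 1: "integral {-1..1} (\<lambda>s. G' s * exp (- A * (G s)\<^sup>2)) =
      sqrt (pi / A) / 2 * (error_fun (sqrt A * (x + y)) + error_fun (sqrt A * (x - y)))"
    by (simp only: mult_minus_right error_fun_minus) simp
  have 2: "integral {-1..1} (\<lambda>s. hecke_dual \<beta> t s x y) =
      exp (- pi * (1 / t) * ((\<beta> + 1) * x\<^sup>2 - \<beta> * y\<^sup>2)) * integral {-1..1} (\<lambda>s. G' s * exp (- A * (G s)\<^sup>2))"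
  proof -
    have "hecke_dual \<beta> t s x y = exp (- pi * (1 / t) * ((\<beta> + 1) * x\<^sup>2 - \<beta> * y\<^sup>2)) * (G' s * exp (- A * (G s)\<^sup>2))"
      if "s \<in> {-1..1}" for s
    proof -
      have D: "hecke_disc \<beta> s > 0" using that hecke_disc_bounds [OF assms(1), of s] by (force simp: abs_le_iff)
      have "- pi / t * hecke_dual_form \<beta> s x y =
          - pi * (1 / t) * ((\<beta> + 1) * x\<^sup>2 - \<beta> * y\<^sup>2) + - A * (G s)\<^sup>2"
        using D by (simp add: hecke_dual_form_def A_def G_def power_divide distrib_left)
      then show ?thesis
        unfolding hecke_dual_def G'_def by (simp only: exp_add) simp
    qed
    then have "integral {-1..1} (\<lambda>s. hecke_dual \<beta> t s x y) =
        integral {-1..1} (\<lambda>s. exp (- pi * (1 / t) * ((\<beta> + 1) * x\<^sup>2 - \<beta> * y\<^sup>2)) * (G' s * exp (- A * (G s)\<^sup>2)))"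
      by (intro integral_cong) auto
    then show ?thesis by simp
  qed
  have "sqrt (2 * \<beta> * (\<beta> + 1) / t) * sqrt (pi / A) = sqrt 1"
    unfolding real_sqrt_mult [symmetric] using assms by (simp add: A_def)
  moreover have "A = 2 * \<beta> * (\<beta> + 1) * pi * (1 / t)" by (simp add: A_def)
  ultimately show ?thesis
    unfolding 1 2 by (simp add: hecke_kernel_def)
qed

text \<open>The square is completed in \<open>y\<close> because the inner Poisson summation runs
  over the second lattice variable; the remaining multiple of \<open>x^2\<close> governs the outer
  one.\<close>

lemma hecke_quadratic_complete_square:
  assumes "\<beta> > 0"
  shows "hecke_majorant \<beta> s x y =
    \<beta> * (2 * \<beta> + 1) * (y + (- (2 * (\<beta> + 1) / (2 * \<beta> + 1) * s)) * x)\<^sup>2 + (\<beta> + 1) * hecke_disc \<beta> s / (2 * \<beta> + 1) * x\<^sup>2"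
proof -
  define k where "k = 2 * \<beta> + 1"
  have "k \<noteq> 0" using assms by (simp add: k_def)
  moreover have "k * hecke_majorant \<beta> s x y =
      \<beta> * (k * y - 2 * (\<beta> + 1) * s * x)\<^sup>2 + (\<beta> + 1) * hecke_disc \<beta> s * x\<^sup>2"
    unfolding k_def hecke_disc_def hecke_majorant_def by algebra
  moreover have "k * y - 2 * (\<beta> + 1) * s * x = k * (y + (- (2 * (\<beta> + 1) / k * s)) * x)"
    using \<open>k \<noteq> 0\<close> by (simp add: field_simps)
  moreover have "\<beta> * (k * w)\<^sup>2 + E * x\<^sup>2 = k * (\<beta> * k * w\<^sup>2 + E / k * x\<^sup>2)" for w E
    using \<open>k \<noteq> 0\<close> by (simp add: field_simps power2_eq_square)
  ultimately have "k * hecke_majorant \<beta> s x y =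
      k * (\<beta> * k * (y + (- (2 * (\<beta> + 1) / k * s)) * x)\<^sup>2 + (\<beta> + 1) * hecke_disc \<beta> s / k * x\<^sup>2)"
    by (simp only:)
  then show ?thesis
    using \<open>k \<noteq> 0\<close> unfolding k_def [symmetric] by (auto simp only: mult_cancel_left)
qed

text \<open>Transforming in \<open>y\<close> and then in \<open>x\<close> produces the two exponents
  on the right; their sum is the inverse form, here recognized in the rescaled coordinates
  \<open>u / (\<beta> + 1)\<close> and \<open>v / \<beta>\<close>.\<close>

lemma hecke_quadratic_dual:
  assumes "\<beta> > 0" "t > 0" "\<bar>s\<bar> \<le> 1"
  shows "pi / t * hecke_dual_form \<beta> s (u / (\<beta> + 1)) (v / \<beta>) =
    pi * (u + 2 * (\<beta> + 1) / (2 * \<beta> + 1) * s * v)\<^sup>2 / (t * ((\<beta> + 1) * hecke_disc \<beta> s / (2 * \<beta> + 1))) + pi * v\<^sup>2 / (t * (\<beta> * (2 * \<beta> + 1)))"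
proof -
  define D where "D = hecke_disc \<beta> s"
  define k where "k = 2 * \<beta> + 1"
  define x where "x = u / (\<beta> + 1)"
  define y where "y = v / \<beta>"
  have u: "u = (\<beta> + 1) * x" and v: "v = \<beta> * y" using assms by (auto simp: x_def y_def)
  have D: "D > 0" using hecke_disc_bounds [OF assms(1,3)] by (simp add: D_def)
  have k: "k > 0" using assms by (simp add: k_def)
  have 1: "u + 2 * (\<beta> + 1) / k * s * v = (\<beta> + 1) / k * (k * x + 2 * \<beta> * s * y)"
    using k by (simp add: u v field_simps)
  have gen: "Z + W * D = D * Q + P \<Longrightarrow> Q + P / D = Z / D + W" for Z W Q P
    using D by (simp add: field_simps)
  have "(\<beta> + 1) / k * ((k * x + 2 * \<beta> * s * y)\<^sup>2) + \<beta> * y\<^sup>2 / k * D =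
      D * ((\<beta> + 1) * x\<^sup>2 - \<beta> * y\<^sup>2) + 2 * \<beta> * (\<beta> + 1) * (y + s * x)\<^sup>2"
  proof -
    have "(\<beta> + 1) * ((k * x + 2 * \<beta> * s * y)\<^sup>2) + \<beta> * y\<^sup>2 * D =
        k * (D * ((\<beta> + 1) * x\<^sup>2 - \<beta> * y\<^sup>2) + 2 * \<beta> * (\<beta> + 1) * (y + s * x)\<^sup>2)"
      unfolding D_def hecke_disc_def k_def by algebra
    then show ?thesis using k by (simp add: field_simps)
  qed
  then have 2: "(\<beta> + 1) * x\<^sup>2 - \<beta> * y\<^sup>2 + 2 * \<beta> * (\<beta> + 1) * (y + s * x)\<^sup>2 / D =
      (\<beta> + 1) / k * ((k * x + 2 * \<beta> * s * y)\<^sup>2) / D + \<beta> * y\<^sup>2 / k"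
    by (rule gen)
  have 3: "pi * (u + 2 * (\<beta> + 1) / k * s * v)\<^sup>2 / (t * ((\<beta> + 1) * D / k)) = pi / t * ((\<beta> + 1) / k * ((k * x + 2 * \<beta> * s * y)\<^sup>2) / D)"
  proof -
    have "pi * (a / k * Z)\<^sup>2 / (t * (a * D / k)) = pi / t * (a / k * Z\<^sup>2 / D)" if "a > 0" for a Z
      using that assms k D by (simp add: power2_eq_square field_simps)
    then show ?thesis unfolding 1 using assms by simp
  qed
  have 4: "pi * v\<^sup>2 / (t * (\<beta> * k)) = pi / t * (\<beta> * y\<^sup>2 / k)"
    unfolding v using assms k by (simp add: power2_eq_square field_simps)
  show ?thesis
    unfolding hecke_dual_form_def D_def [symmetric] k_def [symmetric] x_def [symmetric] y_def [symmetric] 2 3 4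
    by (simp add: distrib_left)
qed

text \<open>\<open>hecke_disc \<beta> s \<ge> 1\<close> keeps the completed square from
  degenerating, and the shear is bounded on \<open>\<bar>s\<bar> \<le> 1\<close>; so
  \<open>f\<close> does not depend on \<open>s\<close>.\<close>

lemma hecke_primal_lower:
  assumes "\<beta> > 0" "t > 0"
  obtains f where "f > 0"
    "\<And>s x y. \<bar>s\<bar> \<le> 1 \<Longrightarrow> f * (x\<^sup>2 + y\<^sup>2) \<le> pi * t * hecke_majorant \<beta> s x y"
proof -
  define S where "S = 2 * (\<beta> + 1) / (2 * \<beta> + 1)"
  define c d where "c = pi * t * (\<beta> * (2 * \<beta> + 1))" and "d = pi * t * ((\<beta> + 1) / (2 * \<beta> + 1))"
  have cd: "c > 0" "d > 0" "S > 0" using assms by (simp_all add: c_def d_def S_def add_pos_pos)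
  define f where "f = min c d / (2 + 2 * S\<^sup>2)"
  have f: "f > 0" using cd unfolding f_def by (simp add: add_pos_nonneg)
  show ?thesis
  proof (rule that [OF f])
    fix s x y :: real assume s: "\<bar>s\<bar> \<le> 1"
    have "f * (x\<^sup>2 + y\<^sup>2) \<le> c * (y + (- (S * s)) * x)\<^sup>2 + d * x\<^sup>2"
      using shear_lower_bound [OF cd(1,2), of "- (S * s)" S y x] s cd(3)
      unfolding f_def by (simp add: abs_mult add.commute)
    also have "d * x\<^sup>2 \<le> d * hecke_disc \<beta> s * x\<^sup>2"
      using hecke_disc_bounds [OF assms(1) s] cd by (intro mult_right_mono) auto
    finally have "f * (x\<^sup>2 + y\<^sup>2) \<le> c * (y + (- (S * s)) * x)\<^sup>2 + d * hecke_disc \<beta> s * x\<^sup>2" by simp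
    also have "\<dots> = pi * t * hecke_majorant \<beta> s x y"
    proof -
      have "c * w\<^sup>2 + d * D * x\<^sup>2 = pi * t * (\<beta> * (2 * \<beta> + 1) * w\<^sup>2 + (\<beta> + 1) * D / (2 * \<beta> + 1) * x\<^sup>2)" for w D
        using assms by (simp add: c_def d_def field_simps)
      then show ?thesis
        unfolding hecke_quadratic_complete_square [OF assms(1)] S_def by simp
    qed
    finally show "f * (x\<^sup>2 + y\<^sup>2) \<le> pi * t * hecke_majorant \<beta> s x y" .
  qed
qed

lemma hecke_primal_bound:
  assumes "\<beta> > 0" "t > 0"
  obtains K e where "e > 0"
    "\<And>s x y. \<bar>s\<bar> \<le> 1 \<Longrightarrow> \<bar>x\<bar> * exp (- pi * t * hecke_majorant \<beta> s x y)
      \<le> K * (exp (- e * x\<^sup>2) * exp (- e * y\<^sup>2))"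
proof -
  obtain f where f: "f > 0"
    and low: "\<And>s x y. \<bar>s\<bar> \<le> 1 \<Longrightarrow> f * (x\<^sup>2 + y\<^sup>2) \<le> pi * t * hecke_majorant \<beta> s x y"
    using hecke_primal_lower [OF assms] by metis
  define e where "e = f / 2"
  have e: "e > 0" "2 * e = f" using f by (simp_all add: e_def)
  show ?thesis
  proof (rule that [OF e(1)])
    fix s x y :: real assume s: "\<bar>s\<bar> \<le> 1"
    have "\<bar>x\<bar> * exp (- pi * t * hecke_majorant \<beta> s x y) \<le>
        (\<bar>x\<bar> + \<bar>y\<bar>) * exp (- (2 * e) * (x\<^sup>2 + y\<^sup>2))"
      unfolding e(2) using low [OF s, of x y] by (intro mult_mono) simp_all
    also have "\<dots> \<le> 2 * (1 + 1 / e) * (exp (- e * x\<^sup>2) * exp (- e * y\<^sup>2))"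
      by (rule linear_gaussian2_le [OF e(1)])
    finally show "\<bar>x\<bar> * exp (- pi * t * hecke_majorant \<beta> s x y) \<le>
        2 * (1 + 1 / e) * (exp (- e * x\<^sup>2) * exp (- e * y\<^sup>2))" .
  qed
qed

lemma hecke_dual_bound:
  assumes "\<beta> > 0" "t > 0"
  obtains K e where "e > 0"
    "\<And>s u v. \<bar>s\<bar> \<le> 1 \<Longrightarrow> \<bar>hecke_dual \<beta> t s (u / (\<beta> + 1)) (v / \<beta>)\<bar> \<le> K * (exp (- e * u\<^sup>2) * exp (- e * v\<^sup>2))"
proof -
  define S where "S = 2 * (\<beta> + 1) / (2 * \<beta> + 1)"
  define c d where "c = pi / (t * (\<beta> + 1))" and "d = pi / (t * (\<beta> * (2 * \<beta> + 1)))"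
  have cd: "c > 0" "d > 0" "S > 0" using assms by (simp_all add: c_def d_def S_def add_pos_pos)
  define f where "f = min c d / (2 + 2 * S\<^sup>2)"
  have f: "f > 0" using cd unfolding f_def by (simp add: add_pos_nonneg)
  define e where "e = f / 2"
  have e: "e > 0" "2 * e = f" using f by (simp_all add: e_def)
  show ?thesis
  proof (rule that [OF e(1)])
    fix s u v :: real assume s: "\<bar>s\<bar> \<le> 1"
    define D where "D = hecke_disc \<beta> s"
    have D: "1 \<le> D" "D \<le> 2 * \<beta> + 1" using hecke_disc_bounds [OF assms(1) s] by (auto simp: D_def)
    have "(2 * e) * (u\<^sup>2 + v\<^sup>2) \<le> c * (u + S * s * v)\<^sup>2 + d * v\<^sup>2"
      using shear_lower_bound [OF cd(1,2), of "S * s" S u v] s cd(3)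
      unfolding e(2) f_def by (simp add: abs_mult)
    \<comment> \<open>On the dual side the upper bound for the discriminant controls the exponent,
      and its lower bound 1 controls the prefactor.\<close>
    also have "c * (u + S * s * v)\<^sup>2 \<le> pi / (t * ((\<beta> + 1) * D / (2 * \<beta> + 1))) * (u + S * s * v)\<^sup>2"
      unfolding c_def
    proof (intro mult_right_mono divide_left_mono mult_left_mono)
      show "(\<beta> + 1) * D / (2 * \<beta> + 1) \<le> \<beta> + 1"
        using D assms by (simp add: divide_le_eq)
    qed (use assms D in \<open>auto intro!: mult_pos_pos divide_pos_pos\<close>)
    finally have "(2 * e) * (u\<^sup>2 + v\<^sup>2) \<le> pi * (u + S * s * v)\<^sup>2 / (t * ((\<beta> + 1) * D / (2 * \<beta> + 1))) + pi * v\<^sup>2 / (t * (\<beta> * (2 * \<beta> + 1)))"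
      by (simp add: d_def mult_ac)
    also note hecke_quadratic_dual [OF assms s, of u v, symmetric, folded S_def D_def]
    finally have ex: "exp (- pi / t * hecke_dual_form \<beta> s (u / (\<beta> + 1)) (v / \<beta>))
        \<le> exp (- (2 * e) * (u\<^sup>2 + v\<^sup>2))"
      by simp
    have lin: "\<bar>((2 * \<beta> + 1) * (u / (\<beta> + 1)) + 2 * \<beta> * s * (v / \<beta>)) / (D * sqrt D)\<bar> \<le> 2 * (\<bar>u\<bar> + \<bar>v\<bar>)"
    proof -
      have "1 * 1 \<le> D * sqrt D" using D by (intro mult_mono) auto
      then have "\<bar>((2 * \<beta> + 1) * (u / (\<beta> + 1)) + 2 * \<beta> * s * (v / \<beta>)) / (D * sqrt D)\<bar> \<le> \<bar>(2 * \<beta> + 1) * (u / (\<beta> + 1)) + 2 * \<beta> * s * (v / \<beta>)\<bar> / 1"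
        unfolding abs_divide by (intro divide_left_mono) auto
      also have "\<dots> \<le> \<bar>(2 * \<beta> + 1) / (\<beta> + 1) * u\<bar> + \<bar>2 * s * v\<bar>"
      proof -
        have "(2 * \<beta> + 1) * (u / (\<beta> + 1)) + 2 * \<beta> * s * (v / \<beta>) = (2 * \<beta> + 1) / (\<beta> + 1) * u + 2 * s * v"
          using assms by simp
        then show ?thesis by (simp only: div_by_1 abs_triangle_ineq)
      qed
      also have "\<bar>(2 * \<beta> + 1) / (\<beta> + 1) * u\<bar> \<le> 2 * \<bar>u\<bar>"
        unfolding abs_mult using assms by (intro mult_right_mono) (auto simp: divide_le_eq)
      also have "\<bar>2 * s * v\<bar> \<le> 2 * \<bar>v\<bar>"
        using mult_right_mono [OF s, of "\<bar>v\<bar>"] by (simp add: abs_mult)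
      finally show ?thesis by simp
    qed
    have "\<bar>hecke_dual \<beta> t s (u / (\<beta> + 1)) (v / \<beta>)\<bar> \<le> (2 * (\<bar>u\<bar> + \<bar>v\<bar>)) * exp (- (2 * e) * (u\<^sup>2 + v\<^sup>2))"
      unfolding hecke_dual_def abs_mult D_def [symmetric] using lin ex by (intro mult_mono) auto
    also have "\<dots> \<le> 2 * (2 * (1 + 1 / e) * (exp (- e * u\<^sup>2) * exp (- e * v\<^sup>2)))"
      unfolding mult.assoc [of 2 "\<bar>u\<bar> + \<bar>v\<bar>"] by (intro mult_left_mono linear_gaussian2_le [OF e(1)]) auto
    finally show "\<bar>hecke_dual \<beta> t s (u / (\<beta> + 1)) (v / \<beta>)\<bar> \<le> (2 * (2 * (1 + 1 / e))) * (exp (- e * u\<^sup>2) * exp (- e * v\<^sup>2))"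
      by (simp only: mult.assoc)
  qed
qed

section \<open>Double Poisson summation for the Hecke kernel\<close>

lemma infsum_int_pairs:
  fixes f :: "int \<Rightarrow> int \<Rightarrow> complex"
  assumes "(\<lambda>(j, r). f j r) summable_on UNIV"
  shows "(\<Sum>\<^sub>\<infinity>(j, r). f j r) = (\<Sum>\<^sub>\<infinity>j. \<Sum>\<^sub>\<infinity>r. f j r)"
    and "(\<Sum>\<^sub>\<infinity>(j, r). f j r) = (\<Sum>\<^sub>\<infinity>r. \<Sum>\<^sub>\<infinity>j. f j r)"
  using infsum_Sigma'_banach [of f UNIV "\<lambda>_. UNIV"] infsum_swap_banach [of f UNIV UNIV] assms by simp_all

lemma summable_on_gaussian_bound2:
  fixes f :: "int \<Rightarrow> int \<Rightarrow> complex"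
  assumes "e > 0" "\<And>j r. norm (f j r) \<le> K * (exp (- e * (of_int j + a)\<^sup>2) * exp (- e * (of_int r + b)\<^sup>2))"
  shows "(\<lambda>(j, r). f j r) summable_on UNIV"
  by (rule summable_on_real_comparison [OF summable_on_gaussian_int2 [OF assms(1) assms(1), of a b], of _ K])
     (use assms(2) in auto)

text \<open>For fixed \<open>s\<close> the exponent is definite, and two one-dimensional Poisson
  summations suffice: over \<open>r\<close> for a pure Gaussian, then over \<open>j\<close> for a
  Gaussian with linear factor. The sums are exchanged in between.\<close>

lemma hecke_poisson_fixed:
  fixes \<beta> t s a b \<mu> \<nu> :: real
  assumes \<beta>: "\<beta> > 0" and t: "t > 0" and s: "\<bar>s\<bar> \<le> 1"
  shows "(\<Sum>\<^sub>\<infinity>(j::int, r::int). cis (2 * pi * \<mu> * of_int j) * cis (2 * pi * \<nu> * of_int r) *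
           of_real (hecke_primal_term \<beta> t s (of_int j + a) (of_int r + b))) =
    (\<Sum>\<^sub>\<infinity>(k::int, l::int). cis (2 * pi * (of_int k - \<mu>) * a) * cis (2 * pi * (of_int l - \<nu>) * b) *
       (- \<i> / (t\<^sup>2 * sqrt (\<beta> * (\<beta> + 1)))) * of_real (hecke_dual \<beta> t s ((of_int k - \<mu>) / (\<beta> + 1)) ((of_int l - \<nu>) / \<beta>)))"
proof -
  define D where "D = hecke_disc \<beta> s"
  have D: "D \<ge> 1" using hecke_disc_bounds [OF \<beta> s] by (simp add: D_def)
  define \<kappa> where "\<kappa> = 2 * (\<beta> + 1) / (2 * \<beta> + 1) * s"
  define c1 where "c1 = t * (\<beta> * (2 * \<beta> + 1))"
  define c2 where "c2 = t * ((\<beta> + 1) * D / (2 * \<beta> + 1))"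
  have c: "c1 > 0" "c2 > 0" using \<beta> t D by (auto simp: c1_def c2_def)
  define P where "P = (\<lambda>j r. cis (2 * pi * \<mu> * of_int j) * cis (2 * pi * \<nu> * of_int r) *
           of_real (hecke_primal_term \<beta> t s (of_int j + a) (of_int r + b)))"
  define Q where "Q = (\<lambda>k l. cis (2 * pi * (of_int k - \<mu>) * a) * cis (2 * pi * (of_int l - \<nu>) * b) *
       (- \<i> / (t\<^sup>2 * sqrt (\<beta> * (\<beta> + 1)))) * complex_of_real (hecke_dual \<beta> t s ((of_int k - \<mu>) / (\<beta> + 1)) ((of_int l - \<nu>) / \<beta>)))"
  define B where "B = (\<lambda>l::int. cis (2 * pi * (of_int l - \<nu>) * b) * complex_of_real (exp (- pi * (of_int l - \<nu>)\<^sup>2 / c1) / sqrt c1))"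
  define X where "X = (\<lambda>w j. cis (2 * pi * \<mu> * of_int j) *
        (complex_of_real ((of_int j + a) * exp (- pi * c2 * (of_int j + a)\<^sup>2)) * cis (2 * pi * w * (of_int j + a))))"
  \<comment> \<open>The half-transformed family, primal in \<open>j\<close> and dual in
    \<open>l\<close>. Its absolute summability is what permits exchanging the order of
    summation.\<close>
  define M where "M = (\<lambda>j l. B l * X (- \<kappa> * (of_int l - \<nu>)) j)"
  obtain K e where e: "e > 0" and K: "\<And>s x y. \<bar>s\<bar> \<le> 1 \<Longrightarrow> \<bar>x\<bar> * exp (- pi * t * hecke_majorant \<beta> s x y)
      \<le> K * (exp (- e * x\<^sup>2) * exp (- e * y\<^sup>2))"
    using hecke_primal_bound [OF \<beta> t] by metis
  have sumP: "(\<lambda>(j, r). P j r) summable_on UNIV"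
    by (rule summable_on_gaussian_bound2 [OF e, of _ K a b])
       (use K [OF s] in \<open>simp add: P_def hecke_primal_term_def norm_mult abs_mult del: of_real_mult of_real_add\<close>)
  obtain K' e' where e': "e' > 0" and K': "\<And>s u v. \<bar>s\<bar> \<le> 1 \<Longrightarrow> \<bar>hecke_dual \<beta> t s (u / (\<beta> + 1)) (v / \<beta>)\<bar> \<le> K' * (exp (- e' * u\<^sup>2) * exp (- e' * v\<^sup>2))"
    using hecke_dual_bound [OF \<beta> t] by metis
  have sumQ: "(\<lambda>(k, l). Q k l) summable_on UNIV"
  proof (rule summable_on_gaussian_bound2 [OF e', of _ "K' / (t\<^sup>2 * sqrt (\<beta> * (\<beta> + 1)))" "- \<mu>" "- \<nu>"])
    fix k l :: int
    have "norm (Q k l) = \<bar>hecke_dual \<beta> t s ((of_int k - \<mu>) / (\<beta> + 1)) ((of_int l - \<nu>) / \<beta>)\<bar> / (t\<^sup>2 * sqrt (\<beta> * (\<beta> + 1)))"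
      using \<beta> t by (simp add: Q_def norm_mult norm_divide abs_mult norm_power)
    also have "\<dots> \<le> (K' * (exp (- e' * (of_int k - \<mu>)\<^sup>2) * exp (- e' * (of_int l - \<nu>)\<^sup>2))) / (t\<^sup>2 * sqrt (\<beta> * (\<beta> + 1)))"
      using \<beta> t by (intro divide_right_mono K' s) auto
    finally show "norm (Q k l) \<le> K' / (t\<^sup>2 * sqrt (\<beta> * (\<beta> + 1))) * (exp (- e' * (of_int k + - \<mu>)\<^sup>2) * exp (- e' * (of_int l + - \<nu>)\<^sup>2))"
      by simp
  qed
  define d where "d = min (pi * c2 / 2) (pi / c1)"
  have "d > 0" using c by (simp add: d_def)
  moreover have "d \<le> pi * c2 / 2" unfolding d_def by (rule min.cobounded1)
  moreover have "d \<le> pi / c1" unfolding d_def by (rule min.cobounded2)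
  ultimately have d: "d > 0" "d \<le> pi * c2 / 2" "d \<le> pi / c1" by blast+
  have sumM: "(\<lambda>(j, l). M j l) summable_on UNIV"
  proof (rule summable_on_gaussian_bound2 [OF d(1), of _ "(1 + 1 / d) / sqrt c1" a "- \<nu>"])
    fix j l :: int
    define x where "x = real_of_int j + a"
    define v where "v = real_of_int l - \<nu>"
    have "norm (M j l) = (\<bar>x\<bar> * exp (- pi * c2 * x\<^sup>2)) * (exp (- pi * v\<^sup>2 / c1)) / sqrt c1"
      using c by (simp add: M_def B_def X_def norm_mult norm_divide abs_mult x_def v_def del: of_real_mult of_real_add)
    also have "\<dots> \<le> ((1 + 1 / d) * exp (- d * x\<^sup>2)) * exp (- d * v\<^sup>2) / sqrt c1"
    proof (rule divide_right_mono, rule mult_mono)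
      have "\<bar>x\<bar> * exp (- pi * c2 * x\<^sup>2) \<le> \<bar>x\<bar> * exp (- (2 * d) * x\<^sup>2)"
        using mult_right_mono [OF d(2), of "x\<^sup>2"] by (intro mult_left_mono) auto
      also have "\<dots> \<le> (1 + 1 / d) * exp (- d * x\<^sup>2)"
        by (rule linear_gaussian_le [OF d(1)])
      finally show "\<bar>x\<bar> * exp (- pi * c2 * x\<^sup>2) \<le> (1 + 1 / d) * exp (- d * x\<^sup>2)" .
      show "exp (- pi * v\<^sup>2 / c1) \<le> exp (- d * v\<^sup>2)"
        using mult_right_mono [OF d(3), of "v\<^sup>2"] by simp
    qed (use c d in auto)
    finally show "norm (M j l) \<le> (1 + 1 / d) / sqrt c1 * (exp (- d * (of_int j + a)\<^sup>2) * exp (- d * (of_int l + - \<nu>)\<^sup>2))"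
      by (simp add: x_def v_def)
  qed
  \<comment> \<open>Completing the square shifts the \<open>r\<close>-lattice by an amount linear in
    \<open>x\<close>; after dualising, this shift is a modulation in \<open>j\<close> of frequency
    \<open>- \<kappa> * (l - \<nu>)\<close>.\<close>
  have stepA: "(\<Sum>\<^sub>\<infinity>r. P j r) = (\<Sum>\<^sub>\<infinity>l. M j l)" for j
  proof -
    define x where "x = real_of_int j + a"
    define A where "A = cis (2 * pi * \<mu> * of_int j) * complex_of_real (x * exp (- pi * c2 * x\<^sup>2))"
    have P: "P j r = A * (cis (2 * pi * \<nu> * of_int r) * complex_of_real (exp (- pi * c1 * (of_int r + (b - \<kappa> * x))\<^sup>2)))" for r
    proof -
      have "pi * t * hecke_majorant \<beta> s x (of_int r + b) =
          pi * c1 * (of_int r + (b - \<kappa> * x))\<^sup>2 + pi * c2 * x\<^sup>2"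
        unfolding hecke_quadratic_complete_square [OF \<beta>] c1_def c2_def D_def [symmetric] \<kappa>_def [symmetric]
        by (simp add: distrib_left algebra_simps)
      then have "exp (- pi * t * hecke_majorant \<beta> s x (of_int r + b)) =
          exp (- pi * c2 * x\<^sup>2) * exp (- pi * c1 * (of_int r + (b - \<kappa> * x))\<^sup>2)"
        by (simp flip: exp_add)
      then show ?thesis
        unfolding P_def A_def hecke_primal_term_def x_def [symmetric] by simp
    qed
    have "(\<Sum>\<^sub>\<infinity>r. P j r) = A * (\<Sum>\<^sub>\<infinity>k::int. cis (2 * pi * (of_int k - \<nu>) * (b - \<kappa> * x)) * complex_of_real (exp (- pi * (of_int k - \<nu>)\<^sup>2 / c1) / sqrt c1))"
      unfolding P infsum_cmult_right' poisson_gaussian [OF c(1)] ..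
    also have "\<dots> = (\<Sum>\<^sub>\<infinity>l. M j l)"
      unfolding infsum_cmult_right' [symmetric]
    proof (rule infsum_cong)
      fix l :: int
      have "cis (2 * pi * (of_int l - \<nu>) * (b - \<kappa> * x)) = cis (2 * pi * (of_int l - \<nu>) * b) * cis (2 * pi * (- \<kappa> * (of_int l - \<nu>)) * x)"
        by (simp add: cis_mult algebra_simps)
      then show "A * (cis (2 * pi * (of_int l - \<nu>) * (b - \<kappa> * x)) * complex_of_real (exp (- pi * (of_int l - \<nu>)\<^sup>2 / c1) / sqrt c1)) = M j l"
        by (simp add: A_def M_def B_def X_def x_def)
    qed
    finally show ?thesis .
  qed
  \<comment> \<open>The modulation returns as the shear \<open>u + \<kappa> * v\<close>. The factors
    \<open>1 / c2\<close>, \<open>1 / sqrt c1\<close> and \<open>1 / sqrt c2\<close> combine to the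
    power 3/2 of the discriminant and the constant
    \<open>t^2 * sqrt (\<beta> * (\<beta> + 1))\<close>.\<close>
  have stepC: "(\<Sum>\<^sub>\<infinity>j. M j l) = (\<Sum>\<^sub>\<infinity>k. Q k l)" for l
  proof -
    define v where "v = real_of_int l - \<nu>"
    have "(\<Sum>\<^sub>\<infinity>j. M j l) = B l * (\<Sum>\<^sub>\<infinity>k::int. cis (2 * pi * (of_int k - \<mu>) * a) * (- \<i> * ((of_int k - \<mu> - (- \<kappa> * v)) / c2)) *
        complex_of_real (exp (- pi * (of_int k - \<mu> - (- \<kappa> * v))\<^sup>2 / c2) / sqrt c2))"
      unfolding M_def infsum_cmult_right' X_def poisson_gaussian_linear [OF c(2)] v_def ..
    also have "\<dots> = (\<Sum>\<^sub>\<infinity>k. Q k l)"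
      unfolding infsum_cmult_right' [symmetric]
    proof (rule infsum_cong)
      fix k :: int
      define u where "u = real_of_int k - \<mu>"
      have ex: "hecke_dual \<beta> t s (u / (\<beta> + 1)) (v / \<beta>) =
          ((2 * \<beta> + 1) * (u / (\<beta> + 1)) + 2 * \<beta> * s * (v / \<beta>)) / (D * sqrt D) * (exp (- pi * (u + \<kappa> * v)\<^sup>2 / c2) * exp (- pi * v\<^sup>2 / c1))"
      proof -
        have "- pi / t * hecke_dual_form \<beta> s (u / (\<beta> + 1)) (v / \<beta>) =
            - pi * (u + \<kappa> * v)\<^sup>2 / c2 + - pi * v\<^sup>2 / c1"
          using hecke_quadratic_dual [OF \<beta> t s, of u v] by (simp add: c1_def c2_def \<kappa>_def D_def)
        then show ?thesis
          unfolding hecke_dual_def D_def [symmetric] by (simp only: exp_add)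
      qed
      have sq: "sqrt c1 * sqrt c2 = t * sqrt (\<beta> * (\<beta> + 1)) * sqrt D"
      proof -
        have "c1 * c2 = t\<^sup>2 * (\<beta> * (\<beta> + 1)) * D"
          using \<beta> by (simp add: c1_def c2_def power2_eq_square field_simps)
        then show ?thesis
          using t by (simp flip: real_sqrt_mult) (simp add: real_sqrt_mult)
      qed
      have lin: "(u + \<kappa> * v) / c2 = ((2 * \<beta> + 1) * (u / (\<beta> + 1)) + 2 * \<beta> * s * (v / \<beta>)) / (t * D)"
      proof -
        have "u + \<kappa> * v = ((\<beta> + 1) / (2 * \<beta> + 1)) * ((2 * \<beta> + 1) * (u / (\<beta> + 1)) + 2 * \<beta> * s * (v / \<beta>))"
        proof -
          have "u + 2 * A / k * s * v = (A / k) * (k * (u / A) + 2 * s * v)" if "A > 0" "k > 0" for A k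
            using that by (simp add: field_simps)
          from this [of "\<beta> + 1" "2 * \<beta> + 1"] show ?thesis
            using \<beta> by (simp add: \<kappa>_def)
        qed
        moreover have "c2 = ((\<beta> + 1) / (2 * \<beta> + 1)) * (t * D)" by (simp add: c2_def)
        moreover have "(\<beta> + 1) / (2 * \<beta> + 1) \<noteq> 0" using \<beta> by simp
        ultimately show ?thesis by (simp only: mult_divide_mult_cancel_left not_False_eq_True)
      qed
      have "(u + \<kappa> * v) / c2 / (sqrt c1 * sqrt c2) = ((2 * \<beta> + 1) * (u / (\<beta> + 1)) + 2 * \<beta> * s * (v / \<beta>)) / (D * sqrt D) / (t\<^sup>2 * sqrt (\<beta> * (\<beta> + 1)))"
        unfolding sq lin by (simp add: power2_eq_square mult_ac)
      then have "(u + \<kappa> * v) / c2 / (sqrt c1 * sqrt c2) * (exp (- pi * (u + \<kappa> * v)\<^sup>2 / c2) * exp (- pi * v\<^sup>2 / c1)) =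
          hecke_dual \<beta> t s (u / (\<beta> + 1)) (v / \<beta>) / (t\<^sup>2 * sqrt (\<beta> * (\<beta> + 1)))"
        unfolding ex by simp
      then have "complex_of_real (exp (- pi * v\<^sup>2 / c1) / sqrt c1) * (complex_of_real ((u + \<kappa> * v) / c2) * complex_of_real (exp (- pi * (u + \<kappa> * v)\<^sup>2 / c2) / sqrt c2)) =
          complex_of_real (hecke_dual \<beta> t s (u / (\<beta> + 1)) (v / \<beta>) / (t\<^sup>2 * sqrt (\<beta> * (\<beta> + 1))))"
        by (simp only: of_real_mult [symmetric]) (simp add: mult_ac)
      then have *: "complex_of_real (exp (- pi * v\<^sup>2 / c1) / sqrt c1) * (complex_of_real ((u + \<kappa> * v) / c2) * complex_of_real (exp (- pi * (u + \<kappa> * v)\<^sup>2 / c2) / sqrt c2)) =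
          complex_of_real (hecke_dual \<beta> t s (u / (\<beta> + 1)) (v / \<beta>)) / complex_of_real (t\<^sup>2 * sqrt (\<beta> * (\<beta> + 1)))"
        by (simp only: of_real_divide)
      have rearrange: "(y1 * z1) * (y2 * (- \<i> * z2) * z3) = y2 * y1 * (- \<i> / z4) * z5"
        if "z1 * (z2 * z3) = z5 / z4" for y1 y2 z1 z2 z3 z4 z5 :: complex
      proof -
        have "(y1 * z1) * (y2 * (- \<i> * z2) * z3) = y2 * y1 * (- \<i>) * (z1 * (z2 * z3))"
          by (simp add: mult_ac)
        then show ?thesis unfolding that by simp
      qed
      have "of_int k - \<mu> - (- \<kappa> * v) = u + \<kappa> * v"
        by (simp add: u_def)
      then show "B l * (cis (2 * pi * (of_int k - \<mu>) * a) * (- \<i> * complex_of_real ((of_int k - \<mu> - (- \<kappa> * v)) / c2)) *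
          complex_of_real (exp (- pi * (of_int k - \<mu> - (- \<kappa> * v))\<^sup>2 / c2) / sqrt c2)) = Q k l"
        unfolding B_def Q_def u_def [symmetric] v_def [symmetric]
        by (simp only:) (rule rearrange [OF *])
    qed
    finally show ?thesis .
  qed
  have "(\<Sum>\<^sub>\<infinity>(j, r). P j r) = (\<Sum>\<^sub>\<infinity>j. \<Sum>\<^sub>\<infinity>l. M j l)"
    unfolding infsum_int_pairs(1) [OF sumP] stepA ..
  also have "\<dots> = (\<Sum>\<^sub>\<infinity>(k, l). Q k l)"
    unfolding infsum_int_pairs(1) [OF sumM, symmetric] infsum_int_pairs(2) [OF sumM] stepC
      infsum_int_pairs(2) [OF sumQ] ..
  finally show ?thesis
    unfolding P_def Q_def .
qed

lemma integral_of_real_complex: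
  assumes "f integrable_on S"
  shows "integral S (\<lambda>x. complex_of_real (f x)) = of_real (integral S f)"
  using has_integral_of_real [OF integrable_integral [OF assms]] by (rule integral_unique)

lemma continuous_on_hecke_dual:
  assumes "\<beta> > 0"
  shows "continuous_on {-1..1} (\<lambda>s. hecke_dual \<beta> t s x y)"
proof -
  have D: "hecke_disc \<beta> s > 0" if "s \<in> {-1..1}" for s
    using hecke_disc_bounds [OF assms, of s] that by (force simp: abs_le_iff)
  have "continuous_on {-1..1} (hecke_disc \<beta>)"
    unfolding hecke_disc_def [abs_def] by (intro continuous_intros)
  then show ?thesis
    unfolding hecke_dual_def hecke_dual_form_def using D by (intro continuous_intros) force+
qed

text \<open>The identity for fixed \<open>s\<close> is integrated over
  \<open>- 1 \<le> s \<le> 1\<close>. The primal side integrates to the kernel at \<open>t\<close>,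
  the dual side to the same kernel at \<open>1 / t\<close>. Termwise integration also yields both
  summability claims.\<close>

theorem hecke_kernel_poisson:
  fixes \<beta> t a b \<mu> \<nu> :: real
  assumes \<beta>: "\<beta> > 0" and t: "t > 0"
  shows "(\<lambda>(j::int, r::int). cis (2 * pi * \<mu> * of_int j) * cis (2 * pi * \<nu> * of_int r) *
           complex_of_real (hecke_kernel \<beta> t (of_int j + a) (of_int r + b))) summable_on UNIV"
    and "(\<lambda>(k::int, l::int). cis (2 * pi * (of_int k - \<mu>) * a) * cis (2 * pi * (of_int l - \<nu>) * b) *
       complex_of_real (hecke_kernel \<beta> (1 / t) ((of_int k - \<mu>) / (\<beta> + 1)) ((of_int l - \<nu>) / \<beta>))) summable_on UNIV"
    and "(\<Sum>\<^sub>\<infinity>(j::int, r::int). cis (2 * pi * \<mu> * of_int j) * cis (2 * pi * \<nu> * of_int r) *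
           complex_of_real (hecke_kernel \<beta> t (of_int j + a) (of_int r + b))) =
    - \<i> / complex_of_real (t * sqrt (\<beta> * (\<beta> + 1))) *
    (\<Sum>\<^sub>\<infinity>(k::int, l::int). cis (2 * pi * (of_int k - \<mu>) * a) * cis (2 * pi * (of_int l - \<nu>) * b) *
       complex_of_real (hecke_kernel \<beta> (1 / t) ((of_int k - \<mu>) / (\<beta> + 1)) ((of_int l - \<nu>) / \<beta>)))"
    (is "infsum ?L UNIV = ?c * infsum ?R UNIV")
proof -
  define c1 where "c1 = sqrt (2 * \<beta> * (\<beta> + 1) * t)"
  define c2 where "c2 = sqrt (2 * \<beta> * (\<beta> + 1) / t)"
  have c: "c1 > 0" "c2 > 0" using \<beta> t by (simp_all add: c1_def c2_def)
  define C where "C = - \<i> / complex_of_real (t\<^sup>2 * sqrt (\<beta> * (\<beta> + 1)))"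
  have C: "C \<noteq> 0" using \<beta> t by (simp add: C_def)
  define P where "P = (\<lambda>(j::int, r::int) s. cis (2 * pi * \<mu> * of_int j) * cis (2 * pi * \<nu> * of_int r) *
           complex_of_real (hecke_primal_term \<beta> t s (of_int j + a) (of_int r + b)))"
  define Q where "Q = (\<lambda>(k::int, l::int) s. cis (2 * pi * (of_int k - \<mu>) * a) * cis (2 * pi * (of_int l - \<nu>) * b) *
       C * complex_of_real (hecke_dual \<beta> t s ((of_int k - \<mu>) / (\<beta> + 1)) ((of_int l - \<nu>) / \<beta>)))"
  obtain K e where e: "e > 0" and K: "\<And>s x y. \<bar>s\<bar> \<le> 1 \<Longrightarrow> \<bar>x\<bar> * exp (- pi * t * hecke_majorant \<beta> s x y)
      \<le> K * (exp (- e * x\<^sup>2) * exp (- e * y\<^sup>2))"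
    using hecke_primal_bound [OF \<beta> t] by metis
  obtain K' e' where e': "e' > 0" and K': "\<And>s u v. \<bar>s\<bar> \<le> 1 \<Longrightarrow> \<bar>hecke_dual \<beta> t s (u / (\<beta> + 1)) (v / \<beta>)\<bar> \<le> K' * (exp (- e' * u\<^sup>2) * exp (- e' * v\<^sup>2))"
    using hecke_dual_bound [OF \<beta> t] by metis
  have contP: "continuous_on {-1..1} (\<lambda>s. hecke_primal_term \<beta> t s x y)" for x y
    unfolding hecke_primal_term_def hecke_majorant_def by (intro continuous_intros)
  have cP: "continuous_on {-1..1} (P i)" for i
    unfolding P_def by (cases i) (auto intro!: continuous_intros contP)
  have cQ: "continuous_on {-1..1} (Q i)" for i
    unfolding Q_def by (cases i) (auto intro!: continuous_intros continuous_on_hecke_dual [OF \<beta>])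
  define M where "M = (\<lambda>(j::int, r::int). K * (exp (- e * (of_int j + a)\<^sup>2) * exp (- e * (of_int r + b)\<^sup>2)))"
  define M' where "M' = (\<lambda>(k::int, l::int). norm C * K' * (exp (- e' * (of_int k + - \<mu>)\<^sup>2) * exp (- e' * (of_int l + - \<nu>)\<^sup>2)))"
  have M: "M summable_on UNIV"
    unfolding M_def using summable_on_cmult_right [OF summable_on_gaussian_int2 [OF e e, of a b], of K]
    by (simp add: case_prod_unfold)
  have M': "M' summable_on UNIV"
    unfolding M'_def using summable_on_cmult_right [OF summable_on_gaussian_int2 [OF e' e', of "- \<mu>" "- \<nu>"], of "norm C * K'"]
    by (simp add: case_prod_unfold)
  have bP: "norm (P i s) \<le> M i" if "s \<in> {-1..1}" for i s
    using K [of s] that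
    by (cases i) (simp add: P_def M_def hecke_primal_term_def norm_mult abs_mult abs_le_iff del: of_real_mult of_real_add)
  have bQ: "norm (Q i s) \<le> M' i" if "s \<in> {-1..1}" for i s
  proof (cases i)
    case (Pair k l)
    have "norm C * \<bar>hecke_dual \<beta> t s ((of_int k - \<mu>) / (\<beta> + 1)) ((of_int l - \<nu>) / \<beta>)\<bar> \<le>
        norm C * (K' * (exp (- e' * (of_int k - \<mu>)\<^sup>2) * exp (- e' * (of_int l - \<nu>)\<^sup>2)))"
      using that by (intro mult_left_mono K') (auto simp: abs_le_iff)
    then show ?thesis
      by (simp add: Pair Q_def M'_def norm_mult)
  qed
  have intP: "integral {-1..1} (P i) = ?L i / complex_of_real c1" for i
  proof (cases i)
    case (Pair j r)
    show ?thesis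
      using c(1) hecke_kernel_eq_integral [OF \<beta> t, of "of_int j + a" "of_int r + b", folded c1_def]
      by (simp add: Pair P_def integral_of_real_complex integrable_continuous_interval contP)
  qed
  have intQ: "integral {-1..1} (Q i) = C / complex_of_real c2 * ?R i" for i
  proof (cases i)
    case (Pair k l)
    show ?thesis
      using c(2) hecke_kernel_eq_integral_dual [OF \<beta> t, of "(of_int k - \<mu>) / (\<beta> + 1)" "(of_int l - \<nu>) / \<beta>", folded c2_def]
      by (simp add: Pair Q_def integral_of_real_complex integrable_continuous_interval continuous_on_hecke_dual [OF \<beta>])
  qed
  have sP: "((\<lambda>i. ?L i / complex_of_real c1) has_sum integral {-1..1} (\<lambda>s. \<Sum>\<^sub>\<infinity>i. P i s)) UNIV"
    unfolding intP [symmetric] by (rule has_sum_integral(1) [OF cP bP M])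
  have sQ: "((\<lambda>i. C / complex_of_real c2 * ?R i) has_sum integral {-1..1} (\<lambda>s. \<Sum>\<^sub>\<infinity>i. Q i s)) UNIV"
    unfolding intQ [symmetric] by (rule has_sum_integral(1) [OF cQ bQ M'])
  have "(\<Sum>\<^sub>\<infinity>i. P i s) = (\<Sum>\<^sub>\<infinity>i. Q i s)" if "s \<in> {-1..1}" for s
  proof -
    have "\<bar>s\<bar> \<le> 1" using that by (auto simp: abs_le_iff)
    from hecke_poisson_fixed [OF \<beta> t this, of \<mu> \<nu> a b] show ?thesis
      by (simp add: P_def Q_def C_def case_prod_unfold)
  qed
  then have eq: "integral {-1..1} (\<lambda>s. \<Sum>\<^sub>\<infinity>i. P i s) = integral {-1..1} (\<lambda>s. \<Sum>\<^sub>\<infinity>i. Q i s)"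
    by (intro integral_cong) auto
  have sL: "(?L has_sum complex_of_real c1 * integral {-1..1} (\<lambda>s. \<Sum>\<^sub>\<infinity>i. Q i s)) UNIV"
    using has_sum_cmult_right [OF sP, of "complex_of_real c1"] c(1) by (simp add: eq)
  have sR: "(?R has_sum complex_of_real c2 / C * integral {-1..1} (\<lambda>s. \<Sum>\<^sub>\<infinity>i. Q i s)) UNIV"
    using has_sum_cmult_right [OF sQ, of "complex_of_real c2 / C"] c(2) C by simp
  show "?L summable_on UNIV" "?R summable_on UNIV"
    using sL sR by (auto simp: summable_on_def)
  \<comment> \<open>The ratio of the two normalizations cancels one of the two factors
    \<open>1 / t\<close> in \<open>C\<close>.\<close>
  have "c1 / c2 = t"
    using \<beta> t by (simp add: c1_def c2_def flip: real_sqrt_divide)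
  then have "complex_of_real c1 = complex_of_real t * complex_of_real c2"
    using c(2) by (metis eq_divide_eq of_real_mult less_irrefl)
  moreover have "?c = complex_of_real t * C"
    using t by (simp add: C_def power2_eq_square)
  ultimately show "infsum ?L UNIV = ?c * infsum ?R UNIV"
    unfolding infsumI [OF sL] infsumI [OF sR] using C by simp
qed

section \<open>Hecke sums on the imaginary axis\<close>

definition msign :: "int \<Rightarrow> complex" where
  "msign k = (if even k then 1 else - 1)"

lemma powi_minus_one: "(- 1 :: complex) powi k = msign k"
  by (simp add: msign_def power_int_minus_left)

lemma msign_simps [simp]: "norm (msign k) = 1" "msign k * msign k = 1" "msign k \<noteq> 0" "msign 0 = 1"
  by (auto simp: msign_def)

lemma cis_pi_int: "cis (pi * of_int k) = msign k"
proof (cases "even k")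
  case True
  then obtain l where "k = 2 * l" by blast
  then have "cis (pi * of_int k) = cis (2 * pi * of_int l)" by (simp add: mult_ac)
  then show ?thesis using True by (simp add: cis_multiple_2pi msign_def)
next
  case False
  then obtain l where "k = 2 * l + 1" using oddE by blast
  then have "cis (pi * of_int k) = cis (2 * pi * of_int l) * cis pi"
    unfolding cis_mult by (simp add: algebra_simps)
  then show ?thesis using False by (simp add: cis_multiple_2pi msign_def)
qed

definition bool_sgn :: "bool \<Rightarrow> real" where
  "bool_sgn b = (if b then 1 else - 1)"

text \<open>The strict and the weak inequality are those of the two brackets, the second one read
  through \<open>r \<mapsto> - r - P\<close>.\<close>

definition hecke_weight :: "int \<Rightarrow> int \<Rightarrow> int \<Rightarrow> real" where
  "hecke_weight P j r = (bool_sgn (r < j) + bool_sgn (- r - P \<le> j)) / 2"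

definition hecke_form :: "real \<Rightarrow> real \<Rightarrow> real \<Rightarrow> real" where
  "hecke_form \<beta> x y = ((\<beta> + 1) * x\<^sup>2 - \<beta> * y\<^sup>2) / 2"

text \<open>Odd \<open>P\<close> will give \<open>galpha\<close> and even \<open>P\<close> will give
  \<open>gbeta\<close>. In the companion \<open>hecke_shift2\<close> the odd number
  \<open>2 * i + 1\<close> is twice the index k of the functions g.\<close>

definition hecke_shift1 :: "int \<Rightarrow> int \<Rightarrow> real" where
  "hecke_shift1 N P = of_int (N * P) / (2 * of_int (N + 1))"

definition hecke_shift2 :: "int \<Rightarrow> int \<Rightarrow> int \<Rightarrow> real" where
  "hecke_shift2 N P i = of_int (N * P + 2 * i + 1) / (2 * of_int N)"

lemma hecke_shift_mult:
  assumes "N > 0"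
  shows "(of_int N + 1) * hecke_shift1 N P = of_int (N * P) / 2"
    and "of_int N * hecke_shift2 N P i = of_int (N * P + 2 * i + 1) / 2"
proof -
  have "z * (w / (2 * z)) = w / 2" if "z > 0" for z w :: real
    using that by simp
  from this [of "of_int (N + 1)"] this [of "of_int N"] assms
  show "(of_int N + 1) * hecke_shift1 N P = of_int (N * P) / 2"
    "of_int N * hecke_shift2 N P i = of_int (N * P + 2 * i + 1) / 2"
    by (simp_all add: hecke_shift1_def hecke_shift2_def)
qed

definition hecke_exponent :: "int \<Rightarrow> int \<Rightarrow> int \<Rightarrow> int \<Rightarrow> int \<Rightarrow> real" where
  "hecke_exponent N P i j r = hecke_form (of_int N) (of_int j + hecke_shift1 N P) (of_int r + hecke_shift2 N P i)"

text \<open>Only the parity of \<open>e\<close> matters. Keeping \<open>e\<close> an integer lets T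
  add \<open>P\<close> to it and lets S trade it against \<open>P\<close> without case
  distinctions.\<close>

definition hecke_theta :: "int \<Rightarrow> int \<Rightarrow> int \<Rightarrow> int \<Rightarrow> complex \<Rightarrow> complex" where
  "hecke_theta N e P i \<tau> =
     (\<Sum>\<^sub>\<infinity>(j, r). msign (e * j + (e + 1) * r) * of_real (hecke_weight P j r) * qpow \<tau> (hecke_exponent N P i j r))"

text \<open>The reflection \<open>\<lambda> \<mapsto> \<lambda> - 2B(\<lambda>, w)w\<close> in \<open>w = (1, 1)\<close> or \<open>w = (1, -1)\<close> maps the coset to itself and moves
  it by an odd multiple of \<open>w\<close>, so it preserves the exponent and changes the sign character.\<close>
lemma infsum_reflection_diff:
  assumes "N > 0"
  shows "(\<Sum>\<^sub>\<infinity>(j, r). msign (e * j + (e + 1) * r) * \<phi> (j - r) * qpow \<tau> (hecke_exponent N P i j r)) = 0"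
    (is "infsum ?f UNIV = 0")
proof -
  \<comment> \<open>This is twice the bilinear product of the coset vector with (1, 1). The
    contributions \<open>N * P\<close> of the two shifts cancel, leaving an odd integer.\<close>
  define n where "n = (\<lambda>(j, r). 2 * (N + 1) * j - 2 * N * r - (2 * i + 1))"
  define \<rho> where "\<rho> = (\<lambda>p. (fst p - n p, snd p - n p))"
  have n: "n (\<rho> p) = - n p" for p
    by (cases p) (simp add: \<rho>_def n_def algebra_simps)
  have ex: "hecke_exponent N P i (j - n (j, r)) (r - n (j, r)) = hecke_exponent N P i j r" for j r
  proof -
    define x where "x = of_int j + hecke_shift1 N P"
    define y where "y = of_int r + hecke_shift2 N P i"
    define k where "k = real_of_int (n (j, r))"
    have k: "k = 2 * ((of_int N + 1) * x - of_int N * y)"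
      unfolding x_def y_def distrib_left hecke_shift_mult [OF assms]
      by (simp add: k_def n_def algebra_simps)
    have "hecke_form (of_int N) (x - k) (y - k) = hecke_form (of_int N) x y"
      unfolding hecke_form_def k by (simp add: power2_eq_square algebra_simps)
    then show ?thesis
      by (simp add: hecke_exponent_def x_def y_def k_def algebra_simps)
  qed
  have sg: "msign (e * (j - n (j, r)) + (e + 1) * (r - n (j, r))) = - msign (e * j + (e + 1) * r)" for j r
  proof -
    have "odd (n (j, r))" by (simp add: n_def)
    then show ?thesis by (auto simp: msign_def)
  qed
  have \<rho>: "\<rho> (\<rho> p) = p" for p
    using n [of p] by (cases p) (simp add: \<rho>_def)
  \<comment> \<open>Reindexing by the involution shows that the sum equals its negative. For a
    family that is not summable both sides are 0 by convention, so the argument is uniform in the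
    function \<open>\<phi>\<close>.\<close>
  have "infsum (\<lambda>p. - ?f p) UNIV = infsum ?f UNIV"
  proof (rule infsum_reindex_bij_witness [of _ \<rho> \<rho>])
    fix p :: "int \<times> int"
    show "?f (\<rho> p) = - ?f p"
      by (cases p) (simp add: \<rho>_def ex sg)
  qed (simp_all only: \<rho> UNIV_I)
  then show ?thesis
    by (simp add: infsum_uminus)
qed

lemma hecke_shift2_reflect:
  assumes "N > 0"
  shows "of_int (- r - P) + hecke_shift2 N P i = - (of_int r + hecke_shift2 N P (- i - 1))"
  using assms by (simp add: hecke_shift2_def field_simps)

text \<open>The substitution \<open>r \<mapsto> - r - P\<close> is the reflection of the second
  coordinate. It turns \<open>j + r\<close> into \<open>j - r - P\<close> and \<open>i\<close> into
  \<open>- i - 1\<close>, and changes the sign character by a constant, which reduces the claim to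
  the other reflection.\<close>

lemma infsum_reflection_sum:
  assumes "N > 0"
  shows "(\<Sum>\<^sub>\<infinity>(j, r). msign (e * j + (e + 1) * r) * \<phi> (j + r) * qpow \<tau> (hecke_exponent N P i j r)) = 0"
proof -
  have ex: "hecke_exponent N P i j (- r - P) = hecke_exponent N P (- i - 1) j r" for j r
    unfolding hecke_exponent_def hecke_shift2_reflect [OF assms] hecke_form_def by (simp only: power2_minus)
  have "(\<Sum>\<^sub>\<infinity>(j, r). msign (e * j + (e + 1) * r) * \<phi> (j + r) * qpow \<tau> (hecke_exponent N P i j r)) =
    (\<Sum>\<^sub>\<infinity>p. msign ((e + 1) * P) * (case p of (j, r) \<Rightarrow>
       msign (e * j + (e + 1) * r) * \<phi> (j - r - P) * qpow \<tau> (hecke_exponent N P (- i - 1) j r)))"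
  proof (rule infsum_reindex_bij_witness [of _ "\<lambda>(j, r). (j, - r - P)" "\<lambda>(j, r). (j, - r - P)"])
    fix p :: "int \<times> int"
    obtain j r where p: "p = (j, r)" by (cases p)
    have "hecke_exponent N P (- i - 1) j (- r - P) = hecke_exponent N P i j r"
      using ex [of j "- r - P"] by simp
    moreover have "msign ((e + 1) * P) * msign (e * j + (e + 1) * (- r - P)) = msign (e * j + (e + 1) * r)"
      by (auto simp: msign_def)
    ultimately show "msign ((e + 1) * P) * (case case p of (j, r) \<Rightarrow> (j, - r - P) of (j, r) \<Rightarrow>
       msign (e * j + (e + 1) * r) * \<phi> (j - r - P) * qpow \<tau> (hecke_exponent N P (- i - 1) j r)) =
       (case p of (j, r) \<Rightarrow> msign (e * j + (e + 1) * r) * \<phi> (j + r) * qpow \<tau> (hecke_exponent N P i j r))"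
      by (simp add: p mult.assoc [symmetric])
  qed auto
  also have "\<dots> = 0"
    unfolding infsum_cmult_right' using infsum_reflection_diff [OF assms, of e "\<lambda>d. \<phi> (d - P)" \<tau> P "- i - 1"] by simp
  finally show ?thesis .
qed

text \<open>Where the step and \<open>z\<close> agree in sign, the Gaussian tail applies. Where they
  disagree, \<open>z\<close> is at most \<open>\<delta>\<close> in absolute value, and the trivial
  bound 2 is absorbed by the factor \<open>exp (A * \<delta>^2)\<close>.\<close>

lemma bool_sgn_error_fun_bound:
  assumes "A > 0" "b \<and> z < 0 \<or> \<not> b \<and> z > 0 \<Longrightarrow> \<bar>z\<bar> \<le> \<delta>"
  shows "\<bar>bool_sgn b - error_fun (sqrt A * z)\<bar> \<le> 2 * exp (A * \<delta>\<^sup>2) * exp (- A * z\<^sup>2)"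
proof (cases "b \<and> z < 0 \<or> \<not> b \<and> z > 0")
  case True
  then have "z\<^sup>2 \<le> \<delta>\<^sup>2"
    using power_mono [OF assms(2) abs_ge_zero, of 2] by simp
  then have "A * z\<^sup>2 \<le> A * \<delta>\<^sup>2"
    using assms(1) by (intro mult_left_mono) auto
  then have "1 \<le> exp (A * \<delta>\<^sup>2) * exp (- A * z\<^sup>2)"
    by (simp flip: exp_add)
  moreover have "\<bar>bool_sgn b - error_fun (sqrt A * z)\<bar> \<le> 2"
    using error_fun_le_1 [of "sqrt A * z"] by (auto simp: bool_sgn_def abs_le_iff)
  ultimately show ?thesis by simp
next
  case False
  then have "\<bar>bool_sgn b - error_fun (sqrt A * z)\<bar> \<le> exp (- (sqrt A * z)\<^sup>2)"
    using assms(1) by (intro error_fun_tail_sgn) (auto simp: bool_sgn_def mult_le_0_iff zero_le_mult_iff)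
  also have "\<dots> = 1 * exp (- A * z\<^sup>2)"
    using assms(1) by (simp add: power_mult_distrib)
  also have "\<dots> \<le> 2 * exp (A * \<delta>\<^sup>2) * exp (- A * z\<^sup>2)"
  proof (rule mult_right_mono)
    have "1 \<le> exp (A * \<delta>\<^sup>2)" using assms(1) by simp
    then show "1 \<le> 2 * exp (A * \<delta>\<^sup>2)" by linarith
  qed simp
  finally show ?thesis .
qed

lemma qpow_imaginary: "qpow (\<i> * of_real t) x = of_real (exp (- 2 * pi * t * x))"
proof -
  have "2 * of_real pi * \<i> * (\<i> * of_real t) * of_real x = complex_of_real (- 2 * pi * t * x)"
    by (simp add: complex_eq_iff)
  then show ?thesis
    unfolding qpow_def exp_of_real [symmetric] by (rule arg_cong)
qed

text \<open>Weight minus smoothed weight is a function \<open>\<phi>1\<close> of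
  \<open>j - r\<close> plus a function \<open>\<phi>2\<close> of \<open>j + r\<close>. Each of the
  two sums converges absolutely and vanishes by reflection, leaving the kernel.\<close>

lemma hecke_theta_eq_kernel:
  assumes N: "N > 0" and t: "t > 0"
  shows "hecke_theta N e P i (\<i> * of_real t) =
    (\<Sum>\<^sub>\<infinity>(j, r). msign (e * j + (e + 1) * r) *
       of_real (hecke_kernel (of_int N) t (of_int j + hecke_shift1 N P) (of_int r + hecke_shift2 N P i)))"
    (is "_ = infsum ?K UNIV")
proof -
  define \<beta> where "\<beta> = real_of_int N"
  have \<beta>: "\<beta> > 0" using N by (simp add: \<beta>_def)
  define A where "A = 2 * \<beta> * (\<beta> + 1) * pi * t"
  have A: "A > 0" using \<beta> t by (simp add: A_def)
  define a where "a = hecke_shift1 N P"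
  define b where "b = hecke_shift2 N P i"
  define \<phi>1 where "\<phi>1 = (\<lambda>d::int. complex_of_real ((bool_sgn (0 < d) - error_fun (sqrt A * (of_int d + (a - b)))) / 2))"
  define \<phi>2 where "\<phi>2 = (\<lambda>d::int. complex_of_real ((bool_sgn (- P \<le> d) - error_fun (sqrt A * (of_int d + (a + b)))) / 2))"
  define S1 where "S1 = (\<lambda>(j, r). msign (e * j + (e + 1) * r) * \<phi>1 (j - r) * qpow (\<i> * of_real t) (hecke_exponent N P i j r))"
  define S2 where "S2 = (\<lambda>(j, r). msign (e * j + (e + 1) * r) * \<phi>2 (j + r) * qpow (\<i> * of_real t) (hecke_exponent N P i j r))"
  obtain f where f: "f > 0" and low: "\<And>s x y. \<bar>s\<bar> \<le> 1 \<Longrightarrow> f * (x\<^sup>2 + y\<^sup>2) \<le> pi * t * hecke_majorant \<beta> s x y"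
    using hecke_primal_lower [OF \<beta> t] by metis
  \<comment> \<open>The Gaussian decay of sign minus error function, multiplied by the indefinite
    exponential, is exactly the majorant at \<open>s = 1\<close> for \<open>\<phi>1\<close> and at
    \<open>s = - 1\<close> for \<open>\<phi>2\<close>. This gives convergence where the indefinite
    form alone would not.\<close>
  have corr: "(\<lambda>(j, r). msign (e * j + (e + 1) * r) * \<phi> j r * qpow (\<i> * of_real t) (hecke_exponent N P i j r)) summable_on UNIV"
    if s: "\<bar>s\<bar> \<le> 1" and \<phi>: "\<And>j r. norm (\<phi> j r) \<le> C * exp (- A * (of_int r + b - s * (of_int j + a))\<^sup>2)" for \<phi> s C
  proof (rule summable_on_gaussian_bound2 [OF f, of _ C a b])
    fix j r :: int
    define x where "x = of_int j + a"
    define y where "y = of_int r + b"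
    have "0 \<le> C * exp (- A * (y - s * x)\<^sup>2)"
      using order_trans [OF norm_ge_zero \<phi> [of j r]] by (simp add: x_def y_def)
    then have C: "C \<ge> 0" by (simp add: zero_le_mult_iff)
    have "A * w + 2 * pi * t * (q / 2) = pi * t * (q + 2 * \<beta> * (\<beta> + 1) * w)" for w q
      by (simp add: A_def algebra_simps)
    from this [of "(y - s * x)\<^sup>2" "(\<beta> + 1) * x\<^sup>2 - \<beta> * y\<^sup>2"] low [OF s, of x y]
    have "f * x\<^sup>2 + f * y\<^sup>2 \<le> A * (y - s * x)\<^sup>2 + 2 * pi * t * hecke_form \<beta> x y"
      by (simp only: hecke_form_def hecke_majorant_def distrib_left)
    then have le: "exp (- A * (y - s * x)\<^sup>2) * exp (- 2 * pi * t * hecke_form \<beta> x y) \<le> exp (- f * x\<^sup>2) * exp (- f * y\<^sup>2)"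
      by (simp flip: exp_add)
    have "norm (msign (e * j + (e + 1) * r) * \<phi> j r * qpow (\<i> * of_real t) (hecke_exponent N P i j r)) =
        norm (\<phi> j r) * exp (- 2 * pi * t * hecke_form \<beta> x y)"
      by (simp add: norm_mult qpow_imaginary hecke_exponent_def x_def y_def a_def b_def \<beta>_def)
    also have "\<dots> \<le> (C * exp (- A * (y - s * x)\<^sup>2)) * exp (- 2 * pi * t * hecke_form \<beta> x y)"
      unfolding x_def y_def by (intro mult_right_mono \<phi>) simp
    also have "\<dots> \<le> C * (exp (- f * x\<^sup>2) * exp (- f * y\<^sup>2))"
      using mult_left_mono [OF le C] by (simp only: mult.assoc)
    finally show "norm (msign (e * j + (e + 1) * r) * \<phi> j r * qpow (\<i> * of_real t) (hecke_exponent N P i j r)) \<le>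
        C * (exp (- f * (of_int j + a)\<^sup>2) * exp (- f * (of_int r + b)\<^sup>2))"
      by (simp only: x_def y_def)
  qed
  have S1: "S1 summable_on UNIV"
    unfolding S1_def
  proof (rule corr [of 1 "\<lambda>j r. \<phi>1 (j - r)"])
    fix j r :: int
    \<comment> \<open>The step jumps at 0 and the error function vanishes at \<open>b - a\<close>;
      signs can differ only between these points, where the argument is at most
      \<open>\<bar>a - b\<bar>\<close>.\<close>
    have "\<bar>bool_sgn (0 < j - r) - error_fun (sqrt A * (of_int (j - r) + (a - b)))\<bar> \<le>
        2 * exp (A * \<bar>a - b\<bar>\<^sup>2) * exp (- A * (of_int (j - r) + (a - b))\<^sup>2)"
      by (rule bool_sgn_error_fun_bound [OF A]) auto
    then show "norm (\<phi>1 (j - r)) \<le> exp (A * (a - b)\<^sup>2) * exp (- A * (of_int r + b - 1 * (of_int j + a))\<^sup>2)"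
      by (simp add: \<phi>1_def norm_divide power2_commute algebra_simps del: of_real_diff)
  qed simp
  have S2: "S2 summable_on UNIV"
    unfolding S2_def
  proof (rule corr [of "- 1" "\<lambda>j r. \<phi>2 (j + r)"])
    fix j r :: int
    have "\<bar>bool_sgn (- P \<le> j + r) - error_fun (sqrt A * (of_int (j + r) + (a + b)))\<bar> \<le>
        2 * exp (A * \<bar>a + b - P\<bar>\<^sup>2) * exp (- A * (of_int (j + r) + (a + b))\<^sup>2)"
    proof (rule bool_sgn_error_fun_bound [OF A])
      have "- P \<le> j + r \<longleftrightarrow> - real_of_int P \<le> of_int (j + r)"
        by (metis of_int_le_iff of_int_minus)
      moreover assume "- P \<le> j + r \<and> real_of_int (j + r) + (a + b) < 0 \<or> \<not> - P \<le> j + r \<and> 0 < real_of_int (j + r) + (a + b)"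
      ultimately show "\<bar>real_of_int (j + r) + (a + b)\<bar> \<le> \<bar>a + b - P\<bar>"
        by linarith
    qed
    then show "norm (\<phi>2 (j + r)) \<le> exp (A * (a + b - P)\<^sup>2) * exp (- A * (of_int r + b - (- 1) * (of_int j + a))\<^sup>2)"
      by (simp add: \<phi>2_def norm_divide algebra_simps del: of_real_diff)
  qed simp
  \<comment> \<open>The sign character has frequencies \<open>e / 2\<close> and
    \<open>(e + 1) / 2\<close>, so the kernel sum is an instance of the Poisson formula.\<close>
  have msign_cis: "cis (2 * pi * (of_int e / 2) * of_int j) * cis (2 * pi * (of_int (e + 1) / 2) * of_int r) = msign (e * j + (e + 1) * r)" for j r
  proof -
    have "2 * pi * (of_int e / 2) * of_int j + 2 * pi * (of_int (e + 1) / 2) * of_int r = pi * of_int (e * j + (e + 1) * r)"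
      by (simp add: field_simps)
    then show ?thesis
      unfolding cis_mult by (simp only: cis_pi_int)
  qed
  have K: "?K summable_on UNIV"
    using hecke_kernel_poisson(1) [OF \<beta> t, of "of_int e / 2" "of_int (e + 1) / 2" a b]
    unfolding msign_cis by (simp add: \<beta>_def a_def b_def)
  have "hecke_theta N e P i (\<i> * of_real t) = infsum (\<lambda>p. ?K p + (S1 p + S2 p)) UNIV"
    unfolding hecke_theta_def
  proof (rule infsum_cong)
    fix p :: "int \<times> int"
    obtain j r where p: "p = (j, r)" by (cases p)
    define x where "x = of_int j + a"
    define y where "y = of_int r + b"
    define E where "E = exp (- pi * t * ((\<beta> + 1) * x\<^sup>2 - \<beta> * y\<^sup>2))"
    have q: "qpow (\<i> * of_real t) (hecke_exponent N P i j r) = of_real E"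
      by (simp add: qpow_imaginary E_def hecke_exponent_def hecke_form_def x_def y_def a_def b_def \<beta>_def)
    have k: "hecke_kernel \<beta> t x y = E * ((error_fun (sqrt A * (x + y)) + error_fun (sqrt A * (x - y))) / 2)"
      by (simp add: hecke_kernel_def E_def A_def)
    have 1: "\<phi>1 (j - r) = complex_of_real ((bool_sgn (r < j) - error_fun (sqrt A * (x - y))) / 2)"
      by (simp add: \<phi>1_def x_def y_def algebra_simps)
    have 2: "\<phi>2 (j + r) = complex_of_real ((bool_sgn (- r - P \<le> j) - error_fun (sqrt A * (x + y))) / 2)"
    proof -
      have "- P \<le> j + r \<longleftrightarrow> - r - P \<le> j" by auto
      then show ?thesis by (simp add: \<phi>2_def x_def y_def algebra_simps)
    qed
    have "hecke_weight P j r * E = hecke_kernel \<beta> t x y + (bool_sgn (r < j) - error_fun (sqrt A * (x - y))) / 2 * E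
        + (bool_sgn (- r - P \<le> j) - error_fun (sqrt A * (x + y))) / 2 * E"
      unfolding k hecke_weight_def by (simp add: field_simps)
    then have "of_real (hecke_weight P j r) * complex_of_real E = of_real (hecke_kernel \<beta> t x y) + \<phi>1 (j - r) * of_real E + \<phi>2 (j + r) * of_real E"
      unfolding 1 2 of_real_mult [symmetric] of_real_add [symmetric] by simp
    then have "msign (e * j + (e + 1) * r) * (of_real (hecke_weight P j r) * complex_of_real E) =
        msign (e * j + (e + 1) * r) * (of_real (hecke_kernel \<beta> t x y) + \<phi>1 (j - r) * of_real E + \<phi>2 (j + r) * of_real E)"
      by simp
    then show "(case p of (j, r) \<Rightarrow> msign (e * j + (e + 1) * r) * of_real (hecke_weight P j r) * qpow (\<i> * of_real t) (hecke_exponent N P i j r)) =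
        ?K p + (S1 p + S2 p)"
      unfolding p S1_def S2_def prod.case q a_def [symmetric] b_def [symmetric] \<beta>_def [symmetric]
        x_def [symmetric] y_def [symmetric]
      by (simp only: distrib_left mult.assoc add.assoc)
  qed
  also have "\<dots> = infsum ?K UNIV + (infsum S1 UNIV + infsum S2 UNIV)"
    by (subst infsum_add, rule K, rule summable_on_add [OF S1 S2], subst infsum_add [OF S1 S2], rule refl)
  also have "infsum S1 UNIV = 0"
    unfolding S1_def by (rule infsum_reflection_diff [OF N])
  also have "infsum S2 UNIV = 0"
    unfolding S2_def by (rule infsum_reflection_sum [OF N])
  finally show ?thesis by simp
qed

lemma hecke_kernel_minus: "hecke_kernel \<beta> t (- x) y = - hecke_kernel \<beta> t x y"
  "hecke_kernel \<beta> t x (- y) = hecke_kernel \<beta> t x y"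
proof -
  have "error_fun (c * (- x + y)) = - error_fun (c * (x - y))"
    "error_fun (c * (- x - y)) = - error_fun (c * (x + y))" for c
    by (simp_all add: algebra_simps flip: error_fun_minus)
  then have "hecke_kernel \<beta> t (- x) y = exp (- pi * t * ((\<beta> + 1) * x\<^sup>2 - \<beta> * y\<^sup>2)) *
      ((- error_fun (sqrt (2 * \<beta> * (\<beta> + 1) * pi * t) * (x - y)) + - error_fun (sqrt (2 * \<beta> * (\<beta> + 1) * pi * t) * (x + y))) / 2)"
    by (simp only: hecke_kernel_def power2_minus)
  then show "hecke_kernel \<beta> t (- x) y = - hecke_kernel \<beta> t x y"
    by (simp only: hecke_kernel_def minus_add_distrib [symmetric] minus_divide_left [symmetric] mult_minus_right add.commute)
  show "hecke_kernel \<beta> t x (- y) = hecke_kernel \<beta> t x y"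
    by (simp add: hecke_kernel_def add.commute)
qed

text \<open>The weight itself is not invariant under reflection of the second coordinate, since one
  of its inequalities is strict and the other weak. The kernel is even in that coordinate, so the
  symmetry is derived from the kernel sum.\<close>

lemma hecke_theta_imaginary_symmetry:
  assumes N: "N > 0" and t: "t > 0"
  shows "hecke_theta N e P (- i - 1) (\<i> * of_real t) = msign ((e + 1) * P) * hecke_theta N e P i (\<i> * of_real t)"
proof -
  let ?K = "\<lambda>i (j, r). msign (e * j + (e + 1) * r) *
       complex_of_real (hecke_kernel (of_int N) t (of_int j + hecke_shift1 N P) (of_int r + hecke_shift2 N P i))"
  have "infsum (?K (- i - 1)) UNIV = infsum (\<lambda>p. msign ((e + 1) * P) * ?K i p) UNIV"
  proof (rule infsum_reindex_bij_witness [of _ "\<lambda>(j, r). (j, - r - P)" "\<lambda>(j, r). (j, - r - P)"])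
    fix p :: "int \<times> int"
    obtain j r where p: "p = (j, r)" by (cases p)
    have k: "hecke_kernel (of_int N) t x (of_int (- r - P) + hecke_shift2 N P i) =
        hecke_kernel (of_int N) t x (of_int r + hecke_shift2 N P (- i - 1))" for x
      by (simp only: hecke_shift2_reflect [OF N] hecke_kernel_minus)
    have "msign ((e + 1) * P) * msign (e * j + (e + 1) * (- r - P)) = msign (e * j + (e + 1) * r)"
      by (auto simp: msign_def)
    then show "msign ((e + 1) * P) * ?K i (case p of (j, r) \<Rightarrow> (j, - r - P)) = ?K (- i - 1) p"
      unfolding p prod.case k by (simp only: mult.assoc [symmetric])
  qed auto
  then show ?thesis
    unfolding hecke_theta_eq_kernel [OF N t] by (simp only: infsum_cmult_right')
qed

section \<open>Sorting the dual lattice into cosets\<close>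

lemma infsum_residue_classes:
  fixes f :: "int \<Rightarrow> int \<Rightarrow> complex" and A B c d :: int
  assumes f: "(\<lambda>(k, l). f k l) summable_on UNIV" and AB: "A > 0" "B > 0"
  shows "(\<Sum>\<^sub>\<infinity>(k, l). f k l) =
    (\<Sum>p\<in>{0..<A}. \<Sum>i\<in>{0..<B}. \<Sum>\<^sub>\<infinity>(j, r). f (p - A * j) (i + B * r))"
proof -
  let ?S = "({0..<A} \<times> {0..<B}) \<times> (UNIV :: (int \<times> int) set)"
  let ?g = "\<lambda>((p, i), (j, r)). f (p - A * j) (i + B * r)"
  \<comment> \<open>The first quotient is negated because the dual frequency will correspond to
    minus the first coordinate of a coset vector.\<close>
  let ?w = "\<lambda>(k, l). ((k mod A, l mod B), (- (k div A), l div B))"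
  let ?v = "\<lambda>((p, i), (j, r)). (p - A * j, i + B * r)"
  have mod: "(p - A * j) mod A = p" "(p - A * j) div A = - j" if "p \<in> {0..<A}" for p j
  proof -
    have "(p + (- j) * A) div A = - j" "(p + (- j) * A) mod A = p"
      using that AB by (simp_all add: div_mult_self1 mod_mult_self1 del: mult_minus_left)
    then show "(p - A * j) mod A = p" "(p - A * j) div A = - j"
      by (simp_all add: algebra_simps)
  qed
  have mod': "(p + B * j) mod B = p" "(p + B * j) div B = j" if "p \<in> {0..<B}" for p j
    using that AB by simp_all
  have sg: "?g summable_on ?S" and eq: "infsum (\<lambda>(k, l). f k l) UNIV = infsum ?g ?S"
  proof -
    have "(\<lambda>(k, l). f k l) summable_on UNIV \<longleftrightarrow> ?g summable_on ?S"
      by (rule summable_on_reindex_bij_witness [of _ ?v ?w])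
         (use AB mod mod' in \<open>auto simp: mult_div_mod_eq\<close>)
    with f show "?g summable_on ?S" by simp
    show "infsum (\<lambda>(k, l). f k l) UNIV = infsum ?g ?S"
      by (rule infsum_reindex_bij_witness [of _ ?v ?w])
         (use AB mod mod' in \<open>auto simp: mult_div_mod_eq\<close>)
  qed
  have "infsum ?g ?S = (\<Sum>\<^sub>\<infinity>x\<in>{0..<A} \<times> {0..<B}. \<Sum>\<^sub>\<infinity>y. ?g (x, y))"
    by (rule infsum_Sigma_banach [OF sg, symmetric])
  also have "\<dots> = (\<Sum>x\<in>{0..<A} \<times> {0..<B}. \<Sum>\<^sub>\<infinity>y. ?g (x, y))"
    by (rule infsum_finite) simp
  also have "\<dots> = (\<Sum>p\<in>{0..<A}. \<Sum>i\<in>{0..<B}. \<Sum>\<^sub>\<infinity>(j, r). f (p - A * j) (i + B * r))"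
    by (simp add: sum.cartesian_product case_prod_unfold)
  finally show ?thesis using eq by simp
qed

lemma summable_on_int_pairs_shift:
  fixes f :: "int \<Rightarrow> int \<Rightarrow> complex"
  assumes "(\<lambda>(k, l). f k l) summable_on UNIV"
  shows "(\<lambda>(k, l). f (k + c) (l + d)) summable_on UNIV"
    and "(\<Sum>\<^sub>\<infinity>(k, l). f (k + c) (l + d)) = (\<Sum>\<^sub>\<infinity>(k, l). f k l)"
proof -
  have "(\<lambda>(k, l). f k l) summable_on UNIV \<longleftrightarrow> (\<lambda>(k, l). f (k + c) (l + d)) summable_on UNIV"
    by (rule summable_on_reindex_bij_witness [of _ "\<lambda>(k, l). (k + c, l + d)" "\<lambda>(k, l). (k - c, l - d)"]) auto
  with assms show "(\<lambda>(k, l). f (k + c) (l + d)) summable_on UNIV" by simp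
  show "(\<Sum>\<^sub>\<infinity>(k, l). f (k + c) (l + d)) = (\<Sum>\<^sub>\<infinity>(k, l). f k l)"
    by (rule infsum_reindex_bij_witness [of _ "\<lambda>(k, l). (k - c, l - d)" "\<lambda>(k, l). (k + c, l + d)"]) auto
qed

text \<open>In units of pi, the part of the dual phase that does not involve the dual index
  \<open>l\<close>.\<close>

definition S_phase :: "int \<Rightarrow> int \<Rightarrow> int \<Rightarrow> int \<Rightarrow> real" where
  "S_phase N P P' i = - of_int (P * P') / (2 * (of_int N + 1)) + of_int (P * P' + P' * (2 * i + 1)) / 2"

text \<open>Dualising turns the coset shifts into characters and the sign character into a
  half-integral shift, so \<open>P\<close> and \<open>e\<close> change places. Oddness of the kernel
  in its first coordinate turns the factor -i of the Poisson formula into i.\<close>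

lemma hecke_theta_imaginary_transform_aux:
  fixes M N e P i :: int
  assumes M: "M \<ge> 0" and N: "N = 2 * M + 1" and t: "t > 0"
  shows "hecke_theta N e P i (\<i> * of_real t) = \<i> / complex_of_real (t * sqrt (of_int N * (of_int N + 1))) *
    (\<Sum>p\<in>{0..N}. \<Sum>l\<in>{- M..M}. cis (pi * (S_phase N P (2 * p + e) i + of_int ((2 * l + 1) * P) / 2
        + of_int ((2 * i + 1) * (2 * l + 1)) / (2 * of_int N))) *
      hecke_theta N P (2 * p + e) l (\<i> * of_real (1 / t)))"
proof -
  define \<beta> where "\<beta> = real_of_int N"
  have N0: "N > 0" and \<beta>: "\<beta> > 0" using M N by (auto simp: \<beta>_def)
  define a where "a = hecke_shift1 N P"
  define b where "b = hecke_shift2 N P i"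
  define \<mu> where "\<mu> = real_of_int e / 2"
  define \<nu> where "\<nu> = real_of_int (e + 1) / 2"
  define f where "f = (\<lambda>k l::int. cis (2 * pi * (of_int k - \<mu>) * a) * cis (2 * pi * (of_int l - \<nu>) * b) *
       complex_of_real (hecke_kernel \<beta> (1 / t) ((of_int k - \<mu>) / (\<beta> + 1)) ((of_int l - \<nu>) / \<beta>)))"
  \<comment> \<open>The integers \<open>c\<close> and \<open>d\<close> are the solutions of the
    equations \<open>X\<close> and \<open>Y\<close> below: they move the dual lattice so that its
    residue classes become the cosets with parameters \<open>2 * p + e\<close> and \<open>l\<close>,
    where \<open>l\<close> runs symmetrically over \<open>{- M..M}\<close>.\<close>
  define c where "c = - M * e"
  define d where "d = (M + 1) * e + 1 - M"
  have msign_cis: "cis (2 * pi * \<mu> * of_int j) * cis (2 * pi * \<nu> * of_int r) = msign (e * j + (e + 1) * r)" for j r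
  proof -
    have "2 * pi * \<mu> * of_int j + 2 * pi * \<nu> * of_int r = pi * of_int (e * j + (e + 1) * r)"
      by (simp add: \<mu>_def \<nu>_def field_simps)
    then show ?thesis
      unfolding cis_mult by (simp only: cis_pi_int)
  qed
  note poisson = hecke_kernel_poisson [OF \<beta> t, where \<mu> = \<mu> and \<nu> = \<nu> and a = a and b = b, unfolded msign_cis]
  have sf: "(\<lambda>(k, l). f k l) summable_on UNIV"
    using poisson(2) unfolding f_def .
  have "hecke_theta N e P i (\<i> * of_real t) = - \<i> / complex_of_real (t * sqrt (\<beta> * (\<beta> + 1))) * (\<Sum>\<^sub>\<infinity>(k, l). f k l)"
    unfolding hecke_theta_eq_kernel [OF N0 t] f_def using poisson(3) by (simp only: a_def b_def \<beta>_def)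
  also have "(\<Sum>\<^sub>\<infinity>(k, l). f k l) = (\<Sum>\<^sub>\<infinity>(k, l). f (k + c) (l + d))"
    by (rule summable_on_int_pairs_shift(2) [OF sf, symmetric])
  also have "\<dots> = (\<Sum>p\<in>{0..<N + 1}. \<Sum>l\<in>{0..<N}. \<Sum>\<^sub>\<infinity>(j, r). f (p - (N + 1) * j + c) (l + N * r + d))"
    by (rule infsum_residue_classes [OF summable_on_int_pairs_shift(1) [OF sf]]) (use N0 in auto)
  also have "\<dots> = (\<Sum>p\<in>{0..N}. \<Sum>l\<in>{- M..M}. \<Sum>\<^sub>\<infinity>(j, r). f (p - (N + 1) * j + c) (l + M + N * r + d))"
  proof -
    have "{0..<N + 1} = {0..N}" by auto
    moreover have "(\<Sum>l\<in>{0..<N}. g l) = (\<Sum>l\<in>{- M..M}. g (l + M))" for g :: "int \<Rightarrow> complex"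
      by (rule sum.reindex_bij_witness [of _ "\<lambda>l. l + M" "\<lambda>l. l - M"]) (use N in auto)
    ultimately show ?thesis by simp
  qed
  also have "\<dots> = (\<Sum>p\<in>{0..N}. \<Sum>l\<in>{- M..M}. - (cis (pi * (S_phase N P (2 * p + e) i + of_int ((2 * l + 1) * P) / 2
        + of_int ((2 * i + 1) * (2 * l + 1)) / (2 * of_int N))) *
      hecke_theta N P (2 * p + e) l (\<i> * of_real (1 / t))))"
  proof (intro sum.cong refl)
    fix p l :: int
    define P' where "P' = 2 * p + e"
    define G where "G = cis (pi * (S_phase N P P' i + of_int ((2 * l + 1) * P) / 2
        + of_int ((2 * i + 1) * (2 * l + 1)) / (2 * of_int N)))"
    \<comment> \<open>Replacing \<open>j\<close> and \<open>r\<close> by \<open>j + p\<close> and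
      \<open>r + p\<close> puts the same \<open>P' = 2 * p + e\<close> into both shifts.\<close>
    have fterm: "f (p - (N + 1) * (j + p) + c) (l + M + N * (r + p) + d) =
        - G * (msign (P * j + (P + 1) * r) * complex_of_real (hecke_kernel \<beta> (1 / t) (of_int j + hecke_shift1 N P') (of_int r + hecke_shift2 N P' l)))" for j r
    proof -
      define X where "X = of_int j + hecke_shift1 N P'"
      define Y where "Y = of_int r + hecke_shift2 N P' l"
      have X: "real_of_int (p - (N + 1) * (j + p) + c) - \<mu> = - ((\<beta> + 1) * X)"
        unfolding X_def \<beta>_def distrib_left hecke_shift_mult [OF N0]
        by (simp add: c_def \<mu>_def P'_def N field_simps)
      have Y: "real_of_int (l + M + N * (r + p) + d) - \<nu> = \<beta> * Y"
        unfolding Y_def \<beta>_def distrib_left hecke_shift_mult [OF N0]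
        by (simp add: d_def \<nu>_def P'_def N field_simps)
      have "cis (2 * pi * (- ((\<beta> + 1) * X)) * a) * cis (2 * pi * (\<beta> * Y) * b) = G * msign (P * j + (P + 1) * r)"
      proof -
        have "2 * pi * (- ((\<beta> + 1) * X)) * a + 2 * pi * (\<beta> * Y) * b = pi * (2 * (\<beta> * Y) * b - 2 * ((\<beta> + 1) * X) * a)"
          by (simp add: algebra_simps)
        also have "2 * (\<beta> * Y) * b - 2 * ((\<beta> + 1) * X) * a =
          S_phase N P P' i + of_int ((2 * l + 1) * P) / 2 + of_int ((2 * i + 1) * (2 * l + 1)) / (2 * of_int N)
            + of_int (r * (N * P + 2 * i + 1) - N * P * j)"
        proof -
          have bY: "\<beta> * Y = \<beta> * of_int r + (\<beta> * of_int P' + of_int (2 * l + 1)) / 2"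
            unfolding Y_def \<beta>_def distrib_left hecke_shift_mult [OF N0] by simp
          have bX: "(\<beta> + 1) * X = (\<beta> + 1) * of_int j + \<beta> * of_int P' / 2"
            unfolding X_def \<beta>_def distrib_left hecke_shift_mult [OF N0] by simp
          have b: "b = (of_int P + of_int (2 * i + 1) / \<beta>) / 2"
            using \<beta> by (simp add: b_def hecke_shift2_def \<beta>_def field_simps)
          have a: "a = (of_int P - of_int P / (\<beta> + 1)) / 2"
            using \<beta> by (simp add: a_def hecke_shift1_def \<beta>_def field_simps)
          have 1: "2 * (\<beta> * Y) * b = of_int r * (\<beta> * of_int P + of_int (2 * i + 1))
              + (\<beta> * of_int P * of_int P' + of_int P' * of_int (2 * i + 1) + of_int (2 * l + 1) * of_int P) / 2
              + of_int (2 * i + 1) * of_int (2 * l + 1) / (2 * \<beta>)"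
            unfolding bY b using \<beta> by (simp add: field_simps)
          have 2: "2 * ((\<beta> + 1) * X) * a = \<beta> * of_int P * of_int j + \<beta> * of_int P * of_int P' / 2 - of_int P * of_int P' / 2
              + of_int P * of_int P' / (2 * (\<beta> + 1))"
          proof -
            have "2 * (k * x + (k - 1) * y / 2) * ((z - z / k) / 2) =
                (k - 1) * z * x + (k - 1) * z * y / 2 - z * y / 2 + z * y / (2 * k)" if "k > 0" for k x y z :: real
              using that by (simp add: field_simps)
            from this [of "\<beta> + 1"] show ?thesis
              unfolding bX a using \<beta> by simp
          qed
          show ?thesis
            unfolding 1 2 unfolding S_phase_def \<beta>_def
            by (simp add: add_divide_distrib diff_divide_distrib algebra_simps)
        qed
        finally have "cis (2 * pi * (- ((\<beta> + 1) * X)) * a) * cis (2 * pi * (\<beta> * Y) * b) =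
            G * cis (pi * of_int (r * (N * P + 2 * i + 1) - N * P * j))"
          unfolding cis_mult G_def by (simp only: distrib_left)
        also have "cis (pi * of_int (r * (N * P + 2 * i + 1) - N * P * j)) = msign (P * j + (P + 1) * r)"
          unfolding cis_pi_int by (auto simp: msign_def N)
        finally show ?thesis .
      qed
      then show ?thesis
        using \<beta> unfolding f_def X Y X_def [symmetric] Y_def [symmetric]
        by (simp add: hecke_kernel_minus mult.assoc)
    qed
    have "(\<Sum>\<^sub>\<infinity>(j, r). f (p - (N + 1) * j + c) (l + M + N * r + d)) =
        (\<Sum>\<^sub>\<infinity>(j, r). f (p - (N + 1) * (j + p) + c) (l + M + N * (r + p) + d))"
      by (rule infsum_reindex_bij_witness [of _ "\<lambda>(j, r). (j + p, r + p)" "\<lambda>(j, r). (j - p, r - p)"]) auto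
    also have "\<dots> = - G * hecke_theta N P P' l (\<i> * of_real (1 / t))"
      unfolding fterm hecke_theta_eq_kernel [OF N0 divide_pos_pos [OF zero_less_one t]] \<beta>_def
      by (simp only: infsum_cmult_right' [symmetric] case_prod_unfold)
    finally show "(\<Sum>\<^sub>\<infinity>(j, r). f (p - (N + 1) * j + c) (l + M + N * r + d)) =
        - (cis (pi * (S_phase N P (2 * p + e) i + of_int ((2 * l + 1) * P) / 2
        + of_int ((2 * i + 1) * (2 * l + 1)) / (2 * of_int N))) *
      hecke_theta N P (2 * p + e) l (\<i> * of_real (1 / t)))"
      by (simp add: G_def P'_def)
  qed
  finally show ?thesis
    by (simp add: sum_negf \<beta>_def)
qed

section \<open>The modular transformations of Hecke sums\<close>

text \<open>The halving at \<open>2 * l + 1 = N\<close> belongs to the index \<open>l = M\<close>,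
  which has no partner in the pairing that produces the sines.\<close>

definition S_coeff :: "int \<Rightarrow> int \<Rightarrow> int \<Rightarrow> int \<Rightarrow> int \<Rightarrow> complex" where
  "S_coeff N P P' i l = cis (pi * (S_phase N P P' i + of_int ((2 * l + 1) * P) / 2)) *
     (2 * \<i> * of_real (sin (pi * of_int ((2 * i + 1) * (2 * l + 1)) / (2 * of_int N)))) /
     (if 2 * l + 1 = N then 2 else 1)"

lemma cis_minus_cis: "cis x - cis (- x) = 2 * \<i> * of_real (sin x)"
  by (simp add: complex_eq_iff)

text \<open>The indices \<open>l\<close> and \<open>- l - 1\<close> carry the same function up to
  sign, so their exponentials combine to a sine. In \<open>{- M..M}\<close> only
  \<open>l = M\<close> stays alone.\<close>

lemma hecke_theta_imaginary_transform:
  fixes M N e P i :: int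
  assumes M: "M \<ge> 0" and N: "N = 2 * M + 1" and t: "t > 0" and odd: "odd P \<or> odd e"
  shows "hecke_theta N e P i (\<i> * of_real t) = \<i> / complex_of_real (t * sqrt (of_int N * (of_int N + 1))) *
    (\<Sum>p\<in>{0..N}. \<Sum>l\<in>{0..M}. S_coeff N P (2 * p + e) i l * hecke_theta N P (2 * p + e) l (\<i> * of_real (1 / t)))"
proof -
  have N0: "N > 0" using M N by simp
  have "(\<Sum>l\<in>{- M..M}. cis (pi * (S_phase N P (2 * p + e) i + of_int ((2 * l + 1) * P) / 2
        + of_int ((2 * i + 1) * (2 * l + 1)) / (2 * of_int N))) *
      hecke_theta N P (2 * p + e) l (\<i> * of_real (1 / t))) =
    (\<Sum>l\<in>{0..M}. S_coeff N P (2 * p + e) i l * hecke_theta N P (2 * p + e) l (\<i> * of_real (1 / t)))"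
    (is "sum ?g _ = sum ?h _") for p
  proof -
    define T where "T = (\<lambda>l. hecke_theta N P (2 * p + e) l (\<i> * of_real (1 / t)))"
    define s where "s = S_phase N P (2 * p + e) i"
    have "{- M..M} = ({0..<M} \<union> {- M..- 1}) \<union> {M}" using M by auto
    then have "sum ?g {- M..M} = sum ?g ({0..<M} \<union> {- M..- 1}) + ?g M"
      by (simp only:) (subst sum.union_disjoint, use M in auto)
    also have "sum ?g ({0..<M} \<union> {- M..- 1}) = sum ?g {0..<M} + sum ?g {- M..- 1}"
      by (subst sum.union_disjoint) auto
    also have "sum ?g {- M..- 1} = (\<Sum>l\<in>{0..<M}. ?g (- l - 1))"
      by (rule sum.reindex_bij_witness [of _ "\<lambda>l. - l - 1" "\<lambda>l. - l - 1"]) auto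
    also have "sum ?g {0..<M} + (\<Sum>l\<in>{0..<M}. ?g (- l - 1)) = (\<Sum>l\<in>{0..<M}. ?g l + ?g (- l - 1))"
      by (rule sum.distrib [symmetric])
    also have "\<dots> = sum ?h {0..<M}"
    proof (rule sum.cong [OF refl])
      fix l assume l: "l \<in> {0..<M}"
      define \<theta> where "\<theta> = pi * of_int ((2 * i + 1) * (2 * l + 1)) / (2 * of_int N)"
      define u where "u = cis (pi * (s + of_int ((2 * l + 1) * P) / 2))"
      have 1: "?g l = u * cis \<theta> * T l"
        unfolding u_def cis_mult s_def [symmetric] T_def \<theta>_def by (simp only: distrib_left times_divide_eq_right)
      have 2: "cis (pi * (s + of_int ((2 * (- l - 1) + 1) * P) / 2 + of_int ((2 * i + 1) * (2 * (- l - 1) + 1)) / (2 * of_int N))) =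
          u * (msign P * cis (- \<theta>))"
      proof -
        have "pi * (s + of_int ((2 * (- l - 1) + 1) * P) / 2 + of_int ((2 * i + 1) * (2 * (- l - 1) + 1)) / (2 * of_int N)) =
            pi * (s + of_int ((2 * l + 1) * P) / 2) + (pi * of_int (- (2 * l + 1) * P) + (- \<theta>))"
        proof -
          have "(2 * i + 1) * (2 * (- l - 1) + 1) = - ((2 * i + 1) * (2 * l + 1))"
            "(2 * (- l - 1) + 1) * P = - ((2 * l + 1) * P)"
            by (simp_all add: algebra_simps)
          moreover have "- (2 * l + 1) * P = - ((2 * l + 1) * P)"
            by (simp add: algebra_simps)
          moreover have "pi * (s + - (A / 2) + - (B / D)) = pi * (s + A / 2) + (pi * (- A) + - (pi * B / D))" for A B D
            by (simp add: field_simps)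
          ultimately show ?thesis
            unfolding \<theta>_def by (simp only: of_int_minus minus_divide_left [symmetric])
        qed
        moreover have "msign (- (2 * l + 1) * P) = msign P" by (simp add: msign_def)
        ultimately show ?thesis
          unfolding u_def by (simp only: cis_mult [symmetric] cis_pi_int)
      qed
      \<comment> \<open>The parity hypothesis enters here: the relative sign -1 selects sines over
        cosines.\<close>
      have mm: "msign P * msign ((P + 1) * (2 * p + e)) = - 1"
        using odd by (auto simp: msign_def)
      have rearrange: "(u * (m1 * c)) * (m2 * z) = (m1 * m2) * (u * c * z)" for m1 m2 c z
        by (simp add: mult_ac)
      have 3: "?g (- l - 1) = - (u * cis (- \<theta>) * T l)"
        unfolding s_def [symmetric] 2 hecke_theta_imaginary_symmetry [OF N0 divide_pos_pos [OF zero_less_one t]] T_def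
        unfolding rearrange mm by simp
      have "?g l + ?g (- l - 1) = u * (cis \<theta> - cis (- \<theta>)) * T l"
        unfolding 1 3 by (simp add: algebra_simps)
      also have "\<dots> = ?h l"
        using l N unfolding cis_minus_cis S_coeff_def u_def \<theta>_def T_def s_def by simp
      finally show "?g l + ?g (- l - 1) = ?h l" .
    qed
    also have "?g M = ?h M"
    proof -
      have "cis (pi * (s + of_int ((2 * M + 1) * P) / 2 + of_int ((2 * i + 1) * (2 * M + 1)) / (2 * of_int N))) =
          cis (pi * (s + of_int ((2 * M + 1) * P) / 2)) * cis (pi * of_int ((2 * i + 1) * (2 * M + 1)) / (2 * of_int N))"
        unfolding cis_mult by (simp only: distrib_left times_divide_eq_right)
      \<comment> \<open>As \<open>2 * M + 1 = N\<close>, the angle is an odd multiple of pi / 2. The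
        cosine vanishes, and the single exponential is half of what a pair would give.\<close>
      moreover have "cis (pi * of_int ((2 * i + 1) * (2 * M + 1)) / (2 * of_int N)) =
          \<i> * of_real (sin (pi * of_int ((2 * i + 1) * (2 * M + 1)) / (2 * of_int N)))"
      proof -
        have x: "pi * of_int ((2 * i + 1) * (2 * M + 1)) / (2 * of_int N) = (2 * of_int i + 1) * (pi / 2)"
          using N0 unfolding N [symmetric] by (simp add: field_simps)
        have "cos ((2 * of_int i + 1) * (pi / 2)) = 0"
          unfolding cos_zero_iff_int by (rule exI [of _ "2 * i + 1"]) simp
        then show ?thesis
          unfolding x by (simp add: complex_eq_iff)
      qed
      ultimately show ?thesis
        unfolding S_coeff_def s_def using N by simp
    qed
    also have "sum ?h {0..<M} + ?h M = sum ?h ({0..<M} \<union> {M})"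
      by (subst sum.union_disjoint) auto
    also have "{0..<M} \<union> {M} = {0..M}" using M by auto
    finally show ?thesis .
  qed
  then show ?thesis
    unfolding hecke_theta_imaginary_transform_aux [OF M N t] by simp
qed

section \<open>Holomorphy, and continuation from the imaginary axis\<close>

lemma norm_qpow: "norm (qpow \<tau> x) = exp (- 2 * pi * Im \<tau> * x)"
  unfolding qpow_def by simp

text \<open>On the cone itself the form is at least x^2 / 2. With slack \<open>C\<close>, completing
  squares costs half of this: up to multiples of C^2, the form is at least x^2 / 4 while x^2 + y^2
  is at most 3 x^2, whence the factor 1/12.\<close>

lemma hecke_form_cone_bound:
  assumes "\<beta> > 0" "C \<ge> 0" "\<bar>y\<bar> \<le> \<bar>x\<bar> + C"
  shows "(x\<^sup>2 + y\<^sup>2) / 12 - (\<beta> * (1 + 2 * \<beta>) + 1) * C\<^sup>2 \<le> hecke_form \<beta> x y"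
proof -
  have y: "y\<^sup>2 \<le> x\<^sup>2 + 2 * \<bar>x\<bar> * C + C\<^sup>2"
    using power_mono [OF assms(3) abs_ge_zero, of 2] by (simp add: power2_sum)
  have "0 \<le> (\<bar>x\<bar> - 2 * \<beta> * C)\<^sup>2" by simp
  then have 1: "2 * \<beta> * (2 * \<bar>x\<bar> * C) \<le> x\<^sup>2 + 4 * \<beta>\<^sup>2 * C\<^sup>2"
    by (simp add: power2_diff power_mult_distrib mult_ac)
  have "0 \<le> (\<bar>x\<bar> - C)\<^sup>2" by simp
  then have 2: "2 * \<bar>x\<bar> * C \<le> x\<^sup>2 + C\<^sup>2"
    by (simp add: power2_diff)
  have "\<beta> * y\<^sup>2 \<le> \<beta> * x\<^sup>2 + \<beta> * (2 * \<bar>x\<bar> * C) + \<beta> * C\<^sup>2"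
    using mult_left_mono [OF y, of \<beta>] assms(1) by (simp add: distrib_left)
  with 1 have 3: "\<beta> * y\<^sup>2 \<le> \<beta> * x\<^sup>2 + x\<^sup>2 / 2 + 2 * \<beta>\<^sup>2 * C\<^sup>2 + \<beta> * C\<^sup>2"
    by simp
  have lin: "(X + Y) / 12 - (r + 2 * p + q) \<le> h"
    if "0 \<le> p" "0 \<le> q" "0 \<le> r" "h = (bX + X - bY) / 2" "bY \<le> bX + X / 2 + 2 * p + r" "Y \<le> X + w + q" "w \<le> X + q"
    for X Y p q r h bX bY w :: real
  proof -
    have "X + Y \<le> 3 * X + 2 * q" using that by linarith
    moreover have "3 * X - 12 * p - 6 * r \<le> 12 * h" using that by simp
    ultimately have "X + Y \<le> 12 * h + 12 * r + 24 * p + 12 * q" using that(1-3) by argo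
    then show ?thesis by argo
  qed
  have "(\<beta> * (1 + 2 * \<beta>) + 1) * C\<^sup>2 = \<beta> * C\<^sup>2 + 2 * (\<beta>\<^sup>2 * C\<^sup>2) + C\<^sup>2"
    by (simp add: power2_eq_square algebra_simps)
  moreover have "(x\<^sup>2 + y\<^sup>2) / 12 - (\<beta> * C\<^sup>2 + 2 * (\<beta>\<^sup>2 * C\<^sup>2) + C\<^sup>2) \<le> hecke_form \<beta> x y"
    by (rule lin [of _ _ _ _ "\<beta> * x\<^sup>2" _ "\<beta> * y\<^sup>2" _ "2 * \<bar>x\<bar> * C"])
       (use assms 2 3 y in \<open>simp_all add: hecke_form_def algebra_simps\<close>)
  ultimately show ?thesis
    by (simp only:)
qed

lemma qpow_hecke_form_bound:
  assumes "\<beta> > 0" "C \<ge> 0" "\<bar>y\<bar> \<le> \<bar>x\<bar> + C" "t0 > 0" "t0 \<le> Im \<tau>" "Im \<tau> \<le> t1"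
  shows "norm (qpow \<tau> (hecke_form \<beta> x y)) \<le>
    exp (2 * pi * t1 * ((\<beta> * (1 + 2 * \<beta>) + 1) * C\<^sup>2)) * (exp (- (pi * t0 / 6) * x\<^sup>2) * exp (- (pi * t0 / 6) * y\<^sup>2))"
proof -
  define K where "K = (\<beta> * (1 + 2 * \<beta>) + 1) * C\<^sup>2"
  have K: "K \<ge> 0" using assms by (simp add: K_def)
  have "2 * pi * Im \<tau> * ((x\<^sup>2 + y\<^sup>2) / 12 - K) \<le> 2 * pi * Im \<tau> * hecke_form \<beta> x y"
    using hecke_form_cone_bound [OF assms(1-3)] assms by (intro mult_left_mono) (auto simp: K_def)
  moreover have "Im \<tau> * K \<le> t1 * K" "t0 * (x\<^sup>2 + y\<^sup>2) \<le> Im \<tau> * (x\<^sup>2 + y\<^sup>2)"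
    using K assms by (auto intro!: mult_right_mono)
  then have "2 * pi * (Im \<tau> * K) \<le> 2 * pi * (t1 * K)" "pi / 6 * (t0 * (x\<^sup>2 + y\<^sup>2)) \<le> pi / 6 * (Im \<tau> * (x\<^sup>2 + y\<^sup>2))"
    by (intro mult_left_mono; simp)+
  ultimately have "- 2 * pi * Im \<tau> * hecke_form \<beta> x y \<le> 2 * pi * t1 * K + (- (pi * t0 / 6) * x\<^sup>2 + - (pi * t0 / 6) * y\<^sup>2)"
    by (simp add: field_simps)
  then show ?thesis
    unfolding norm_qpow K_def [symmetric] exp_add [symmetric] by simp
qed

lemma summable_on_cone:
  fixes c :: "int \<Rightarrow> int \<Rightarrow> complex"
  assumes "\<beta> > 0" "C \<ge> 0" "Im \<tau> > 0"
    and "\<And>j r. (j, r) \<in> S \<Longrightarrow> \<bar>of_int r + b\<bar> \<le> \<bar>of_int j + a\<bar> + C"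
    and "\<And>j r. (j, r) \<in> S \<Longrightarrow> norm (c j r) \<le> 1"
  shows "(\<lambda>(j, r). c j r * qpow \<tau> (hecke_form \<beta> (of_int j + a) (of_int r + b))) summable_on S"
proof (rule summable_on_real_comparison)
  define d where "d = pi * Im \<tau> / 6"
  have "d > 0" using assms by (simp add: d_def)
  from summable_on_gaussian_int2 [OF this this, of a b]
  show "(\<lambda>(j, r). exp (- d * (of_int j + a)\<^sup>2) * exp (- d * (of_int r + b)\<^sup>2)) summable_on S"
    by (rule summable_on_subset_banach) auto
  fix p assume "p \<in> S"
  then obtain j r where p: "p = (j, r)" "(j, r) \<in> S" by (cases p) auto
  have "norm (c j r) * norm (qpow \<tau> (hecke_form \<beta> (of_int j + a) (of_int r + b))) \<le>
      1 * (exp (2 * pi * Im \<tau> * ((\<beta> * (1 + 2 * \<beta>) + 1) * C\<^sup>2)) * (exp (- d * (of_int j + a)\<^sup>2) * exp (- d * (of_int r + b)\<^sup>2)))"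
    unfolding d_def using assms p
    by (intro mult_mono qpow_hecke_form_bound) auto
  then show "norm (case p of (j, r) \<Rightarrow> c j r * qpow \<tau> (hecke_form \<beta> (of_int j + a) (of_int r + b))) \<le>
      exp (2 * pi * Im \<tau> * ((\<beta> * (1 + 2 * \<beta>) + 1) * C\<^sup>2)) * (case p of (j, r) \<Rightarrow> exp (- d * (of_int j + a)\<^sup>2) * exp (- d * (of_int r + b)\<^sup>2))"
    by (simp add: p norm_mult)
qed

lemma hecke_weight_support: "hecke_weight P j r \<noteq> 0 \<Longrightarrow> \<bar>r\<bar> \<le> \<bar>j\<bar> + \<bar>P\<bar>"
  unfolding hecke_weight_def bool_sgn_def by (auto split: if_splits)

lemma hecke_weight_bound: "\<bar>hecke_weight P j r\<bar> \<le> 1"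
  unfolding hecke_weight_def bool_sgn_def by auto

lemma abs_shift_le:
  assumes "\<bar>r\<bar> \<le> \<bar>j\<bar> + B"
  shows "\<bar>of_int r + b\<bar> \<le> \<bar>of_int j + a\<bar> + (of_int B + \<bar>a\<bar> + \<bar>b :: real\<bar>)"
proof -
  have "\<bar>real_of_int r\<bar> \<le> \<bar>of_int j\<bar> + of_int B"
    using assms by (metis of_int_abs of_int_add of_int_le_iff)
  then show ?thesis by linarith
qed

text \<open>The weight is supported in a fattened cone, where the exponent is positive definite up
  to a constant. On the ball of radius \<open>Im z / 2\<close> the imaginary part stays between
  \<open>\<rho>\<close> and \<open>3 * \<rho>\<close>, so one Gaussian majorant gives uniform
  convergence.\<close>

lemma holomorphic_hecke_theta:
  assumes N: "N > 0"
  shows "hecke_theta N e P i holomorphic_on {\<tau>. Im \<tau> > 0}"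
  unfolding holomorphic_on_def
proof
  fix z assume "z \<in> {\<tau>. Im \<tau> > 0}"
  then have z: "Im z > 0" by simp
  define \<beta> where "\<beta> = real_of_int N"
  have \<beta>: "\<beta> > 0" using N by (simp add: \<beta>_def)
  define a where "a = hecke_shift1 N P"
  define b where "b = hecke_shift2 N P i"
  define C where "C = of_int \<bar>P\<bar> + \<bar>a\<bar> + \<bar>b\<bar>"
  have C: "C \<ge> 0" by (simp add: C_def)
  define \<rho> where "\<rho> = Im z / 2"
  have \<rho>: "\<rho> > 0" using z by (simp add: \<rho>_def)
  define f where "f = (\<lambda>(j, r) \<tau>. msign (e * j + (e + 1) * r) * of_real (hecke_weight P j r) * qpow \<tau> (hecke_exponent N P i j r))"
  define K where "K = exp (2 * pi * (3 * \<rho>) * ((\<beta> * (1 + 2 * \<beta>) + 1) * C\<^sup>2))"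
  define d where "d = pi * \<rho> / 6"
  define B where "B = (\<lambda>(j::int, r::int). K * (exp (- d * (of_int j + a)\<^sup>2) * exp (- d * (of_int r + b)\<^sup>2)))"
  have d: "d > 0" using \<rho> by (simp add: d_def)
  have B: "B summable_on UNIV"
    unfolding B_def using summable_on_cmult_right [OF summable_on_gaussian_int2 [OF d d, of a b], of K]
    by (simp add: case_prod_unfold)
  have bound: "norm (f p \<tau>) \<le> B p" if "\<tau> \<in> cball z \<rho>" for p \<tau>
  proof -
    obtain j r where p: "p = (j, r)" by (cases p)
    have "\<bar>Im z - Im \<tau>\<bar> \<le> \<rho>"
      using that abs_Im_le_cmod [of "z - \<tau>"] by (simp add: dist_norm)
    then have Im: "\<rho> \<le> Im \<tau>" "Im \<tau> \<le> 3 * \<rho>"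
      unfolding \<rho>_def by linarith+
    show ?thesis
    proof (cases "hecke_weight P j r = 0")
      case True
      then show ?thesis by (simp add: p f_def B_def K_def)
    next
      case False
      have "norm (f p \<tau>) = \<bar>hecke_weight P j r\<bar> * norm (qpow \<tau> (hecke_form \<beta> (of_int j + a) (of_int r + b)))"
        by (simp add: p f_def norm_mult hecke_exponent_def a_def b_def \<beta>_def)
      also have "\<dots> \<le> 1 * (K * (exp (- d * (of_int j + a)\<^sup>2) * exp (- d * (of_int r + b)\<^sup>2)))"
        unfolding K_def d_def
      proof (rule mult_mono [OF hecke_weight_bound qpow_hecke_form_bound [OF \<beta> C _ \<rho> Im]])
        show "\<bar>of_int r + b\<bar> \<le> \<bar>of_int j + a\<bar> + C"
          unfolding C_def by (rule abs_shift_le [OF hecke_weight_support [OF False]])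
      qed auto
      finally show ?thesis by (simp add: p B_def)
    qed
  qed
  have ul: "uniform_limit (cball z \<rho>) (\<lambda>X \<tau>. \<Sum>p\<in>X. f p \<tau>) (\<lambda>\<tau>. \<Sum>\<^sub>\<infinity>p. f p \<tau>) (finite_subsets_at_top UNIV)"
    by (rule Weierstrass_m_test_general [OF bound B])
  have hol: "f p holomorphic_on S" for p S
    unfolding f_def qpow_def by (cases p) (auto intro!: holomorphic_intros)
  have "(\<lambda>\<tau>. \<Sum>\<^sub>\<infinity>p. f p \<tau>) holomorphic_on ball z \<rho>"
  proof (rule holomorphic_uniform_limit [OF _ ul])
    show "\<forall>\<^sub>F X in finite_subsets_at_top UNIV. continuous_on (cball z \<rho>) (\<lambda>\<tau>. \<Sum>p\<in>X. f p \<tau>) \<and> (\<lambda>\<tau>. \<Sum>p\<in>X. f p \<tau>) holomorphic_on ball z \<rho>"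
      by (intro always_eventually allI conjI holomorphic_on_imp_continuous_on holomorphic_on_sum hol)
  qed auto
  moreover have "(\<lambda>\<tau>. \<Sum>\<^sub>\<infinity>p. f p \<tau>) = hecke_theta N e P i"
    by (simp add: f_def hecke_theta_def fun_eq_iff case_prod_unfold)
  ultimately have "hecke_theta N e P i holomorphic_on ball z \<rho>" by simp
  then have "hecke_theta N e P i field_differentiable at z"
    using \<rho> by (intro holomorphic_on_imp_differentiable_at [of _ "ball z \<rho>"]) auto
  then show "hecke_theta N e P i field_differentiable at z within {\<tau>. Im \<tau> > 0}"
    by (rule field_differentiable_at_within)
qed

text \<open>If \<open>- 1 / \<tau> = \<i> * t\<close>, then the factor \<open>\<i> / t\<close> of
  the formula on the axis is \<open>\<tau>\<close> itself; in this form both sides are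
  holomorphic.\<close>

theorem hecke_theta_S:
  fixes M N e P i :: int
  assumes M: "M \<ge> 0" and N: "N = 2 * M + 1" and odd: "odd P \<or> odd e" and \<tau>: "Im \<tau> > 0"
  shows "hecke_theta N e P i (- 1 / \<tau>) = \<tau> / complex_of_real (sqrt (of_int N * (of_int N + 1))) *
    (\<Sum>p\<in>{0..N}. \<Sum>l\<in>{0..M}. S_coeff N P (2 * p + e) i l * hecke_theta N P (2 * p + e) l \<tau>)"
proof -
  let ?H = "{\<tau>. Im \<tau> > 0}"
  define C where "C = complex_of_real (sqrt (of_int N * (of_int N + 1)))"
  define F where "F = (\<lambda>\<tau>. hecke_theta N e P i (- 1 / \<tau>) - \<tau> / C *
    (\<Sum>p\<in>{0..N}. \<Sum>l\<in>{0..M}. S_coeff N P (2 * p + e) i l * hecke_theta N P (2 * p + e) l \<tau>))"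
  have N0: "N > 0" using M N by simp
  have inv: "Im (- 1 / \<tau>) > 0" if "Im \<tau> > 0" for \<tau> :: complex
    using that by (auto simp: Im_divide power2_eq_square intro!: divide_pos_pos add_nonneg_pos)
  have "F holomorphic_on ?H"
  proof -
    have "(hecke_theta N e P i \<circ> (\<lambda>\<tau>. - 1 / \<tau>)) holomorphic_on ?H"
      by (rule holomorphic_on_compose_gen [OF _ holomorphic_hecke_theta [OF N0]])
         (use inv in \<open>auto intro!: holomorphic_intros\<close>)
    then have 1: "(\<lambda>\<tau>. hecke_theta N e P i (- 1 / \<tau>)) holomorphic_on ?H"
      by (simp add: o_def)
    have 2: "(\<lambda>\<tau>. \<tau> / C) holomorphic_on ?H"
      using N0 by (intro holomorphic_intros) (auto simp: C_def)
    show ?thesis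
      unfolding F_def
      by (intro holomorphic_on_diff holomorphic_on_mult holomorphic_on_sum 1 2 holomorphic_hecke_theta [OF N0] holomorphic_on_const)
  qed
  moreover have "open ?H"
    by (rule open_halfspace_Im_gt)
  moreover have "connected ?H"
    by (rule convex_connected [OF convex_halfspace_Im_gt])
  moreover have "\<i> islimpt (\<lambda>s. \<i> * of_real s) ` {0<..}"
    unfolding islimpt_approachable
  proof (intro allI impI)
    fix \<epsilon> :: real assume "\<epsilon> > 0"
    moreover have "\<i> * complex_of_real (1 + \<epsilon> / 2) - \<i> = \<i> * of_real (\<epsilon> / 2)"
      by (simp add: algebra_simps)
    then have "dist (\<i> * complex_of_real (1 + \<epsilon> / 2)) \<i> = norm (\<i> * complex_of_real (\<epsilon> / 2))"
      unfolding dist_norm by (simp only:)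
    then have "dist (\<i> * complex_of_real (1 + \<epsilon> / 2)) \<i> = \<bar>\<epsilon> / 2\<bar>"
      by (simp only: norm_mult norm_of_real) simp
    ultimately show "\<exists>x'\<in>(\<lambda>s. \<i> * complex_of_real s) ` {0<..}. x' \<noteq> \<i> \<and> dist x' \<i> < \<epsilon>"
      by (intro bexI [of _ "\<i> * complex_of_real (1 + \<epsilon> / 2)"] imageI conjI) auto
  qed
  moreover have "F z = 0" if z: "z \<in> (\<lambda>s. \<i> * of_real s) ` {0<..}" for z
  proof -
    obtain s where s: "s > 0" "z = \<i> * of_real s" using z by auto
    have inv: "- 1 / z = \<i> * of_real (1 / s)"
      using s by (simp add: divide_simps)
    have "1 / s > 0" "1 / (1 / s) = s" using s by auto
    with hecke_theta_imaginary_transform [OF M N this(1) odd]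
    have "hecke_theta N e P i (- 1 / z) = \<i> / complex_of_real (1 / s * sqrt (of_int N * (of_int N + 1))) *
      (\<Sum>p\<in>{0..N}. \<Sum>l\<in>{0..M}. S_coeff N P (2 * p + e) i l * hecke_theta N P (2 * p + e) l z)"
      unfolding inv unfolding s(2) by (simp only:)
    moreover have "\<i> / complex_of_real (1 / s * sqrt (of_int N * (of_int N + 1))) = z / C"
      using s by (simp add: C_def)
    ultimately show ?thesis
      by (simp only: F_def diff_self)
  qed
  moreover have "(\<lambda>s. \<i> * complex_of_real s) ` {0<..} \<subseteq> ?H" "\<i> \<in> ?H" "\<tau> \<in> ?H"
    using \<tau> by auto
  ultimately have "F \<tau> = 0"
    using analytic_continuation by blast
  then show ?thesis
    by (simp add: F_def C_def)
qed

section \<open>The T-transformation\<close>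

lemma qpow_add: "qpow \<tau> (x + y) = qpow \<tau> x * qpow \<tau> y"
  by (simp add: qpow_def distrib_left exp_add)

lemma qpow_plus_one: "qpow (\<tau> + 1) x = qpow \<tau> x * cis (2 * pi * x)"
  by (simp add: qpow_def cis_conv_exp algebra_simps flip: exp_add)

lemma hecke_theta_parity:
  assumes "even (e - e')"
  shows "hecke_theta N e P i \<tau> = hecke_theta N e' P i \<tau>"
proof -
  have "msign (e * j + (e + 1) * r) = msign (e' * j + (e' + 1) * r)" for j r
    using assms by (auto simp: msign_def)
  then show ?thesis by (simp add: hecke_theta_def)
qed

definition T_phase :: "int \<Rightarrow> int \<Rightarrow> int \<Rightarrow> real" where
  "T_phase N P i = of_int (P\<^sup>2) / (4 * (of_int N + 1)) - of_int (P\<^sup>2 + 2 * P * (2 * i + 1)) / 4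
     - of_int ((2 * i + 1)\<^sup>2) / (4 * of_int N)"

text \<open>Twice the exponent is \<open>T_phase\<close> plus an integer. The integer contributes
  only through its parity, which twists the sign character and moves \<open>e\<close> to
  \<open>e + P\<close>.\<close>

theorem hecke_theta_T:
  assumes N: "N > 0" "odd N"
  shows "hecke_theta N e P i (\<tau> + 1) = cis (pi * T_phase N P i) * hecke_theta N (e + P) P i \<tau>"
proof -
  define \<beta> where "\<beta> = real_of_int N"
  have \<beta>: "\<beta> > 0" using N by (simp add: \<beta>_def)
  have ph: "msign (e * j + (e + 1) * r) * cis (2 * pi * hecke_exponent N P i j r) =
      cis (pi * T_phase N P i) * msign ((e + P) * j + (e + P + 1) * r)" for j r
  proof -
    define \<kappa> where "\<kappa> = real_of_int (2 * i + 1)"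
    have x: "of_int j + hecke_shift1 N P = of_int j + (of_int P - of_int P / (\<beta> + 1)) / 2"
      using \<beta> by (simp add: hecke_shift1_def \<beta>_def field_simps)
    have y: "of_int r + hecke_shift2 N P i = of_int r + (of_int P + \<kappa> / \<beta>) / 2"
      using \<beta> by (simp add: hecke_shift2_def \<kappa>_def \<beta>_def field_simps)
    have xsq: "k * (u + (v - v / k) / 2)\<^sup>2 = k * u\<^sup>2 + (k - 1) * u * v + (k - 2) * v\<^sup>2 / 4 + v\<^sup>2 / (4 * k)" if "k > 0" for k u v :: real
      using that by (simp add: power2_eq_square field_simps)
    have ysq: "k * (u + (v + w / k) / 2)\<^sup>2 = k * u\<^sup>2 + k * u * v + u * w + k * v\<^sup>2 / 4 + v * w / 2 + w\<^sup>2 / (4 * k)" if "k > 0" for k u v w :: real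
      using that by (simp add: power2_eq_square field_simps)
    have "2 * hecke_exponent N P i j r = (\<beta> + 1) * (of_int j + (of_int P - of_int P / (\<beta> + 1)) / 2)\<^sup>2 - \<beta> * (of_int r + (of_int P + \<kappa> / \<beta>) / 2)\<^sup>2"
      unfolding hecke_exponent_def hecke_form_def x y by (simp add: \<beta>_def)
    also have "\<dots> = T_phase N P i + of_int ((N + 1) * j\<^sup>2 + N * j * P - N * r\<^sup>2 - N * r * P - r * (2 * i + 1))"
      using \<beta> by (subst xsq, simp, subst ysq, simp)
        (simp add: T_phase_def \<kappa>_def [symmetric], simp add: \<kappa>_def \<beta>_def add_divide_distrib diff_divide_distrib algebra_simps)
    finally have "cis (2 * pi * hecke_exponent N P i j r) = cis (pi * T_phase N P i + pi * of_int ((N + 1) * j\<^sup>2 + N * j * P - N * r\<^sup>2 - N * r * P - r * (2 * i + 1)))"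
      by (simp only: mult.assoc mult.left_commute [of 2] distrib_left)
    also have "\<dots> = cis (pi * T_phase N P i) * msign ((N + 1) * j\<^sup>2 + N * j * P - N * r\<^sup>2 - N * r * P - r * (2 * i + 1))"
      by (simp only: cis_mult [symmetric] cis_pi_int)
    finally have "cis (2 * pi * hecke_exponent N P i j r) =
        cis (pi * T_phase N P i) * msign ((N + 1) * j\<^sup>2 + N * j * P - N * r\<^sup>2 - N * r * P - r * (2 * i + 1))" .
    \<comment> \<open>For odd \<open>N\<close> the integer is congruent to
      \<open>P * (j + r)\<close> modulo 2, because \<open>r^2 + r\<close> is even.\<close>
    moreover have "msign (e * j + (e + 1) * r) * msign ((N + 1) * j\<^sup>2 + N * j * P - N * r\<^sup>2 - N * r * P - r * (2 * i + 1)) =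
        msign ((e + P) * j + (e + P + 1) * r)"
      using N by (auto simp: msign_def)
    ultimately show ?thesis by (simp add: mult_ac)
  qed
  show ?thesis
    unfolding hecke_theta_def infsum_cmult_right' [symmetric]
  proof (rule infsum_cong)
    fix p :: "int \<times> int"
    obtain j r where p: "p = (j, r)" by (cases p)
    have "msign (e * j + (e + 1) * r) * of_real (hecke_weight P j r) * qpow (\<tau> + 1) (hecke_exponent N P i j r) =
        (msign (e * j + (e + 1) * r) * cis (2 * pi * hecke_exponent N P i j r)) * of_real (hecke_weight P j r) * qpow \<tau> (hecke_exponent N P i j r)"
      unfolding qpow_plus_one by (simp only: mult_ac)
    then show "(case p of (j, r) \<Rightarrow> msign (e * j + (e + 1) * r) * of_real (hecke_weight P j r) * qpow (\<tau> + 1) (hecke_exponent N P i j r)) =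
        cis (pi * T_phase N P i) * (case p of (j, r) \<Rightarrow> msign ((e + P) * j + (e + P + 1) * r) * of_real (hecke_weight P j r) * qpow \<tau> (hecke_exponent N P i j r))"
      unfolding p prod.case ph by (simp only: mult.assoc)
  qed
qed

section \<open>Splitting a Hecke sum into brackets and theta corrections\<close>

definition hecke_sum :: "int \<Rightarrow> int \<Rightarrow> int \<Rightarrow> int \<Rightarrow> complex \<Rightarrow> (int \<Rightarrow> int \<Rightarrow> real) \<Rightarrow> complex" where
  "hecke_sum N e P i \<tau> W =
     (\<Sum>\<^sub>\<infinity>(j, r). msign (e * j + (e + 1) * r) * of_real (W j r) * qpow \<tau> (hecke_exponent N P i j r))"

text \<open>These conditions give absolute convergence, which makes \<open>hecke_sum\<close>
  additive in the weight.\<close>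

definition cone_weight :: "(int \<Rightarrow> int \<Rightarrow> real) \<Rightarrow> bool" where
  "cone_weight W \<longleftrightarrow> (\<exists>B\<ge>0. \<forall>j r. W j r \<noteq> 0 \<longrightarrow> \<bar>r\<bar> \<le> \<bar>j\<bar> + B) \<and> (\<forall>j r. \<bar>W j r\<bar> \<le> 1)"

lemma summable_hecke_sum_on:
  assumes "N > 0" "Im \<tau> > 0" "B \<ge> 0" "\<And>j r. (j, r) \<in> S \<Longrightarrow> \<bar>r\<bar> \<le> \<bar>j\<bar> + B" "\<And>j r. norm (c j r) \<le> 1"
  shows "(\<lambda>(j, r). c j r * qpow \<tau> (hecke_exponent N P i j r)) summable_on S"
  unfolding hecke_exponent_def
proof (rule summable_on_cone)
  show "\<bar>of_int r + hecke_shift2 N P i\<bar> \<le> \<bar>of_int j + hecke_shift1 N P\<bar> + (of_int B + \<bar>hecke_shift1 N P\<bar> + \<bar>hecke_shift2 N P i\<bar>)"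
    if "(j, r) \<in> S" for j r
    by (rule abs_shift_le [OF assms(4) [OF that]])
qed (use assms in auto)

lemma summable_hecke_sum:
  assumes "N > 0" "Im \<tau> > 0" "cone_weight W"
  shows "(\<lambda>(j, r). msign (e * j + (e + 1) * r) * of_real (W j r) * qpow \<tau> (hecke_exponent N P i j r)) summable_on UNIV"
proof -
  obtain B where B: "B \<ge> 0" "\<And>j r. W j r \<noteq> 0 \<Longrightarrow> \<bar>r\<bar> \<le> \<bar>j\<bar> + B" and 1: "\<And>j r. \<bar>W j r\<bar> \<le> 1"
    using assms(3) unfolding cone_weight_def by blast
  have "(\<lambda>(j, r). msign (e * j + (e + 1) * r) * of_real (W j r) * qpow \<tau> (hecke_exponent N P i j r)) summable_on {(j, r). W j r \<noteq> 0}"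
    by (rule summable_hecke_sum_on [OF assms(1,2) B(1)]) (use B 1 in \<open>auto simp: norm_mult\<close>)
  then show ?thesis
    by (rule summable_on_cong_neutral [THEN iffD1, rotated 3]) auto
qed

lemma hecke_sum_add:
  assumes "N > 0" "Im \<tau> > 0" "cone_weight V" "cone_weight W" "\<And>j r. U j r = V j r + W j r"
  shows "hecke_sum N e P i \<tau> U = hecke_sum N e P i \<tau> V + hecke_sum N e P i \<tau> W"
  unfolding hecke_sum_def
  by (subst infsum_add [OF summable_hecke_sum [OF assms(1-3)] summable_hecke_sum [OF assms(1,2,4)], symmetric])
     (auto simp: assms(5) algebra_simps intro!: infsum_cong)

lemma bracket_reindex:
  assumes "\<And>r. f (g r) = r" "\<And>r. g (f r) = r"
  shows "bracket A B F = bracket (\<lambda>j r. A j (f r)) (\<lambda>j r. B j (f r)) (\<lambda>j r. F j (f r))"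
proof -
  have "(\<Sum>\<^sub>\<infinity>(j, r)\<in>{(j, r). A j r}. F j r) = (\<Sum>\<^sub>\<infinity>(j, r)\<in>{(j, r). A j (f r)}. F j (f r))" for A
    by (rule infsum_reindex_bij_witness [of _ "\<lambda>(j, r). (j, f r)" "\<lambda>(j, r). (j, g r)"]) (use assms in auto)
  then show ?thesis by (simp add: bracket_def)
qed

lemma bracket_eq_hecke_sum:
  assumes "N > 0" "Im \<tau> > 0" and B: "\<And>j r. A j r \<or> A' j r \<Longrightarrow> \<bar>r\<bar> \<le> \<bar>j\<bar> + B" "B \<ge> 0"
    and F: "\<And>j r. F j r = c * (msign (e * j + (e + 1) * r) * qpow \<tau> (hecke_exponent N P i j r))"
  shows "bracket A A' F = c * hecke_sum N e P i \<tau> (\<lambda>j r. of_bool (A j r) - of_bool (A' j r))"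
proof -
  let ?T = "\<lambda>j r. msign (e * j + (e + 1) * r) * qpow \<tau> (hecke_exponent N P i j r)"
  have s: "(\<Sum>\<^sub>\<infinity>(j, r)\<in>{(j, r). D j r}. F j r) = c * hecke_sum N e P i \<tau> (\<lambda>j r. of_bool (D j r))" for D
  proof -
    have "(\<Sum>\<^sub>\<infinity>(j, r)\<in>{(j, r). D j r}. F j r) = c * (\<Sum>\<^sub>\<infinity>(j, r)\<in>{(j, r). D j r}. ?T j r)"
      unfolding F infsum_cmult_right' [symmetric] by (rule infsum_cong) auto
    also have "(\<Sum>\<^sub>\<infinity>(j, r)\<in>{(j, r). D j r}. ?T j r) = hecke_sum N e P i \<tau> (\<lambda>j r. of_bool (D j r))"
      unfolding hecke_sum_def by (rule infsum_cong_neutral) auto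
    finally show ?thesis .
  qed
  have "cone_weight (\<lambda>j r. of_bool (A j r) - of_bool (A' j r))" "cone_weight (\<lambda>j r. of_bool (A' j r))"
    unfolding cone_weight_def using B by (auto simp: of_bool_def intro!: exI [of _ B])
  from hecke_sum_add [OF assms(1,2) this]
  have "hecke_sum N e P i \<tau> (\<lambda>j r. of_bool (A j r)) = hecke_sum N e P i \<tau> (\<lambda>j r. of_bool (A j r) - of_bool (A' j r))
      + hecke_sum N e P i \<tau> (\<lambda>j r. of_bool (A' j r))"
    by simp
  then show ?thesis
    unfolding bracket_def s by (simp add: distrib_left)
qed

text \<open>A theta value times a finite sum is a Hecke sum over finitely many rows: the exponent
  separates, and each row summed over \<open>j\<close> is the theta series. Finitely many rows lie
  in a fattened cone, so the sums converge.\<close>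

lemma strip_eq_hecke_sum:
  assumes N: "N > 0" and \<tau>: "Im \<tau> > 0" and R: "finite R"
    and c: "\<And>j r. c1 j * c2 r = c * msign (e * j + (e + 1) * r)"
    and A: "A = (\<Sum>\<^sub>\<infinity>j. c1 j * qpow \<tau> ((of_int N + 1) / 2 * (of_int j + hecke_shift1 N P)\<^sup>2))"
    and B: "B = (\<Sum>r\<in>R. c2 r * qpow \<tau> (- (of_int N / 2 * (of_int r + hecke_shift2 N P i)\<^sup>2)))"
  shows "A * B = c * hecke_sum N e P i \<tau> (\<lambda>j r. of_bool (r \<in> R))"
proof -
  let ?T = "\<lambda>j r. msign (e * j + (e + 1) * r) * qpow \<tau> (hecke_exponent N P i j r)"
  define K where "K = Max (insert 0 (abs ` R))"
  have K: "K \<ge> 0" "\<bar>r\<bar> \<le> K" if "r \<in> R" for r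
    unfolding K_def using R that by (auto intro!: Max_ge)
  have K0: "K \<ge> 0" unfolding K_def using R by (auto intro!: Max_ge)
  have T: "c * ?T j r = c1 j * qpow \<tau> ((of_int N + 1) / 2 * (of_int j + hecke_shift1 N P)\<^sup>2)
      * (c2 r * qpow \<tau> (- (of_int N / 2 * (of_int r + hecke_shift2 N P i)\<^sup>2)))" for j r
  proof -
    have "hecke_exponent N P i j r = (of_int N + 1) / 2 * (of_int j + hecke_shift1 N P)\<^sup>2 + - (of_int N / 2 * (of_int r + hecke_shift2 N P i)\<^sup>2)"
      by (simp add: hecke_exponent_def hecke_form_def diff_divide_distrib)
    then have "c * ?T j r = (c * msign (e * j + (e + 1) * r)) * (qpow \<tau> ((of_int N + 1) / 2 * (of_int j + hecke_shift1 N P)\<^sup>2)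
        * qpow \<tau> (- (of_int N / 2 * (of_int r + hecke_shift2 N P i)\<^sup>2)))"
      by (simp only: qpow_add mult.assoc)
    then show ?thesis
      unfolding c [symmetric] by (simp only: mult_ac)
  qed
  have s: "(\<lambda>(j, r). ?T j r) summable_on UNIV \<times> R"
    by (rule summable_hecke_sum_on [OF N \<tau> K0]) (use K in \<open>force+\<close>)
  have "hecke_sum N e P i \<tau> (\<lambda>j r. of_bool (r \<in> R)) = (\<Sum>\<^sub>\<infinity>(j, r)\<in>UNIV \<times> R. ?T j r)"
    unfolding hecke_sum_def by (rule infsum_cong_neutral) auto
  also have "\<dots> = (\<Sum>\<^sub>\<infinity>j. \<Sum>r\<in>R. ?T j r)"
    using infsum_Sigma'_banach [OF s] R by simp
  finally have "c * hecke_sum N e P i \<tau> (\<lambda>j r. of_bool (r \<in> R)) = (\<Sum>\<^sub>\<infinity>j. \<Sum>r\<in>R. c * ?T j r)"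
    by (simp only: infsum_cmult_right' [symmetric] sum_distrib_left)
  also have "\<dots> = A * B"
    unfolding T A B sum_distrib_left [symmetric] by (rule infsum_cmult_left')
  finally show ?thesis ..
qed

definition wedge_weight1 :: "int \<Rightarrow> int \<Rightarrow> real" where
  "wedge_weight1 j r = of_bool (0 \<le> r \<and> r < j) - of_bool (j \<le> r \<and> r < 0)"

definition wedge_weight2 :: "int \<Rightarrow> int \<Rightarrow> int \<Rightarrow> real" where
  "wedge_weight2 P j r = of_bool (0 \<le> - r - P \<and> - r - P \<le> j) - of_bool (j < - r - P \<and> - r - P < 0)"

text \<open>An oriented row indicator. For \<open>P = 0\<close> it is minus the indicator of the row
  0; for positive \<open>P\<close> the subtracted set is empty.\<close>

definition strip_weight :: "int \<Rightarrow> int \<Rightarrow> int \<Rightarrow> real" where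
  "strip_weight P j r = of_bool (- P < r \<and> r < 0) - of_bool (0 \<le> r \<and> r \<le> - P)"

text \<open>The weight is [r < j] + [- r - P \<le> j] - 1, while the wedges are [r < j] - [r < 0]
  and [- r - P \<le> j] - [- r - P < 0]. The difference depends on \<open>r\<close> alone and is the
  strip.\<close>

lemma hecke_theta_decompose:
  assumes "N > 0" "Im \<tau> > 0" "P \<ge> 0"
  shows "hecke_theta N e P i \<tau> =
    hecke_sum N e P i \<tau> wedge_weight1 +
    hecke_sum N e P i \<tau> (wedge_weight2 P) +
    hecke_sum N e P i \<tau> (strip_weight P)"
    (is "_ = hecke_sum N e P i \<tau> ?W1 + hecke_sum N e P i \<tau> ?W2 + _")
proof -
  have c: "cone_weight ?W1" "cone_weight ?W2" "cone_weight (strip_weight P)"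
    unfolding cone_weight_def strip_weight_def wedge_weight1_def wedge_weight2_def using assms(3) by (auto simp: of_bool_def intro!: exI [of _ P])
  have c12: "cone_weight (\<lambda>j r. ?W1 j r + strip_weight P j r)"
    unfolding cone_weight_def strip_weight_def wedge_weight1_def wedge_weight2_def using assms(3) by (auto simp: of_bool_def intro!: exI [of _ P])
  have "hecke_theta N e P i \<tau> = hecke_sum N e P i \<tau> (hecke_weight P)"
    by (simp add: hecke_theta_def hecke_sum_def)
  also have "\<dots> = hecke_sum N e P i \<tau> (\<lambda>j r. ?W1 j r + strip_weight P j r) + hecke_sum N e P i \<tau> ?W2"
    by (rule hecke_sum_add [OF assms(1,2) c12 c(2)])
       (use assms(3) in \<open>auto simp: hecke_weight_def bool_sgn_def strip_weight_def wedge_weight1_def wedge_weight2_def of_bool_def\<close>)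
  also have "hecke_sum N e P i \<tau> (\<lambda>j r. ?W1 j r + strip_weight P j r) = hecke_sum N e P i \<tau> ?W1 + hecke_sum N e P i \<tau> (strip_weight P)"
    by (rule hecke_sum_add [OF assms(1,2) c(1,3)]) simp
  finally show ?thesis by simp
qed

text \<open>For \<open>2i + 1 = N\<close> the coset is invariant under \<open>y \<mapsto> -y\<close>.\<close>
lemma hecke_sum_reflect:
  assumes "N > 0" "2 * i + 1 = N" "even ((e + 1) * (P + 1))"
  shows "hecke_sum N e P i \<tau> W = hecke_sum N e P i \<tau> (\<lambda>j r. W j (- r - P - 1))"
  unfolding hecke_sum_def
proof (rule infsum_reindex_bij_witness [of _ "\<lambda>(j, r). (j, - r - P - 1)" "\<lambda>(j, r). (j, - r - P - 1)"])
  fix p :: "int \<times> int"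
  obtain j r where p: "p = (j, r)" by (cases p)
  have s: "hecke_shift2 N P i = (of_int P + 1) / 2"
  proof -
    have "N * P + 2 * i + 1 = N * (P + 1)" using assms(2) by (simp add: algebra_simps)
    then show ?thesis
      unfolding hecke_shift2_def using assms(1) by (simp only: of_int_mult) simp
  qed
  have "of_int (- r - P - 1) + hecke_shift2 N P i = - (of_int r + hecke_shift2 N P i)"
    unfolding s by (simp add: field_simps)
  then have ex: "hecke_exponent N P i j (- r - P - 1) = hecke_exponent N P i j r"
    unfolding hecke_exponent_def hecke_form_def by (simp only: power2_minus)
  have "msign (e * j + (e + 1) * (- r - P - 1)) = msign (e * j + (e + 1) * r)"
    using assms(3) by (auto simp: msign_def)
  then show "(case case p of (j, r) \<Rightarrow> (j, - r - P - 1) of (j, r) \<Rightarrow>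
        msign (e * j + (e + 1) * r) * of_real (W j (- r - P - 1)) * qpow \<tau> (hecke_exponent N P i j r)) =
      (case p of (j, r) \<Rightarrow> msign (e * j + (e + 1) * r) * of_real (W j r) * qpow \<tau> (hecke_exponent N P i j r))"
    unfolding p prod.case ex by simp
qed auto

text \<open>For \<open>2 * i + 1 = N\<close> the second wedge can be chosen as the mirror image of
  the first under \<open>r \<mapsto> - r - P - 1\<close>, with the same sum. This accounts for the
  single bracket at k = m and for the normalization by 2.\<close>

lemma hecke_theta_decompose_boundary:
  assumes "N > 0" "Im \<tau> > 0" "P \<ge> 0" "2 * i + 1 = N" "even ((e + 1) * (P + 1))"
  shows "hecke_theta N e P i \<tau> =
    2 * hecke_sum N e P i \<tau> wedge_weight1 +
    hecke_sum N e P i \<tau> (\<lambda>j r. of_bool (- P \<le> r \<and> r \<le> - 1))"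
    (is "_ = 2 * hecke_sum N e P i \<tau> ?W1 + hecke_sum N e P i \<tau> ?W2")
proof -
  let ?W1' = "\<lambda>j r. ?W1 j (- r - P - 1)"
  have c: "cone_weight ?W1" "cone_weight ?W1'" "cone_weight ?W2" "cone_weight (\<lambda>j r. ?W1 j r + ?W2 j r)"
    unfolding cone_weight_def wedge_weight1_def using assms(3) by (auto simp: of_bool_def intro!: exI [of _ "P + 1"])
  have "hecke_theta N e P i \<tau> = hecke_sum N e P i \<tau> (hecke_weight P)"
    by (simp add: hecke_theta_def hecke_sum_def)
  also have "\<dots> = hecke_sum N e P i \<tau> (\<lambda>j r. ?W1 j r + ?W2 j r) + hecke_sum N e P i \<tau> ?W1'"
    by (rule hecke_sum_add [OF assms(1,2) c(4,2)])
       (use assms(3) in \<open>auto simp: hecke_weight_def bool_sgn_def wedge_weight1_def of_bool_def\<close>)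
  also have "hecke_sum N e P i \<tau> (\<lambda>j r. ?W1 j r + ?W2 j r) = hecke_sum N e P i \<tau> ?W1 + hecke_sum N e P i \<tau> ?W2"
    by (rule hecke_sum_add [OF assms(1,2) c(1,3)]) simp
  also have "hecke_sum N e P i \<tau> ?W1' = hecke_sum N e P i \<tau> ?W1"
    by (rule hecke_sum_reflect [OF assms(1,4,5), symmetric])
  finally show ?thesis by simp
qed

section \<open>The functions of the paper as Hecke sums\<close>

lemma galpha_eq: "N > 0 \<Longrightarrow> galpha (of_int N / 2) p = hecke_shift1 N (2 * p + 1)"
  by (simp add: galpha_def hecke_shift1_def field_simps)

lemma gbeta_eq: "N > 0 \<Longrightarrow> gbeta (of_int N / 2) p = hecke_shift1 N (2 * p)"
  by (simp add: gbeta_def hecke_shift1_def field_simps)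

lemma theta_sgn_eq:
  assumes "N > 0"
  shows "theta_sgn \<epsilon> (of_int P * (of_int N / 2)) (of_int N / 2 + 1 / 2) \<tau> 0 =
    (\<Sum>\<^sub>\<infinity>j. \<epsilon> powi j * qpow \<tau> ((of_int N + 1) / 2 * (of_int j + hecke_shift1 N P)\<^sup>2))"
proof -
  have "of_int P * (of_int N / 2) / (2 * (of_int N / 2 + 1 / 2)) = hecke_shift1 N P"
    using assms by (simp add: hecke_shift1_def field_simps)
  then show ?thesis
    unfolding theta_sgn_def by (simp add: add_divide_distrib)
qed

lemma hecke_exponent_odd_eq:
  assumes "N > 0"
  shows "hecke_exponent N (2 * p + 1) i j r =
    (of_int N / 2 + 1 / 2) * (of_int j + hecke_shift1 N (2 * p + 1))\<^sup>2 - of_int N / 2 * (of_int r + of_int p + 1 / 2 + of_int (2 * i + 1) / (2 * of_int N))\<^sup>2"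
proof -
  have "of_int r + hecke_shift2 N (2 * p + 1) i = of_int r + of_int p + 1 / 2 + of_int (2 * i + 1) / (2 * of_int N)"
    using assms by (simp add: hecke_shift2_def field_simps)
  then show ?thesis
    unfolding hecke_exponent_def hecke_form_def by (simp only: diff_divide_distrib) (simp add: add_divide_distrib)
qed

lemma hecke_exponent_even_eq:
  assumes "N > 0"
  shows "hecke_exponent N (2 * p) i j r =
    (of_int N / 2 + 1 / 2) * (of_int j + hecke_shift1 N (2 * p))\<^sup>2 - of_int N / 2 * (of_int r + of_int p + of_int (2 * i + 1) / (2 * of_int N))\<^sup>2"
proof -
  have "of_int r + hecke_shift2 N (2 * p) i = of_int r + of_int p + of_int (2 * i + 1) / (2 * of_int N)"
    using assms by (simp add: hecke_shift2_def field_simps)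
  then show ?thesis
    unfolding hecke_exponent_def hecke_form_def by (simp only: diff_divide_distrib) (simp add: add_divide_distrib)
qed

lemma frac_shifts:
  assumes "N > 0"
  shows "(of_int N / 2 + real_of_int (2 * i + 1) / 2) / (2 * (of_int N / 2)) = 1 / 2 + of_int (2 * i + 1) / (2 * of_int N)"
    and "(of_int N / 2 - real_of_int (2 * i + 1) / 2) / (2 * (of_int N / 2)) = 1 / 2 - of_int (2 * i + 1) / (2 * of_int N)"
    and "(real_of_int (2 * i + 1) / 2 - of_int N / 2) / (2 * (of_int N / 2)) = of_int (2 * i + 1) / (2 * of_int N) - 1 / 2"
    and "(real_of_int (2 * i + 1) / 2) / (2 * (of_int N / 2)) = of_int (2 * i + 1) / (2 * of_int N)"
  using assms by (simp_all add: field_simps)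

lemma bracket_wedge1:
  assumes "N > 0" "Im \<tau> > 0"
    and "\<And>j r. F j r = c * (msign (e * j + (e + 1) * r) * qpow \<tau> (hecke_exponent N P i j r))"
  shows "bracket (\<lambda>j r. 0 \<le> r \<and> r < j) (\<lambda>j r. j \<le> r \<and> r < 0) F = c * hecke_sum N e P i \<tau> wedge_weight1"
  unfolding wedge_weight1_def [abs_def]
  by (rule bracket_eq_hecke_sum [OF assms(1,2), of _ _ 0]) (use assms(3) in auto)

lemma bracket_wedge2:
  assumes "N > 0" "Im \<tau> > 0" "P \<ge> 0"
    and "\<And>j r. F j (- r - P) = c * (msign (e * j + (e + 1) * r) * qpow \<tau> (hecke_exponent N P i j r))"
  shows "bracket (\<lambda>j r. 0 \<le> r \<and> r \<le> j) (\<lambda>j r. j < r \<and> r < 0) F = c * hecke_sum N e P i \<tau> (wedge_weight2 P)"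
  unfolding wedge_weight2_def [abs_def]
  by (rule trans [OF bracket_reindex [of "\<lambda>r. - r - P" "\<lambda>r. - r - P"] bracket_eq_hecke_sum [OF assms(1,2) _ assms(3)]])
     (use assms(3,4) in auto)

lemma bracket_wedge_boundary:
  assumes "N > 0" "Im \<tau> > 0"
    and "\<And>j r. F j (r + 1) = c * (msign (e * j + (e + 1) * r) * qpow \<tau> (hecke_exponent N P i j r))"
  shows "bracket (\<lambda>j r. 0 < r \<and> r \<le> j) (\<lambda>j r. j < r \<and> r \<le> 0) F = c * hecke_sum N e P i \<tau> wedge_weight1"
proof -
  \<comment> \<open>The boundary bracket is the first wedge moved up by one row.\<close>
  have W: "wedge_weight1 = (\<lambda>j r. of_bool (0 < r + 1 \<and> r + 1 \<le> j) - of_bool (j < r + 1 \<and> r + 1 \<le> 0))"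
    by (auto simp: wedge_weight1_def fun_eq_iff of_bool_def)
  show ?thesis
    unfolding W
    by (rule trans [OF bracket_reindex [of "\<lambda>r. r + 1" "\<lambda>r. r - 1"] bracket_eq_hecke_sum [OF assms(1,2), of _ _ 1]])
       (use assms(3) in auto)
qed

lemma square_reflect: "(y :: real)\<^sup>2 = z\<^sup>2" if "y = - z"
  using that by simp

text \<open>The two brackets are the wedges, the second after reflection, and the theta correction
  is the strip of the decomposition. At k = m the factor 1/2 before the theta term is the reciprocal
  of \<open>cfac\<close>.\<close>

lemma g1_eq_hecke_theta:
  assumes N: "N > 0" and \<tau>: "Im \<tau> > 0" and p: "p \<ge> 0" and i: "0 \<le> i" "2 * i + 1 \<le> N"
  shows "g1 (of_int N / 2) p (of_int (2 * i + 1) / 2) \<tau> =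
    cis (pi * (of_int (2 * i + 1) / 2)) / of_real (cfac (of_int N / 2) (of_int (2 * i + 1) / 2)) * hecke_theta N 1 (2 * p + 1) i \<tau>"
proof -
  define P where "P = 2 * p + 1"
  have P: "P \<ge> 0" using p by (simp add: P_def)
  define c where "c = exp (of_real pi * \<i> * of_real (real_of_int (2 * i + 1) / 2))"
  have c: "c = cis (pi * (of_int (2 * i + 1) / 2))"
    by (simp add: c_def cis_conv_exp mult_ac)
  define a where "a = hecke_shift1 N P"
  define \<kappa> where "\<kappa> = real_of_int (2 * i + 1) / (2 * of_int N)"
  have E: "hecke_exponent N P i j r = (of_int N / 2 + 1 / 2) * (of_int j + a)\<^sup>2 - of_int N / 2 * (of_int r + of_int p + 1 / 2 + \<kappa>)\<^sup>2" for j r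
    unfolding P_def hecke_exponent_odd_eq [OF N] a_def \<kappa>_def ..
  have sh: "of_int r + hecke_shift2 N P i = of_int r + of_int p + 1 / 2 + \<kappa>" for r
    unfolding \<kappa>_def P_def using N by (simp add: hecke_shift2_def field_simps)
  have sgn: "msign (1 * j + (1 + 1) * r) = msign j" for j r by (simp add: msign_def)
  define \<Theta> where "\<Theta> = theta_minus (of_int P * (of_int N / 2)) (of_int N / 2 + 1 / 2) \<tau> 0"
  have \<Theta>: "\<Theta> = (\<Sum>\<^sub>\<infinity>j. msign j * qpow \<tau> ((of_int N + 1) / 2 * (of_int j + hecke_shift1 N P)\<^sup>2))"
    unfolding \<Theta>_def theta_sgn_eq [OF N] powi_minus_one ..
  have strip: "\<Theta> * (\<Sum>r\<in>R. c * qpow \<tau> (- (of_int N / 2 * (of_int r + of_int p + 1 / 2 + \<kappa>)\<^sup>2))) =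
      c * hecke_sum N 1 P i \<tau> (\<lambda>j r. of_bool (r \<in> R))" if "finite R" for R
  proof (rule strip_eq_hecke_sum [OF N \<tau> that, of msign "\<lambda>_. c"])
    show "msign j * c = c * msign (1 * j + (1 + 1) * r)" for j r
      unfolding sgn by (rule mult.commute)
  qed (simp_all only: \<Theta> sh)
  show ?thesis
  proof (cases "2 * i + 1 = N")
    case False
    then have lt: "real_of_int (2 * i + 1) / 2 < of_int N / 2" using i by simp
    have b1: "bracket (\<lambda>j r. 0 \<le> r \<and> r < j) (\<lambda>j r. j \<le> r \<and> r < 0)
         (\<lambda>j r. msign j * c * qpow \<tau> ((of_int N / 2 + 1 / 2) * (of_int j + a)\<^sup>2 - of_int N / 2 * (of_int r + of_int p + (1 / 2 + \<kappa>))\<^sup>2)) =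
        c * hecke_sum N 1 P i \<tau> wedge_weight1"
      by (rule bracket_wedge1 [OF N \<tau>]) (unfold E sgn add.assoc, simp only: mult_ac)
    have b2: "bracket (\<lambda>j r. 0 \<le> r \<and> r \<le> j) (\<lambda>j r. j < r \<and> r < 0)
         (\<lambda>j r. msign j * c * qpow \<tau> ((of_int N / 2 + 1 / 2) * (of_int j + a)\<^sup>2 - of_int N / 2 * (of_int r + of_int p + (1 / 2 - \<kappa>))\<^sup>2)) =
        c * hecke_sum N 1 P i \<tau> (wedge_weight2 P)"
    proof (rule bracket_wedge2 [OF N \<tau> P])
      fix j r
      have "(of_int (- r - P) + of_int p + (1 / 2 - \<kappa>))\<^sup>2 = (of_int r + of_int p + 1 / 2 + \<kappa>)\<^sup>2"
        by (rule square_reflect) (simp add: P_def)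
      then show "msign j * c * qpow \<tau> ((of_int N / 2 + 1 / 2) * (of_int j + a)\<^sup>2 - of_int N / 2 * (of_int (- r - P) + of_int p + (1 / 2 - \<kappa>))\<^sup>2) =
          c * (msign (1 * j + (1 + 1) * r) * qpow \<tau> (hecke_exponent N P i j r))"
        unfolding E sgn by (simp only: mult_ac)
    qed
    \<comment> \<open>Translating the rows \<open>- P < r < 0\<close> by \<open>p + 1\<close> yields
      \<open>- p < r \<le> p\<close> and turns the shift \<open>p + 1/2 + \<kappa>\<close> into
      \<open>\<kappa> - 1/2\<close>.\<close>
    have b3: "(\<Sum>r\<in>{-p<..p}. c * qpow \<tau> (- (of_int N / 2) * (of_int r + (\<kappa> - 1 / 2))\<^sup>2)) =
        (\<Sum>r\<in>{-P<..<0}. c * qpow \<tau> (- (of_int N / 2 * (of_int r + of_int p + 1 / 2 + \<kappa>)\<^sup>2)))"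
      by (rule sum.reindex_bij_witness [of _ "\<lambda>r. r + p + 1" "\<lambda>r. r - p - 1"]) (auto simp: P_def algebra_simps)
    have "strip_weight P = (\<lambda>j r. of_bool (r \<in> {-P<..<0}))"
      using p by (auto simp: strip_weight_def P_def fun_eq_iff)
    then have "c * hecke_theta N 1 P i \<tau> =
        c * hecke_sum N 1 P i \<tau> wedge_weight1 + c * hecke_sum N 1 P i \<tau> (wedge_weight2 P)
        + \<Theta> * (\<Sum>r\<in>{-p<..p}. c * qpow \<tau> (- (of_int N / 2) * (of_int r + (\<kappa> - 1 / 2))\<^sup>2))"
      unfolding hecke_theta_decompose [OF N \<tau> P] b3 strip [OF finite_greaterThanLessThan_int] by (simp add: distrib_left)
    also have "\<dots> = g1 (of_int N / 2) p (of_int (2 * i + 1) / 2) \<tau>"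
      unfolding g1_def if_P [OF lt] powi_minus_one frac_shifts [OF N] galpha_eq [OF N] P_def [symmetric] a_def [symmetric]
        c_def [symmetric] \<kappa>_def [symmetric] b1 b2 by (simp add: \<Theta>_def P_def)
    finally show ?thesis
      using lt by (simp add: c cfac_def P_def)
  next
    case True
    then have nlt: "\<not> real_of_int (2 * i + 1) / 2 < of_int N / 2" by simp
    have \<kappa>: "\<kappa> = 1 / 2" using N by (simp add: \<kappa>_def True)
    have b1: "bracket (\<lambda>j r. 0 < r \<and> r \<le> j) (\<lambda>j r. j < r \<and> r \<le> 0)
         (\<lambda>j r. msign j * c * qpow \<tau> ((of_int N / 2 + 1 / 2) * (of_int j + a)\<^sup>2 - of_int N / 2 * (of_int r + of_int p)\<^sup>2)) =
        c * hecke_sum N 1 P i \<tau> wedge_weight1"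
    proof (rule bracket_wedge_boundary [OF N \<tau>])
      fix j r :: int
      have "of_int (r + 1) + of_int p = of_int r + of_int p + 1 / 2 + \<kappa>" by (simp add: \<kappa>)
      then show "msign j * c * qpow \<tau> ((of_int N / 2 + 1 / 2) * (of_int j + a)\<^sup>2 - of_int N / 2 * (of_int (r + 1) + of_int p)\<^sup>2) =
          c * (msign (1 * j + (1 + 1) * r) * qpow \<tau> (hecke_exponent N P i j r))"
        unfolding E sgn by (simp only: mult_ac)
    qed
    have b3: "c * (\<Sum>r\<in>{-p..p}. qpow \<tau> (- (of_int N / 2) * (of_int r)\<^sup>2)) =
        (\<Sum>r\<in>{-P..-1}. c * qpow \<tau> (- (of_int N / 2 * (of_int r + of_int p + 1 / 2 + \<kappa>)\<^sup>2)))"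
      unfolding sum_distrib_left
      by (rule sum.reindex_bij_witness [of _ "\<lambda>r. r + p + 1" "\<lambda>r. r - p - 1"]) (auto simp: P_def \<kappa> algebra_simps)
    have "c / 2 * hecke_theta N 1 P i \<tau> = c * hecke_sum N 1 P i \<tau> wedge_weight1
        + 1 / 2 * (\<Theta> * (c * (\<Sum>r\<in>{-p..p}. qpow \<tau> (- (of_int N / 2) * (of_int r)\<^sup>2))))"
      unfolding b3 strip [OF finite_atLeastAtMost_int]
      by (subst hecke_theta_decompose_boundary [OF N \<tau> P True]) (simp_all add: distrib_left)
    also have "\<dots> = g1 (of_int N / 2) p (of_int (2 * i + 1) / 2) \<tau>"
    proof -
      have c': "exp (of_real pi * \<i> * of_real (real_of_int N / 2)) = c" by (simp add: c_def True)
      show ?thesis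
        unfolding g1_def if_not_P [OF nlt] powi_minus_one galpha_eq [OF N] P_def [symmetric] a_def [symmetric] c' b1
        by (simp add: \<Theta>_def P_def mult_ac)
    qed
    finally show ?thesis
      using nlt by (simp add: c cfac_def P_def)
  qed
qed

text \<open>Now the character is (-1)^r. It changes sign under \<open>r \<mapsto> - r - P\<close>,
  as \<open>P\<close> is odd, and acquires \<open>- msign p\<close> under the translation by
  \<open>p + 1\<close>; this explains the minus signs in the definition of
  \<open>g2\<close>.\<close>

lemma g2_eq_hecke_theta:
  assumes N: "N > 0" and \<tau>: "Im \<tau> > 0" and p: "p \<ge> 0" and i: "0 \<le> i" "2 * i + 1 \<le> N"
  shows "g2 (of_int N / 2) p (of_int (2 * i + 1) / 2) \<tau> =
    msign p / of_real (cfac (of_int N / 2) (of_int (2 * i + 1) / 2)) * hecke_theta N 0 (2 * p + 1) i \<tau>"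
proof -
  define P where "P = 2 * p + 1"
  have P: "P \<ge> 0" using p by (simp add: P_def)
  define a where "a = hecke_shift1 N P"
  define \<kappa> where "\<kappa> = real_of_int (2 * i + 1) / (2 * of_int N)"
  have E: "hecke_exponent N P i j r = (of_int N / 2 + 1 / 2) * (of_int j + a)\<^sup>2 - of_int N / 2 * (of_int r + of_int p + 1 / 2 + \<kappa>)\<^sup>2" for j r
    unfolding P_def hecke_exponent_odd_eq [OF N] a_def \<kappa>_def ..
  have sh: "of_int r + hecke_shift2 N P i = of_int r + of_int p + 1 / 2 + \<kappa>" for r
    unfolding \<kappa>_def P_def using N by (simp add: hecke_shift2_def field_simps)
  have sgn: "msign (0 * j + (0 + 1) * r) = msign r" for j r by simp
  define \<Theta> where "\<Theta> = theta (of_int P * (of_int N / 2)) (of_int N / 2 + 1 / 2) \<tau> 0"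
  have \<Theta>: "\<Theta> = (\<Sum>\<^sub>\<infinity>j. 1 * qpow \<tau> ((of_int N + 1) / 2 * (of_int j + hecke_shift1 N P)\<^sup>2))"
    unfolding \<Theta>_def theta_sgn_eq [OF N] power_int_1_left ..
  have strip: "\<Theta> * (\<Sum>r\<in>R. (- msign p * msign r) * qpow \<tau> (- (of_int N / 2 * (of_int r + of_int p + 1 / 2 + \<kappa>)\<^sup>2))) =
      - msign p * hecke_sum N 0 P i \<tau> (\<lambda>j r. of_bool (r \<in> R))" if "finite R" for R
  proof (rule strip_eq_hecke_sum [OF N \<tau> that, of "\<lambda>_. 1" "\<lambda>r. - msign p * msign r"])
    show "1 * (- msign p * msign r) = - msign p * msign (0 * j + (0 + 1) * r)" for j r
      unfolding sgn by simp
  qed (simp_all only: \<Theta> sh)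
  have sgn_shift: "msign (r + p + 1) = - msign p * msign r" for r
    by (simp add: msign_def)
  show ?thesis
  proof (cases "2 * i + 1 = N")
    case False
    then have lt: "real_of_int (2 * i + 1) / 2 < of_int N / 2" using i by simp
    have b1: "bracket (\<lambda>j r. 0 \<le> r \<and> r < j) (\<lambda>j r. j \<le> r \<and> r < 0)
         (\<lambda>j r. msign r * qpow \<tau> ((of_int N / 2 + 1 / 2) * (of_int j + a)\<^sup>2 - of_int N / 2 * (of_int r + of_int p + (1 / 2 + \<kappa>))\<^sup>2)) =
        1 * hecke_sum N 0 P i \<tau> wedge_weight1"
      by (rule bracket_wedge1 [OF N \<tau>]) (simp only: E sgn add.assoc mult_1)
    have b2: "bracket (\<lambda>j r. 0 \<le> r \<and> r \<le> j) (\<lambda>j r. j < r \<and> r < 0)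
         (\<lambda>j r. msign r * qpow \<tau> ((of_int N / 2 + 1 / 2) * (of_int j + a)\<^sup>2 - of_int N / 2 * (of_int r + of_int p + (1 / 2 - \<kappa>))\<^sup>2)) =
        - 1 * hecke_sum N 0 P i \<tau> (wedge_weight2 P)"
    proof (rule bracket_wedge2 [OF N \<tau> P])
      fix j r
      have "(of_int (- r - P) + of_int p + (1 / 2 - \<kappa>))\<^sup>2 = (of_int r + of_int p + 1 / 2 + \<kappa>)\<^sup>2"
        by (rule square_reflect) (simp add: P_def)
      moreover have "msign (- r - P) = - msign r" by (simp add: msign_def P_def)
      ultimately show "msign (- r - P) * qpow \<tau> ((of_int N / 2 + 1 / 2) * (of_int j + a)\<^sup>2 - of_int N / 2 * (of_int (- r - P) + of_int p + (1 / 2 - \<kappa>))\<^sup>2) =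
          - 1 * (msign (0 * j + (0 + 1) * r) * qpow \<tau> (hecke_exponent N P i j r))"
        unfolding E sgn by simp
    qed
    have b3: "(\<Sum>r\<in>{-p<..p}. msign r * qpow \<tau> (- (of_int N / 2) * (of_int r + (\<kappa> - 1 / 2))\<^sup>2)) =
        (\<Sum>r\<in>{-P<..<0}. (- msign p * msign r) * qpow \<tau> (- (of_int N / 2 * (of_int r + of_int p + 1 / 2 + \<kappa>)\<^sup>2)))"
      unfolding sgn_shift [symmetric]
      by (rule sum.reindex_bij_witness [of _ "\<lambda>r. r + p + 1" "\<lambda>r. r - p - 1"]) (auto simp: P_def algebra_simps)
    have "strip_weight P = (\<lambda>j r. of_bool (r \<in> {-P<..<0}))"
      using p by (auto simp: strip_weight_def P_def fun_eq_iff)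
    then have "msign p * hecke_theta N 0 P i \<tau> =
        msign p * hecke_sum N 0 P i \<tau> wedge_weight1 - msign p * (- 1 * hecke_sum N 0 P i \<tau> (wedge_weight2 P))
        - \<Theta> * (\<Sum>r\<in>{-p<..p}. msign r * qpow \<tau> (- (of_int N / 2) * (of_int r + (\<kappa> - 1 / 2))\<^sup>2))"
      unfolding hecke_theta_decompose [OF N \<tau> P] b3 strip [OF finite_greaterThanLessThan_int] by (simp add: distrib_left)
    also have "\<dots> = g2 (of_int N / 2) p (of_int (2 * i + 1) / 2) \<tau>"
      unfolding g2_def if_P [OF lt] powi_minus_one frac_shifts [OF N] galpha_eq [OF N] P_def [symmetric] a_def [symmetric]
        \<kappa>_def [symmetric] b1 b2 by (simp add: \<Theta>_def P_def)
    finally show ?thesis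
      using lt by (simp add: cfac_def P_def)
  next
    case True
    then have nlt: "\<not> real_of_int (2 * i + 1) / 2 < of_int N / 2" by simp
    have \<kappa>: "\<kappa> = 1 / 2" using N by (simp add: \<kappa>_def True)
    have b1: "bracket (\<lambda>j r. 0 < r \<and> r \<le> j) (\<lambda>j r. j < r \<and> r \<le> 0)
         (\<lambda>j r. msign r * qpow \<tau> ((of_int N / 2 + 1 / 2) * (of_int j + a)\<^sup>2 - of_int N / 2 * (of_int r + of_int p)\<^sup>2)) =
        - 1 * hecke_sum N 0 P i \<tau> wedge_weight1"
    proof (rule bracket_wedge_boundary [OF N \<tau>])
      fix j r :: int
      have "of_int (r + 1) + of_int p = of_int r + of_int p + 1 / 2 + \<kappa>" by (simp add: \<kappa>)
      moreover have "msign (r + 1) = - msign r" by (simp add: msign_def)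
      ultimately show "msign (r + 1) * qpow \<tau> ((of_int N / 2 + 1 / 2) * (of_int j + a)\<^sup>2 - of_int N / 2 * (of_int (r + 1) + of_int p)\<^sup>2) =
          - 1 * (msign (0 * j + (0 + 1) * r) * qpow \<tau> (hecke_exponent N P i j r))"
        unfolding E sgn by (simp only:) simp
    qed
    have b3: "(\<Sum>r\<in>{-p..p}. msign r * qpow \<tau> (- (of_int N / 2) * (of_int r)\<^sup>2)) =
        (\<Sum>r\<in>{-P..-1}. (- msign p * msign r) * qpow \<tau> (- (of_int N / 2 * (of_int r + of_int p + 1 / 2 + \<kappa>)\<^sup>2)))"
      unfolding sgn_shift [symmetric]
      by (rule sum.reindex_bij_witness [of _ "\<lambda>r. r + p + 1" "\<lambda>r. r - p - 1"]) (auto simp: P_def \<kappa> algebra_simps)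
    have "msign p / 2 * hecke_theta N 0 P i \<tau> = - msign p * (- 1 * hecke_sum N 0 P i \<tau> wedge_weight1)
        - 1 / 2 * (\<Theta> * (\<Sum>r\<in>{-p..p}. msign r * qpow \<tau> (- (of_int N / 2) * (of_int r)\<^sup>2)))"
      unfolding b3 strip [OF finite_atLeastAtMost_int]
      by (subst hecke_theta_decompose_boundary [OF N \<tau> P True]) (simp_all add: distrib_left P_def)
    also have "\<dots> = g2 (of_int N / 2) p (of_int (2 * i + 1) / 2) \<tau>"
      unfolding g2_def if_not_P [OF nlt] powi_minus_one galpha_eq [OF N] P_def [symmetric] a_def [symmetric] b1
      by (simp add: \<Theta>_def P_def mult_ac)
    finally show ?thesis
      using nlt by (simp add: cfac_def P_def)
  qed
qed

text \<open>Even \<open>P\<close> allows \<open>P = 0\<close>, where the strip degenerates to a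
  negatively counted row. The identity thus depends on the oriented reading of the last sum in
  \<open>g3\<close>.\<close>

lemma g3_eq_hecke_theta:
  assumes N: "N > 0" and \<tau>: "Im \<tau> > 0" and p: "p \<ge> 0" and i: "0 \<le> i" "2 * i + 1 \<le> N"
  shows "g3 (of_int N / 2) p (of_int (2 * i + 1) / 2) \<tau> =
    cis (pi * (of_int (2 * i + 1) / 2)) / of_real (cfac (of_int N / 2) (of_int (2 * i + 1) / 2)) * hecke_theta N 1 (2 * p) i \<tau>"
proof -
  define P where "P = 2 * p"
  have P: "P \<ge> 0" using p by (simp add: P_def)
  define c where "c = exp (of_real pi * \<i> * of_real (real_of_int (2 * i + 1) / 2))"
  have c: "c = cis (pi * (of_int (2 * i + 1) / 2))"
    by (simp add: c_def cis_conv_exp mult_ac)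
  define a where "a = hecke_shift1 N P"
  define \<kappa> where "\<kappa> = real_of_int (2 * i + 1) / (2 * of_int N)"
  have E: "hecke_exponent N P i j r = (of_int N / 2 + 1 / 2) * (of_int j + a)\<^sup>2 - of_int N / 2 * (of_int r + of_int p + \<kappa>)\<^sup>2" for j r
    unfolding P_def hecke_exponent_even_eq [OF N] a_def \<kappa>_def ..
  have sh: "of_int r + hecke_shift2 N P i = of_int r + of_int p + \<kappa>" for r
    unfolding \<kappa>_def P_def using N by (simp add: hecke_shift2_def field_simps)
  have sgn: "msign (1 * j + (1 + 1) * r) = msign j" for j r by (simp add: msign_def)
  define \<Theta> where "\<Theta> = theta_minus (of_int P * (of_int N / 2)) (of_int N / 2 + 1 / 2) \<tau> 0"
  have \<Theta>: "\<Theta> = (\<Sum>\<^sub>\<infinity>j. msign j * qpow \<tau> ((of_int N + 1) / 2 * (of_int j + hecke_shift1 N P)\<^sup>2))"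
    unfolding \<Theta>_def theta_sgn_eq [OF N] powi_minus_one ..
  have strip: "\<Theta> * (\<Sum>r\<in>R. c * qpow \<tau> (- (of_int N / 2 * (of_int r + of_int p + \<kappa>)\<^sup>2))) =
      c * hecke_sum N 1 P i \<tau> (\<lambda>j r. of_bool (r \<in> R))" if "finite R" for R
  proof (rule strip_eq_hecke_sum [OF N \<tau> that, of msign "\<lambda>_. c"])
    show "msign j * c = c * msign (1 * j + (1 + 1) * r)" for j r
      unfolding sgn by (rule mult.commute)
  qed (simp_all only: \<Theta> sh)
  show ?thesis
  proof (cases "2 * i + 1 = N")
    case False
    then have lt: "real_of_int (2 * i + 1) / 2 < of_int N / 2" using i by simp
    have b1: "bracket (\<lambda>j r. 0 \<le> r \<and> r < j) (\<lambda>j r. j \<le> r \<and> r < 0)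
         (\<lambda>j r. msign j * c * qpow \<tau> ((of_int N / 2 + 1 / 2) * (of_int j + a)\<^sup>2 - of_int N / 2 * (of_int r + of_int p + \<kappa>)\<^sup>2)) =
        c * hecke_sum N 1 P i \<tau> wedge_weight1"
      by (rule bracket_wedge1 [OF N \<tau>]) (unfold E sgn, simp only: mult_ac)
    have b2: "bracket (\<lambda>j r. 0 \<le> r \<and> r \<le> j) (\<lambda>j r. j < r \<and> r < 0)
         (\<lambda>j r. msign j * c * qpow \<tau> ((of_int N / 2 + 1 / 2) * (of_int j + a)\<^sup>2 - of_int N / 2 * (of_int r + of_int p - \<kappa>)\<^sup>2)) =
        c * hecke_sum N 1 P i \<tau> (wedge_weight2 P)"
    proof (rule bracket_wedge2 [OF N \<tau> P])
      fix j r
      have "(of_int (- r - P) + of_int p - \<kappa>)\<^sup>2 = (of_int r + of_int p + \<kappa>)\<^sup>2"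
        by (rule square_reflect) (simp add: P_def)
      then show "msign j * c * qpow \<tau> ((of_int N / 2 + 1 / 2) * (of_int j + a)\<^sup>2 - of_int N / 2 * (of_int (- r - P) + of_int p - \<kappa>)\<^sup>2) =
          c * (msign (1 * j + (1 + 1) * r) * qpow \<tau> (hecke_exponent N P i j r))"
        unfolding E sgn by (simp only: mult_ac)
    qed
    have sq: "(2 * (of_int N / 2) * of_int r + real_of_int (2 * i + 1) / 2)\<^sup>2 / (4 * (of_int N / 2)) = of_int N / 2 * (of_int r + \<kappa>)\<^sup>2" for r
    proof -
      have "(2 * (n / 2) * x + k / 2)\<^sup>2 / (4 * (n / 2)) = n / 2 * (x + k / (2 * n))\<^sup>2" if "n > 0" for n x k :: real
        using that by (simp add: power2_eq_square field_simps)
      from this [of "of_int N"] N show ?thesis by (simp add: \<kappa>_def)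
    qed
    have b3: "(\<Sum>r\<in>{-p<..<p}. c * qpow \<tau> (- (of_int N / 2 * (of_int r + \<kappa>)\<^sup>2))) =
        (\<Sum>r\<in>{-P<..<0}. c * qpow \<tau> (- (of_int N / 2 * (of_int r + of_int p + \<kappa>)\<^sup>2)))"
      by (rule sum.reindex_bij_witness [of _ "\<lambda>r. r + p" "\<lambda>r. r - p"]) (auto simp: P_def)
    \<comment> \<open>These rows are present only for \<open>p = 0\<close>; they are the negative
      part of the oriented strip.\<close>
    have b4: "(\<Sum>r\<in>{p..-p}. c * qpow \<tau> (- (of_int N / 2 * (of_int r + \<kappa>)\<^sup>2))) =
        (\<Sum>r\<in>{0..-P}. c * qpow \<tau> (- (of_int N / 2 * (of_int r + of_int p + \<kappa>)\<^sup>2)))"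
      by (rule sum.reindex_bij_witness [of _ "\<lambda>r. r + p" "\<lambda>r. r - p"]) (auto simp: P_def)
    have "cone_weight (strip_weight P)" "cone_weight (\<lambda>j r. of_bool (r \<in> {0..-P}))"
      unfolding cone_weight_def strip_weight_def using P by (auto simp: of_bool_def intro!: exI [of _ P])
    from hecke_sum_add [OF N \<tau> this, of "\<lambda>j r. of_bool (r \<in> {-P<..<0})"]
    have "hecke_sum N 1 P i \<tau> (\<lambda>j r. of_bool (r \<in> {-P<..<0})) =
        hecke_sum N 1 P i \<tau> (strip_weight P) + hecke_sum N 1 P i \<tau> (\<lambda>j r. of_bool (r \<in> {0..-P}))"
      by (simp add: strip_weight_def)
    then have "c * hecke_theta N 1 P i \<tau> =
        c * hecke_sum N 1 P i \<tau> wedge_weight1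
        + c * hecke_sum N 1 P i \<tau> (wedge_weight2 P)
        + \<Theta> * ((\<Sum>r\<in>{-p<..<p}. c * qpow \<tau> (- (of_int N / 2 * (of_int r + \<kappa>)\<^sup>2))) - (\<Sum>r\<in>{p..-p}. c * qpow \<tau> (- (of_int N / 2 * (of_int r + \<kappa>)\<^sup>2))))"
      unfolding hecke_theta_decompose [OF N \<tau> P] b3 b4 right_diff_distrib strip [OF finite_greaterThanLessThan_int] strip [OF finite_atLeastAtMost_int]
      by (simp add: distrib_left)
    also have "\<dots> = g3 (of_int N / 2) p (of_int (2 * i + 1) / 2) \<tau>"
      unfolding g3_def if_P [OF lt] powi_minus_one frac_shifts [OF N] gbeta_eq [OF N] P_def [symmetric] a_def [symmetric]
        c_def [symmetric] \<kappa>_def [symmetric] b1 b2 sq by (simp add: \<Theta>_def P_def)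
    finally show ?thesis
      using lt by (simp add: c cfac_def P_def)
  next
    case True
    then have nlt: "\<not> real_of_int (2 * i + 1) / 2 < of_int N / 2" by simp
    have \<kappa>: "\<kappa> = 1 / 2" using N by (simp add: \<kappa>_def True)
    have b1: "bracket (\<lambda>j r. 0 < r \<and> r \<le> j) (\<lambda>j r. j < r \<and> r \<le> 0)
         (\<lambda>j r. msign j * qpow \<tau> ((of_int N / 2 + 1 / 2) * (of_int j + a)\<^sup>2 - of_int N / 2 * (of_int r - 1 / 2 + of_int p)\<^sup>2)) =
        1 * hecke_sum N 1 P i \<tau> wedge_weight1"
    proof (rule bracket_wedge_boundary [OF N \<tau>])
      fix j r :: int
      have "of_int (r + 1) - 1 / 2 + of_int p = of_int r + of_int p + \<kappa>" by (simp add: \<kappa>)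
      then show "msign j * qpow \<tau> ((of_int N / 2 + 1 / 2) * (of_int j + a)\<^sup>2 - of_int N / 2 * (of_int (r + 1) - 1 / 2 + of_int p)\<^sup>2) =
          1 * (msign (1 * j + (1 + 1) * r) * qpow \<tau> (hecke_exponent N P i j r))"
        unfolding E sgn by (simp only: mult_1)
    qed
    have b3: "c * (\<Sum>r\<in>{1..p}. qpow \<tau> (- (of_int N / 2 / 4) * (2 * of_int r - 1)\<^sup>2)) =
        (\<Sum>r\<in>{-p..-1}. c * qpow \<tau> (- (of_int N / 2 * (of_int r + of_int p + \<kappa>)\<^sup>2)))"
      unfolding sum_distrib_left
    proof (rule sum.reindex_bij_witness [of _ "\<lambda>r. r + p + 1" "\<lambda>r. r - p - 1"])
      fix r
      have "of_int (r - p - 1) + of_int p + \<kappa> = (2 * of_int r - 1) / 2" by (simp add: \<kappa>)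
      then show "c * qpow \<tau> (- (of_int N / 2 * (of_int (r - p - 1) + of_int p + \<kappa>)\<^sup>2)) = c * qpow \<tau> (- (of_int N / 2 / 4) * (2 * of_int r - 1)\<^sup>2)"
        by (simp only: power_divide) simp
    qed auto
    \<comment> \<open>The rows from \<open>- 2 * p\<close> to \<open>- 1\<close> are those from
      \<open>- p\<close> to \<open>- 1\<close> together with their mirror images, which have the
      same sum. So the theta term of \<open>g3\<close> at k = m runs over half the rows and carries
      no factor 1/2.\<close>
    have "cone_weight (\<lambda>j r. of_bool (r \<in> {-p..-1}))" "cone_weight (\<lambda>j r. of_bool (- r - P - 1 \<in> {-p..-1}))"
      unfolding cone_weight_def using p by (auto simp: of_bool_def P_def intro!: exI [of _ "2 * p + 1"])
    then have "hecke_sum N 1 P i \<tau> (\<lambda>j r. of_bool (- P \<le> r \<and> r \<le> - 1)) =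
        hecke_sum N 1 P i \<tau> (\<lambda>j r. of_bool (r \<in> {-p..-1})) + hecke_sum N 1 P i \<tau> (\<lambda>j r. of_bool (- r - P - 1 \<in> {-p..-1}))"
      by (rule hecke_sum_add [OF N \<tau>]) (use p in \<open>auto simp: of_bool_def P_def\<close>)
    also have "hecke_sum N 1 P i \<tau> (\<lambda>j r. of_bool (- r - P - 1 \<in> {-p..-1})) = hecke_sum N 1 P i \<tau> (\<lambda>j r. of_bool (r \<in> {-p..-1}))"
      by (rule hecke_sum_reflect [OF N True, symmetric]) simp
    finally have "hecke_sum N 1 P i \<tau> (\<lambda>j r. of_bool (- P \<le> r \<and> r \<le> - 1)) = 2 * hecke_sum N 1 P i \<tau> (\<lambda>j r. of_bool (r \<in> {-p..-1}))"
      by simp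
    then have "c / 2 * hecke_theta N 1 P i \<tau> =
        c * (1 * hecke_sum N 1 P i \<tau> wedge_weight1)
        + \<Theta> * (c * (\<Sum>r\<in>{1..p}. qpow \<tau> (- (of_int N / 2 / 4) * (2 * of_int r - 1)\<^sup>2)))"
      unfolding b3 strip [OF finite_atLeastAtMost_int]
      by (subst hecke_theta_decompose_boundary [OF N \<tau> P True]) (simp_all add: distrib_left)
    also have "\<dots> = g3 (of_int N / 2) p (of_int (2 * i + 1) / 2) \<tau>"
    proof -
      have c': "exp (of_real pi * \<i> * of_real (real_of_int N / 2)) = c" by (simp add: c_def True)
      show ?thesis
        unfolding g3_def if_not_P [OF nlt] powi_minus_one gbeta_eq [OF N] P_def [symmetric] a_def [symmetric] c' b1
        by (simp add: \<Theta>_def P_def mult_ac)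
    qed
    finally show ?thesis
      using nlt by (simp add: c cfac_def P_def)
  qed
qed



section \<open>Fourth roots of unity and the explicit constants\<close>

lemma cis_half_pi_int_cong:
  assumes "4 dvd a - b"
  shows "cis (pi / 2 * of_int a) = cis (pi / 2 * of_int b)"
proof -
  obtain k where "a - b = 4 * k" using assms by blast
  then have a: "a = b + 4 * k" by simp
  have "cis (pi / 2 * of_int a) = cis (pi / 2 * of_int b) * cis (2 * pi * of_int k)"
    unfolding cis_mult a by (simp add: algebra_simps add_divide_distrib)
  then show ?thesis
    by (simp add: cis_multiple_2pi)
qed

lemma cis_half_pi_int_values:
  "cis (pi / 2 * of_int 1) = \<i>" "cis (pi / 2 * of_int 2) = - 1" "cis (pi / 2 * of_int 3) = - \<i>"
  "cis (pi / 2 * of_int (2 * p)) = msign p"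
proof -
  show 1: "cis (pi / 2 * of_int 1) = \<i>" by simp
  show 4: "cis (pi / 2 * of_int (2 * p)) = msign p" for p
    unfolding cis_pi_int [symmetric] by simp
  from 4 [of 1] show 2: "cis (pi / 2 * of_int 2) = - 1" by (simp add: msign_def)
  have "cis (pi / 2 * of_int 3) = cis (pi / 2 * of_int 1) * cis (pi / 2 * of_int 2)"
    unfolding cis_mult by (simp add: algebra_simps)
  then show "cis (pi / 2 * of_int 3) = - \<i>" unfolding 1 2 by simp
qed

lemma cis_half_pi_int_mult: "cis (pi / 2 * of_int a) * cis (pi / 2 * of_int b) = cis (pi / 2 * of_int (a + b))"
  by (simp add: cis_mult distrib_left)

text \<open>The first factor is the exponential of the S-transformation formulas. The second is a
  power of i, so matching the constants becomes a congruence modulo 4.\<close>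

lemma S_phase_split:
  "cis (pi * (S_phase N P P' i + of_int ((2 * l + 1) * P) / 2)) =
    cis (- (pi * of_int (P * P') / (2 * (of_int N + 1)))) * cis (pi / 2 * of_int (P * P' + P' * (2 * i + 1) + (2 * l + 1) * P))"
proof -
  have "pi * (- x / y + z / 2 + w / 2) = - (pi * x / y) + pi / 2 * (z + w)" for x y z w
    by (simp add: algebra_simps add_divide_distrib)
  then show ?thesis
    unfolding cis_mult S_phase_def of_int_add [of "P * P' + P' * (2 * i + 1)" "(2 * l + 1) * P"] by (simp only:)
qed

lemma sum_half_odd:
  fixes f :: "real \<Rightarrow> complex"
  assumes "N = 2 * M + 1"
  shows "(\<Sum>l | l \<in> half_odd_ints \<and> 0 < l \<and> l \<le> of_int N / 2. f l) = (\<Sum>l\<in>{0..M}. f (of_int (2 * l + 1) / 2))"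
proof (rule sum.reindex_bij_witness [of _ "\<lambda>l. of_int (2 * l + 1) / 2" floor])
  fix x assume x: "x \<in> {l. l \<in> half_odd_ints \<and> 0 < l \<and> l \<le> of_int N / 2}"
  then obtain n where n: "x = of_int n / 2" "odd n" by (auto simp: half_odd_ints_def)
  then obtain k where k: "n = 2 * k + 1" using oddE by blast
  have xk: "x = of_int k + 1 / 2" using n k by simp
  then have fl: "\<lfloor>x\<rfloor> = k" by linarith
  show "real_of_int (2 * \<lfloor>x\<rfloor> + 1) / 2 = x"
    unfolding fl xk by simp
  then show "f (real_of_int (2 * \<lfloor>x\<rfloor> + 1) / 2) = f x"
    by simp
  have "0 < real_of_int (2 * k + 1)" "real_of_int (2 * k + 1) \<le> of_int N"
    using x n k by auto
  then have "0 < 2 * k + 1" "2 * k + 1 \<le> N"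
    by (simp_all only: of_int_0_less_iff of_int_le_iff)
  then show "\<lfloor>x\<rfloor> \<in> {0..M}" unfolding fl using assms by simp
next
  fix l assume l: "l \<in> {0..M}"
  have "real_of_int (2 * l + 1) / 2 = of_int l + 1 / 2" by simp
  then show "\<lfloor>real_of_int (2 * l + 1) / 2\<rfloor> = l" by linarith
  have "real_of_int (2 * l + 1) \<le> of_int N" unfolding of_int_le_iff using l assms by simp
  moreover have "0 < real_of_int (2 * l + 1)" unfolding of_int_0_less_iff using l by simp
  ultimately show "real_of_int (2 * l + 1) / 2 \<in> {l. l \<in> half_odd_ints \<and> 0 < l \<and> l \<le> of_int N / 2}"
    by (auto simp: half_odd_ints_def intro!: exI [of _ "2 * l + 1"])
qed

text \<open>The part common to the three S-formulas; what remains in \<open>key\<close> is one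
  identity between fourth roots of unity. The 2 of the sine cancels against sqrt(N(N + 1)) = 2
  sqrt(m(m + 1/2)), and the halving in \<open>S_coeff\<close> is the normalization of the function
  with index \<open>l\<close>.\<close>

lemma hecke_theta_S_sum:
  fixes M N e P i :: int and c :: real and d u :: complex
  assumes M: "M \<ge> 0" and N: "N = 2 * M + 1" and odd: "odd P \<or> odd e" and \<tau>: "Im \<tau> > 0"
    and key: "\<And>p l. p \<in> {0..N} \<Longrightarrow> l \<in> {0..M} \<Longrightarrow>
      u * cis (pi * (S_phase N P (2 * p + e) i + of_int ((2 * l + 1) * P) / 2)) * \<i> *
        (hecke_theta N P (2 * p + e) l \<tau> / of_real (cfac (of_int N / 2) (of_int (2 * l + 1) / 2))) = d * v p * g p l"
  shows "u / of_real c * hecke_theta N e P i (- 1 / \<tau>) =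
    d * \<tau> / of_real (c * sqrt (of_int N / 2 * (of_int N / 2 + 1 / 2))) *
    (\<Sum>l\<in>{0..M}. \<Sum>p\<in>{0..N}. v p * of_real (sin (pi * (of_int (2 * i + 1) / 2) * (of_int (2 * l + 1) / 2) / (of_int N / 2))) * g p l)"
proof -
  have N0: "N > 0" using M N by simp
  define R where "R = sqrt (of_int N / 2 * (of_int N / 2 + 1 / 2))"
  have "sqrt (of_int N * (of_int N + 1)) = sqrt (4 * (of_int N / 2 * (of_int N / 2 + 1 / 2)))"
    by (simp add: field_simps)
  also have "\<dots> = 2 * R"
    unfolding R_def real_sqrt_mult [of 4] by simp
  finally have R: "sqrt (of_int N * (of_int N + 1)) = 2 * R" .
  have t: "u * S_coeff N P (2 * p + e) i l * hecke_theta N P (2 * p + e) l \<tau> =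
      2 * (d * (v p * of_real (sin (pi * (of_int (2 * i + 1) / 2) * (of_int (2 * l + 1) / 2) / (of_int N / 2))) * g p l))"
    if "p \<in> {0..N}" "l \<in> {0..M}" for p l
  proof -
    have s: "pi * (of_int (2 * i + 1) / 2) * (of_int (2 * l + 1) / 2) / (of_int N / 2) =
        pi * of_int ((2 * i + 1) * (2 * l + 1)) / (2 * of_int N)"
      using N0 by (simp add: field_simps)
    have cf: "complex_of_real (cfac (of_int N / 2) (of_int (2 * l + 1) / 2)) = (if 2 * l + 1 = N then 2 else 1)"
    proof -
      have "real_of_int (2 * l + 1) / 2 < of_int N / 2 \<longleftrightarrow> 2 * l + 1 \<noteq> N"
        using that N by auto
      then show ?thesis by (simp add: cfac_def)
    qed
    have "u * S_coeff N P (2 * p + e) i l * hecke_theta N P (2 * p + e) l \<tau> =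
        2 * of_real (sin (pi * of_int ((2 * i + 1) * (2 * l + 1)) / (2 * of_int N))) *
        (u * cis (pi * (S_phase N P (2 * p + e) i + of_int ((2 * l + 1) * P) / 2)) * \<i> *
        (hecke_theta N P (2 * p + e) l \<tau> / of_real (cfac (of_int N / 2) (of_int (2 * l + 1) / 2))))"
      unfolding S_coeff_def cf by simp
    then show ?thesis
      unfolding key [OF that] s by simp
  qed
  have "u / of_real c * hecke_theta N e P i (- 1 / \<tau>) =
      \<tau> / (of_real c * of_real (2 * R)) * (\<Sum>p\<in>{0..N}. \<Sum>l\<in>{0..M}. u * S_coeff N P (2 * p + e) i l * hecke_theta N P (2 * p + e) l \<tau>)"
    unfolding hecke_theta_S [OF M N odd \<tau>] R by (simp add: sum_distrib_left mult_ac)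
  also have "(\<Sum>p\<in>{0..N}. \<Sum>l\<in>{0..M}. u * S_coeff N P (2 * p + e) i l * hecke_theta N P (2 * p + e) l \<tau>) =
     (\<Sum>p\<in>{0..N}. \<Sum>l\<in>{0..M}. 2 * (d * (v p * of_real (sin (pi * (of_int (2 * i + 1) / 2) * (of_int (2 * l + 1) / 2) / (of_int N / 2))) * g p l)))"
    by (intro sum.cong refl t)
  also have "\<dots> = 2 * (d * (\<Sum>l\<in>{0..M}. \<Sum>p\<in>{0..N}. v p * of_real (sin (pi * (of_int (2 * i + 1) / 2) * (of_int (2 * l + 1) / 2) / (of_int N / 2))) * g p l))"
    unfolding sum_distrib_left by (rule sum.swap)
  finally show ?thesis
    unfolding R_def [symmetric] by (simp add: mult_ac)
qed

lemma phase_rearrange: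
  fixes u V Q s H C d W :: complex
  assumes "u * Q * s = d * W"
  shows "u * (V * Q) * s * (H / C) = d * V * (W / C * H)"
proof -
  have "u * (V * Q) * s * (H / C) = V * (u * Q * s) * (H / C)"
    by (simp add: mult_ac)
  then show ?thesis
    unfolding assms by (simp add: mult_ac)
qed

theorem theorem8p1:
  fixes m j :: real and p :: int and \<tau> :: complex
  assumes "m \<in> half_odd_nats" and "j \<in> half_odd_nats"
    and "0 \<le> p" and "real_of_int p \<le> 2 * m"
    and "0 < j" and "j \<le> m"
    and "Im \<tau> > 0"
  shows
    "g1 m p j (- 1 / \<tau>) =
       \<tau> / of_real (cfac m j * sqrt (m * (m + 1/2)))
       * (\<Sum>l | l \<in> half_odd_ints \<and> 0 < l \<and> l \<le> m. \<Sum>p'\<in>{0..\<lfloor>2 * m\<rfloor>}.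
            exp (- (of_real pi * \<i> / of_real (2 * (2 * m + 1)) * of_int ((2 * p + 1) * (2 * p' + 1))))
            * of_real (sin (pi * j * l / m)) * g1 m p' l \<tau>) \<and>
     g2 m p j (- 1 / \<tau>) =
       \<i> * \<tau> / of_real (cfac m j * sqrt (m * (m + 1/2)))
       * (\<Sum>l | l \<in> half_odd_ints \<and> 0 < l \<and> l \<le> m. \<Sum>p'\<in>{0..\<lfloor>2 * m\<rfloor>}.
            exp (- (of_real pi * \<i> / of_real (2 * m + 1) * of_int ((2 * p + 1) * p')))
            * of_real (sin (pi * j * l / m)) * g3 m p' l \<tau>) \<and>
     g3 m p j (- 1 / \<tau>) =
       - \<i> * \<tau> / of_real (cfac m j * sqrt (m * (m + 1/2)))
       * (\<Sum>l | l \<in> half_odd_ints \<and> 0 < l \<and> l \<le> m. \<Sum>p'\<in>{0..\<lfloor>2 * m\<rfloor>}.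
            exp (- (of_real pi * \<i> / of_real (2 * m + 1) * of_int (p * (2 * p' + 1))))
            * of_real (sin (pi * j * l / m)) * g2 m p' l \<tau>) \<and>
     g1 m p j (\<tau> + 1) =
       exp (of_real pi * \<i> * of_int ((2 * p + 1)\<^sup>2) / of_real (4 * (2 * m + 1))
            - of_real pi * \<i> * of_real (j\<^sup>2) / of_real (2 * m) - of_real pi * \<i> / 4)
       * g2 m p j \<tau> \<and>
     g2 m p j (\<tau> + 1) =
       - exp (of_real pi * \<i> * of_int ((2 * p + 1)\<^sup>2) / of_real (4 * (2 * m + 1))
            - of_real pi * \<i> * of_real (j\<^sup>2) / of_real (2 * m) - of_real pi * \<i> / 4)
       * g1 m p j \<tau> \<and>
     g3 m p j (\<tau> + 1) =
       exp (of_real pi * \<i> * of_int (p\<^sup>2) / of_real (2 * m + 1)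
            - of_real pi * \<i> * of_real (j\<^sup>2) / of_real (2 * m))
       * g3 m p j \<tau>"
proof -
  obtain N where N: "m = of_int N / 2" "odd N" "0 < N"
    using assms(1) by (auto simp: half_odd_nats_def)
  then obtain M where M: "N = 2 * M + 1" using oddE by blast
  then have M0: "M \<ge> 0" using N by simp
  obtain k where k: "j = of_int k / 2" "odd k" "0 < k"
    using assms(2) by (auto simp: half_odd_nats_def)
  then obtain i where i: "k = 2 * i + 1" using oddE by blast
  have j: "j = of_int (2 * i + 1) / 2" using k(1) i by simp
  have i0: "0 \<le> i" using k i by simp
  have "real_of_int k \<le> of_int N" using assms(6) k(1) N(1) by simp
  then have iN: "2 * i + 1 \<le> N" unfolding of_int_le_iff i .
  have fl: "\<lfloor>2 * m\<rfloor> = N" unfolding N(1) by simp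
  note \<tau> = assms(7)
  have S\<tau>: "Im (- 1 / \<tau>) > 0"
    using \<tau> by (auto simp: Im_divide power2_eq_square intro!: divide_pos_pos add_nonneg_pos)
  have T\<tau>: "Im (\<tau> + 1) > 0" using \<tau> by simp
  define c where "c = cfac (of_int N / 2) (of_int (2 * i + 1) / 2)"
  note g1 = g1_eq_hecke_theta [OF N(3)] and g2 = g2_eq_hecke_theta [OF N(3)] and g3 = g3_eq_hecke_theta [OF N(3)]
  have l: "0 \<le> l" "2 * l + 1 \<le> N" if "l \<in> {0..M}" for l
    using that M by auto
  have par: "hecke_theta N (2 * p + 1) P i \<tau> = hecke_theta N 1 P i \<tau>" "hecke_theta N (2 * p) P i \<tau> = hecke_theta N 0 P i \<tau>" for p P i
    by (rule hecke_theta_parity; simp)+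
  have v: "exp (- (of_real pi * \<i> / of_real (2 * (2 * (of_int N / 2) + 1)) * of_int X)) = cis (- (pi * of_int X / (2 * (of_int N + 1))))"
    "exp (- (of_real pi * \<i> / of_real (2 * (of_int N / 2) + 1) * of_int X)) = cis (- (pi * of_int (2 * X) / (2 * (of_int N + 1))))" for X
  proof -
    have "pi * (2 * x) / (2 * y) = pi * x / y" for x y by simp
    then have "pi * of_int (2 * X) / (2 * (of_int N + 1)) = pi * of_int X / (of_int N + 1)"
      by (simp only: of_int_mult of_int_numeral)
    then show "exp (- (of_real pi * \<i> / of_real (2 * (of_int N / 2) + 1) * of_int X)) = cis (- (pi * of_int (2 * X) / (2 * (of_int N + 1))))"
      by (simp only:) (simp add: cis_conv_exp mult_ac)
    show "exp (- (of_real pi * \<i> / of_real (2 * (2 * (of_int N / 2) + 1)) * of_int X)) = cis (- (pi * of_int X / (2 * (of_int N + 1))))"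
      by (simp add: cis_conv_exp mult_ac)
  qed
  have cis\<kappa>: "cis (pi * (of_int z / 2)) = cis (pi / 2 * of_int z)" for z by simp
  note S = hecke_theta_S_sum [OF M0 M _ \<tau>]
  have S1: "g1 m p j (- 1 / \<tau>) =
       \<tau> / of_real (cfac m j * sqrt (m * (m + 1/2)))
       * (\<Sum>l | l \<in> half_odd_ints \<and> 0 < l \<and> l \<le> m. \<Sum>p'\<in>{0..\<lfloor>2 * m\<rfloor>}.
            exp (- (of_real pi * \<i> / of_real (2 * (2 * m + 1)) * of_int ((2 * p + 1) * (2 * p' + 1))))
            * of_real (sin (pi * j * l / m)) * g1 m p' l \<tau>)"
    unfolding fl unfolding N(1) j sum_half_odd [OF M] g1 [OF S\<tau> assms(3) i0 iN] v c_def [symmetric]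
  proof (rule S [where d = 1, simplified mult_1])
    fix p' l assume p': "p' \<in> {0..N}" and l': "l \<in> {0..M}"
    then have p0: "0 \<le> p'" by simp
    \<comment> \<open>Exponents of i on both sides, compared modulo 4; the witness is the quotient
      by 4.\<close>
    have "4 dvd ((2 * i + 1) + ((2 * p + 1) * (2 * p' + 1) + (2 * p' + 1) * (2 * i + 1) + (2 * l + 1) * (2 * p + 1)) + 1) - (2 * l + 1)"
      by (rule dvdI [of _ _ "i * (p' + 1) + l * p + p * p' + p + p' + 1"]) (simp add: algebra_simps)
    from cis_half_pi_int_cong [OF this]
    have ph: "cis (pi / 2 * of_int (2 * i + 1)) * cis (pi / 2 * of_int ((2 * p + 1) * (2 * p' + 1) + (2 * p' + 1) * (2 * i + 1) + (2 * l + 1) * (2 * p + 1))) * \<i>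
        = cis (pi / 2 * of_int (2 * l + 1))"
      unfolding cis_half_pi_int_values(1) [symmetric] cis_half_pi_int_mult .
    show "cis (pi * (of_int (2 * i + 1) / 2)) * cis (pi * (S_phase N (2 * p + 1) (2 * p' + 1) i + of_int ((2 * l + 1) * (2 * p + 1)) / 2)) * \<i> *
        (hecke_theta N (2 * p + 1) (2 * p' + 1) l \<tau> / of_real (cfac (of_int N / 2) (of_int (2 * l + 1) / 2))) =
        cis (- (pi * of_int ((2 * p + 1) * (2 * p' + 1)) / (2 * (of_int N + 1)))) * g1 (of_int N / 2) p' (of_int (2 * l + 1) / 2) \<tau>"
      unfolding g1 [OF \<tau> p0 l [OF l']] par cis\<kappa> S_phase_split
      by (rule phase_rearrange [where d = 1, unfolded mult_1, OF ph])
  qed simp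
  have S2: "g2 m p j (- 1 / \<tau>) =
       \<i> * \<tau> / of_real (cfac m j * sqrt (m * (m + 1/2)))
       * (\<Sum>l | l \<in> half_odd_ints \<and> 0 < l \<and> l \<le> m. \<Sum>p'\<in>{0..\<lfloor>2 * m\<rfloor>}.
            exp (- (of_real pi * \<i> / of_real (2 * m + 1) * of_int ((2 * p + 1) * p')))
            * of_real (sin (pi * j * l / m)) * g3 m p' l \<tau>)"
    unfolding fl unfolding N(1) j sum_half_odd [OF M] g2 [OF S\<tau> assms(3) i0 iN] v c_def [symmetric]
  proof (rule S)
    fix p' l assume p': "p' \<in> {0..N}" and l': "l \<in> {0..M}"
    then have p0: "0 \<le> p'" by simp
    have "4 dvd (2 * p + ((2 * p + 1) * (2 * p' + 0) + (2 * p' + 0) * (2 * i + 1) + (2 * l + 1) * (2 * p + 1)) + 1) - (1 + (2 * l + 1))"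
      by (rule dvdI [of _ _ "p + p * p' + p' + p' * i + l * p"]) (simp add: algebra_simps)
    from cis_half_pi_int_cong [OF this]
    have ph: "msign p * cis (pi / 2 * of_int ((2 * p + 1) * (2 * p' + 0) + (2 * p' + 0) * (2 * i + 1) + (2 * l + 1) * (2 * p + 1))) * \<i>
        = \<i> * cis (pi / 2 * of_int (2 * l + 1))"
      unfolding cis_half_pi_int_values(1,4) [symmetric] cis_half_pi_int_mult .
    \<comment> \<open>The summand 0 is the value of \<open>e\<close> for \<open>g2\<close>, kept so
      that the general pattern \<open>2 * p + e\<close> matches.\<close>
    have X: "2 * ((2 * p + 1) * p') = (2 * p + 1) * (2 * p' + 0)" "2 * p' + 0 = 2 * p'" by simp_all
    show "msign p * cis (pi * (S_phase N (2 * p + 1) (2 * p' + 0) i + of_int ((2 * l + 1) * (2 * p + 1)) / 2)) * \<i> *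
        (hecke_theta N (2 * p + 1) (2 * p' + 0) l \<tau> / of_real (cfac (of_int N / 2) (of_int (2 * l + 1) / 2))) =
        \<i> * cis (- (pi * of_int (2 * ((2 * p + 1) * p')) / (2 * (of_int N + 1)))) * g3 (of_int N / 2) p' (of_int (2 * l + 1) / 2) \<tau>"
      unfolding g3 [OF \<tau> p0 l [OF l']] par cis\<kappa> S_phase_split X(1)
      using phase_rearrange [OF ph] by (simp only: X(2))
  qed simp
  have S3: "g3 m p j (- 1 / \<tau>) =
       - \<i> * \<tau> / of_real (cfac m j * sqrt (m * (m + 1/2)))
       * (\<Sum>l | l \<in> half_odd_ints \<and> 0 < l \<and> l \<le> m. \<Sum>p'\<in>{0..\<lfloor>2 * m\<rfloor>}.
            exp (- (of_real pi * \<i> / of_real (2 * m + 1) * of_int (p * (2 * p' + 1))))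
            * of_real (sin (pi * j * l / m)) * g2 m p' l \<tau>)"
    unfolding fl unfolding N(1) j sum_half_odd [OF M] g3 [OF S\<tau> assms(3) i0 iN] v c_def [symmetric]
  proof (rule S)
    fix p' l assume p': "p' \<in> {0..N}" and l': "l \<in> {0..M}"
    then have p0: "0 \<le> p'" by simp
    \<comment> \<open>The remaining exponent \<open>3 + 2 * p'\<close> splits into the constant -i
      of the formula and the sign (-1)^p' in the normalization of \<open>g2\<close>.\<close>
    have "4 dvd ((2 * i + 1) + ((2 * p) * (2 * p' + 1) + (2 * p' + 1) * (2 * i + 1) + (2 * l + 1) * (2 * p)) + 1) - (3 + 2 * p')"
      by (rule dvdI [of _ _ "i * p' + i + p * p' + p + l * p"]) (simp add: algebra_simps)
    from cis_half_pi_int_cong [OF this]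
    have "cis (pi / 2 * of_int (2 * i + 1)) * cis (pi / 2 * of_int ((2 * p) * (2 * p' + 1) + (2 * p' + 1) * (2 * i + 1) + (2 * l + 1) * (2 * p))) * \<i>
        = cis (pi / 2 * of_int (3 + 2 * p'))"
      unfolding cis_half_pi_int_values(1) [symmetric] cis_half_pi_int_mult .
    also have "\<dots> = - \<i> * msign p'"
      by (simp only: cis_half_pi_int_mult [symmetric] cis_half_pi_int_values)
    finally have ph: "cis (pi / 2 * of_int (2 * i + 1)) * cis (pi / 2 * of_int ((2 * p) * (2 * p' + 1) + (2 * p' + 1) * (2 * i + 1) + (2 * l + 1) * (2 * p))) * \<i>
        = - \<i> * msign p'" .
    have X: "2 * (p * (2 * p' + 1)) = 2 * p * (2 * p' + 1)" by simp
    show "cis (pi * (of_int (2 * i + 1) / 2)) * cis (pi * (S_phase N (2 * p) (2 * p' + 1) i + of_int ((2 * l + 1) * (2 * p)) / 2)) * \<i> *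
        (hecke_theta N (2 * p) (2 * p' + 1) l \<tau> / of_real (cfac (of_int N / 2) (of_int (2 * l + 1) / 2))) =
        - \<i> * cis (- (pi * of_int (2 * (p * (2 * p' + 1))) / (2 * (of_int N + 1)))) * g2 (of_int N / 2) p' (of_int (2 * l + 1) / 2) \<tau>"
      unfolding g2 [OF \<tau> p0 l [OF l']] par cis\<kappa> S_phase_split X
      by (rule phase_rearrange [OF ph])
  qed simp
  have T: "hecke_theta N e P i (\<tau> + 1) = cis (pi * T_phase N P i) * hecke_theta N (e + P) P i \<tau>" for e P
    by (rule hecke_theta_T [OF N(3,2)])
  define B where "B = cis (pi * (of_int ((2 * p + 1)\<^sup>2) / (4 * (of_int N + 1)) - of_int ((2 * i + 1)\<^sup>2) / (4 * of_int N) - 1 / 4))"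
  have sq: "(of_int (2 * i + 1) / 2 :: real)\<^sup>2 / (2 * (of_int N / 2)) = of_int ((2 * i + 1)\<^sup>2) / (4 * of_int N)"
    by (simp add: power_divide)
  have y: "2 * (real_of_int N / 2) + 1 = of_int N + 1" by simp
  have E: "exp (of_real pi * \<i> * of_int ((2 * p + 1)\<^sup>2) / of_real (4 * (2 * (of_int N / 2) + 1))
            - of_real pi * \<i> * of_real ((of_int (2 * i + 1) / 2)\<^sup>2) / of_real (2 * (of_int N / 2)) - of_real pi * \<i> / 4) = B"
  proof -
    have "of_real pi * \<i> * of_int x / of_real y - of_real pi * \<i> * of_real z / of_real w - of_real pi * \<i> / 4 =
        \<i> * complex_of_real (pi * (of_int x / y - z / w - 1 / 4))" for x y z w
      by (simp add: right_diff_distrib mult_ac)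
    then show ?thesis
      unfolding B_def sq [symmetric] cis_conv_exp y by (rule arg_cong)
  qed
  have par2: "hecke_theta N (1 + (2 * p + 1)) P i \<tau> = hecke_theta N 0 P i \<tau>" "hecke_theta N (0 + (2 * p + 1)) P i \<tau> = hecke_theta N 1 P i \<tau>"
    "hecke_theta N (1 + 2 * p) P i \<tau> = hecke_theta N 1 P i \<tau>" for P
    by (rule hecke_theta_parity; simp)+
  \<comment> \<open>The term -1/4 in \<open>B\<close> absorbs the residue of the odd square
    \<open>(2 * p + 1)^2\<close> modulo 4, so the rest of the phase is a power of i.\<close>
  have Tp: "cis (pi * T_phase N (2 * p + 1) i) = B * cis (pi / 2 * of_int (- (2 * p * (p + 1) + (2 * p + 1) * (2 * i + 1))))"
    unfolding B_def cis_mult by (rule arg_cong [of _ _ cis]) (simp add: T_phase_def power2_eq_square algebra_simps add_divide_distrib)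
  have T1: "cis (pi / 2 * of_int (2 * i + 1)) * cis (pi * T_phase N (2 * p + 1) i) = B * msign p"
  proof -
    \<comment> \<open>Divisibility by 4 rather than 2 comes from the evenness of
      \<open>p * (p + 3)\<close>.\<close>
    obtain q where q: "p * (p + 3) = 2 * q"
      using evenE [of "p * (p + 3)"] by auto
    have "4 dvd ((2 * i + 1) + - (2 * p * (p + 1) + (2 * p + 1) * (2 * i + 1))) - 2 * p"
    proof (rule dvdI)
      have "((2 * i + 1) + - (2 * p * (p + 1) + (2 * p + 1) * (2 * i + 1))) - 2 * p = - 4 * p * i - 2 * (p * (p + 3))"
        by (simp add: algebra_simps)
      also have "\<dots> = 4 * (- p * i - q)" unfolding q by simp
      finally show "((2 * i + 1) + - (2 * p * (p + 1) + (2 * p + 1) * (2 * i + 1))) - 2 * p = 4 * (- p * i - q)" .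
    qed
    from cis_half_pi_int_cong [OF this] show ?thesis
      unfolding Tp cis_half_pi_int_values(4) [symmetric] mult.left_commute [of _ B] cis_half_pi_int_mult by (simp only:)
  qed
  have T2: "msign p * cis (pi * T_phase N (2 * p + 1) i) = - B * cis (pi / 2 * of_int (2 * i + 1))"
  proof -
    obtain q where q: "p * (p + 1) = 2 * q"
      using evenE [of "p * (p + 1)"] by auto
    have "4 dvd (2 * p + - (2 * p * (p + 1) + (2 * p + 1) * (2 * i + 1))) - (2 + (2 * i + 1))"
    proof (rule dvdI)
      have "(2 * p + - (2 * p * (p + 1) + (2 * p + 1) * (2 * i + 1))) - (2 + (2 * i + 1)) = - 4 * i * (p + 1) - 4 - 2 * (p * (p + 1))"
        by (simp add: algebra_simps)
      also have "\<dots> = 4 * (- i * (p + 1) - 1 - q)" unfolding q by simp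
      finally show "(2 * p + - (2 * p * (p + 1) + (2 * p + 1) * (2 * i + 1))) - (2 + (2 * i + 1)) = 4 * (- i * (p + 1) - 1 - q)" .
    qed
    from cis_half_pi_int_cong [OF this]
    have "msign p * cis (pi / 2 * of_int (- (2 * p * (p + 1) + (2 * p + 1) * (2 * i + 1)))) = - 1 * cis (pi / 2 * of_int (2 * i + 1))"
      unfolding cis_half_pi_int_values(2,4) [symmetric] cis_half_pi_int_mult .
    then show ?thesis
      unfolding Tp mult.left_commute [of _ B] by simp
  qed
  have T3: "cis (pi * T_phase N (2 * p) i) = exp (of_real pi * \<i> * of_int (p\<^sup>2) / of_real (2 * (of_int N / 2) + 1)
            - of_real pi * \<i> * of_real ((of_int (2 * i + 1) / 2)\<^sup>2) / of_real (2 * (of_int N / 2)))"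
  proof -
    have "of_real pi * \<i> * of_int x / of_real y - of_real pi * \<i> * of_real z / of_real w =
        \<i> * complex_of_real (pi * (of_int x / y - z / w))" for x y z w
      by (simp add: right_diff_distrib mult_ac)
    then have "exp (of_real pi * \<i> * of_int (p\<^sup>2) / of_real (2 * (of_int N / 2) + 1)
            - of_real pi * \<i> * of_real ((of_int (2 * i + 1) / 2)\<^sup>2) / of_real (2 * (of_int N / 2))) =
        cis (pi * (of_int (p\<^sup>2) / (of_int N + 1) - of_int ((2 * i + 1)\<^sup>2) / (4 * of_int N)))"
      unfolding sq [symmetric] cis_conv_exp y by (rule arg_cong)
    moreover have "cis (pi * T_phase N (2 * p) i) =
        cis (pi * (of_int (p\<^sup>2) / (of_int N + 1) - of_int ((2 * i + 1)\<^sup>2) / (4 * of_int N))) * cis (pi * of_int (- (p * (p + (2 * i + 1)))))"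
    proof -
      have "4 * x / (4 * y) = x / y" for x y :: real by simp
      moreover have "of_int ((2 * p)\<^sup>2) = 4 * real_of_int (p\<^sup>2)"
        by (simp add: power_mult_distrib)
      ultimately have 1: "of_int ((2 * p)\<^sup>2) / (4 * (of_int N + 1)) = real_of_int (p\<^sup>2) / (of_int N + 1)"
        by (simp only:)
      have "(2 * p)\<^sup>2 + 2 * (2 * p) * (2 * i + 1) = 4 * (p * (p + (2 * i + 1)))"
        by (simp add: power2_eq_square algebra_simps)
      then have 2: "real_of_int ((2 * p)\<^sup>2 + 2 * (2 * p) * (2 * i + 1)) / 4 = of_int (p * (p + (2 * i + 1)))"
        by (simp only: of_int_mult)
      have "pi * (x - w - z) = pi * (x - z) + pi * - w" for x w z
        by (simp add: algebra_simps)
      then show ?thesis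
        unfolding cis_mult T_phase_def 1 2 of_int_minus by (simp only:)
    qed
    \<comment> \<open>The factors \<open>p\<close> and \<open>p + (2 * i + 1)\<close> have opposite
      parity, so the product is even and no sign remains.\<close>
    moreover have "cis (pi * of_int (- (p * (p + (2 * i + 1))))) = 1"
      unfolding cis_pi_int by (simp add: msign_def)
    ultimately show ?thesis by simp
  qed
  have rearrange: "a / w * (b * h) = d * (e / w * h)" if "a * b = d * e" for a b d e w h :: complex
  proof -
    have "a / w * (b * h) = (a * b) / w * h" by simp
    then show ?thesis unfolding that by simp
  qed
  have "g1 m p j (\<tau> + 1) = B * g2 m p j \<tau>"
    unfolding N(1) j g1 [OF T\<tau> assms(3) i0 iN] g2 [OF \<tau> assms(3) i0 iN] T par2 cis\<kappa>
    by (rule rearrange [OF T1])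
  moreover have "g2 m p j (\<tau> + 1) = - B * g1 m p j \<tau>"
    unfolding N(1) j g1 [OF \<tau> assms(3) i0 iN] g2 [OF T\<tau> assms(3) i0 iN] T par2 cis\<kappa>
    by (rule rearrange [OF T2])
  moreover have "g3 m p j (\<tau> + 1) = cis (pi * T_phase N (2 * p) i) * g3 m p j \<tau>"
    unfolding N(1) j g3 [OF \<tau> assms(3) i0 iN] g3 [OF T\<tau> assms(3) i0 iN] T par2 by (simp add: mult_ac)
  ultimately show ?thesis
    using S1 S2 S3 unfolding E [symmetric, folded N(1) j] T3 [folded N(1) j] by blast
qed

end
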